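(* The norm of $J_\sigma(\mathcal R)^*$ satisfies $$\|A\|=\sup\{\|\pi(A)\| : \pi\in\mathcal R\}\qquad\text{for } A\in J_\sigma(\mathcal R)^*.$$ This is a C*-norm, hence $J_\sigma(\mathcal R)^*$ is a C*-algebra, and so is every d-ideal in $J_\sigma(\mathcal R)^*$.
   Context: $G$ is a topological group with a fixed nondiscrete Hausdorff topology, $G_d$ is $G$ with the discrete topology, and $\sigma:G\times G\to\mathbb T$ is a jointly continuous 2-cocycle ($\sigma(x,y)\sigma(xy,z)=\sigma(y,z)\sigma(x,yz)$), normalised by $1=\sigma(x,e)=\sigma(e,x)=\sigma(x,x^{-1})$ and $\overline{\sigma(x,y)}=\sigma(y^{-1},x^{-1})$. $\mathrm{Rep}_\sigma G_d$ is the set of all (not necessarily continuous) unitary $\sigma$-representations $\pi$ of $G$ on Hilbert spaces $\mathcal H_\pi$: $\pi(x)\pi(y)=\sigma(x,y)\pi(xy)$. $\mathcal R\subset\mathrm{Rep}_\sigma G_d$ is a given set, closed under direct sums. Inner products are linear in the second variable. $C^*_\sigma(G_d)$ is the C*-algebra generated by unitaries $\delta_x$, $x\in G$, with $\delta_x\delta_y=\sigma(x,y)\delta_{xy}$ (twisted discrete group algebra); each $\pi\in\mathrm{Rep}_\sigma G_d$ gives a representation of it, also written $\pi$, with $\pi(\delta_x)=\pi(x)$. $B_\sigma(\mathcal R)$ is the linear space of functions $f(x)=(\psi,\pi(x)\varphi)$, $\pi\in\mathcal R$, $\psi,\varphi\in\mathcal H_\pi$; $\|f\|_*:=\sup\{|(\psi,\pi(A)\varphi)|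 : A\in C^*_\sigma(G_d),\|A\|\le1\}$; $J_\sigma(\mathcal R)$ is the completion of $B_\sigma(\mathcal R)$ in $\|\cdot\|_*$, a space of bounded functions on $G$. $J_\sigma(\mathcal R)^*$ is its Banach dual with the dual norm, made into a Banach $*$-algebra by the convolution $(\xi*\omega)(f):=\xi_x\big(\omega_y(\sigma(x,y)f(xy))\big)$ and the involution $\omega^*(f):=\overline{\omega(f^* )}$, $f^*(x):=\overline{f(x^{-1})}$; here $\omega_x(f(x))$ means $\omega$ evaluated on $x\mapsto f(x)$. For $\pi\in\mathcal R$ and $A\in J_\sigma(\mathcal R)^*$, $\pi(A)\in\mathcal B(\mathcal H_\pi)$ is the unique operator with $A_x\big((\psi,\pi(x)\varphi)\big)=(\psi,\pi(A)\varphi)$ for all $\psi,\varphi\in\mathcal H_\pi$. $\delta_x\in J_\sigma(\mathcal R)^*$ denotes evaluation, $\delta_x(f)=f(x)$. A d-ideal of $J_\sigma(\mathcal R)^*$ is a nonzero norm-closed $*$-subalgebra $\mathcal A$ with $\delta_x*\mathcal A\subseteq\mathcal A\supseteq\mathcal A*\delta_x$ for all $x\in G$. *)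

theory Defs
  imports Complex_Main "HOL-Library.FuncSet" "HOL-Algebra.Module"
begin

text \<open>
  The group \<open>G\<close> is a type of class \<^class>\<open>topological_group_add\<close>. Such groups are written additively
  in the library but need not be commutative: \<open>x + y\<close>, \<open>0\<close>, \<open>- x\<close> stand for \<open>xy\<close>, \<open>e\<close>, \<open>x\<^sup>-\<^sup>1\<close>.
\<close>

definition normalized_cocycle :: "('g::topological_group_add \<Rightarrow> 'g \<Rightarrow> complex) \<Rightarrow> bool" where
  "normalized_cocycle \<sigma> \<longleftrightarrow>
     (\<forall>x y. cmod (\<sigma> x y) = 1) \<and>
     continuous_on UNIV (\<lambda>(x, y). \<sigma> x y) \<and>
     (\<forall>x y z. \<sigma> x y * \<sigma> (x + y) z = \<sigma> y z * \<sigma> x (y + z)) \<and>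
     (\<forall>x. \<sigma> x 0 = 1 \<and> \<sigma> 0 x = 1 \<and> \<sigma> x (- x) = 1) \<and>
     (\<forall>x y. cnj (\<sigma> x y) = \<sigma> (- y) (- x))"


section \<open>Hilbert spaces and bounded operators\<close>

text \<open>
  A set of representations involves many different Hilbert spaces, so Hilbert spaces are
  carrier-based. They extend the \<^type>\<open>module\<close> records of HOL-Algebra; the fields
  \<open>mult\<close> and \<open>one\<close> of these records are never used for Hilbert spaces.
\<close>

definition complex_ring :: "complex ring" where
  "complex_ring = \<lparr>carrier = UNIV, mult = (*), one = 1, zero = 0, add = (+)\<rparr>"

definition dist_Cauchy :: "('v \<Rightarrow> 'v \<Rightarrow> real) \<Rightarrow> (nat \<Rightarrow> 'v) \<Rightarrow> bool" where
  "dist_Cauchy d s \<longleftrightarrow> (\<forall>e>0. \<exists>N. \<forall>m\<ge>N. \<forall>n\<ge>N. d (s m) (s n) < e)"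

definition complete_for :: "('v, 'm) ring_scheme \<Rightarrow> ('v \<Rightarrow> real) \<Rightarrow> bool" where
  "complete_for V N \<longleftrightarrow>
     (\<forall>s. (\<forall>n. s n \<in> carrier V) \<and> dist_Cauchy (\<lambda>u v. N (u \<ominus>\<^bsub>V\<^esub> v)) s \<longrightarrow>
          (\<exists>l\<in>carrier V. (\<lambda>n. N (s n \<ominus>\<^bsub>V\<^esub> l)) \<longlonglongrightarrow> 0))"

record 'v hilbert = "(complex, 'v) module" +
  hinner :: "'v \<Rightarrow> 'v \<Rightarrow> complex"

definition hnorm :: "'v hilbert \<Rightarrow> 'v \<Rightarrow> real" where
  "hnorm H v = sqrt (Re (hinner H v v))"

definition hilbert_space :: "'v hilbert \<Rightarrow> bool" where
  "hilbert_space H \<longleftrightarrow>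
     module complex_ring H \<and>
     (\<forall>u\<in>carrier H. \<forall>v\<in>carrier H. \<forall>w\<in>carrier H.
        hinner H u (v \<oplus>\<^bsub>H\<^esub> w) = hinner H u v + hinner H u w) \<and>
     (\<forall>c. \<forall>u\<in>carrier H. \<forall>v\<in>carrier H. hinner H u (c \<odot>\<^bsub>H\<^esub> v) = c * hinner H u v) \<and>
     (\<forall>u\<in>carrier H. \<forall>v\<in>carrier H. hinner H v u = cnj (hinner H u v)) \<and>
     (\<forall>v\<in>carrier H. v \<noteq> \<zero>\<^bsub>H\<^esub> \<longrightarrow> 0 < Re (hinner H v v)) \<and>
     complete_for H (hnorm H)"

definition linear_map :: "'v hilbert \<Rightarrow> 'w hilbert \<Rightarrow> ('v \<Rightarrow> 'w) \<Rightarrow> bool" where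
  "linear_map H K T \<longleftrightarrow>
     T \<in> carrier H \<rightarrow> carrier K \<and>
     (\<forall>u\<in>carrier H. \<forall>v\<in>carrier H. T (u \<oplus>\<^bsub>H\<^esub> v) = T u \<oplus>\<^bsub>K\<^esub> T v) \<and>
     (\<forall>c. \<forall>v\<in>carrier H. T (c \<odot>\<^bsub>H\<^esub> v) = c \<odot>\<^bsub>K\<^esub> T v)"

definition unitary_map :: "'v hilbert \<Rightarrow> 'w hilbert \<Rightarrow> ('v \<Rightarrow> 'w) \<Rightarrow> bool" where
  "unitary_map H K U \<longleftrightarrow>
     linear_map H K U \<and> U ` carrier H = carrier K \<and>
     (\<forall>u\<in>carrier H. \<forall>v\<in>carrier H. hinner K (U u) (U v) = hinner H u v)"

definition bounded_ops :: "'v hilbert \<Rightarrow> ('v \<Rightarrow> 'v) set" where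
  "bounded_ops H = {T \<in> extensional (carrier H). linear_map H H T \<and>
     (\<exists>c. \<forall>v\<in>carrier H. hnorm H (T v) \<le> c * hnorm H v)}"

definition op_norm :: "'v hilbert \<Rightarrow> ('v \<Rightarrow> 'v) \<Rightarrow> real" where
  "op_norm H T = Sup {hnorm H (T v) | v. v \<in> carrier H \<and> hnorm H v \<le> 1}"

definition hilbert_sum :: "'v hilbert \<Rightarrow> 'w hilbert \<Rightarrow> ('v \<times> 'w) hilbert" where
  "hilbert_sum H K =
     \<lparr>carrier = carrier H \<times> carrier K,
      mult = undefined, one = undefined,
      zero = (\<zero>\<^bsub>H\<^esub>, \<zero>\<^bsub>K\<^esub>),
      add = (\<lambda>(u, v) (u', v'). (u \<oplus>\<^bsub>H\<^esub> u', v \<oplus>\<^bsub>K\<^esub> v')),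
      smult = (\<lambda>c (u, v). (c \<odot>\<^bsub>H\<^esub> u, c \<odot>\<^bsub>K\<^esub> v)),
      hinner = (\<lambda>(u, v) (u', v'). hinner H u u' + hinner K v v')\<rparr>"


section \<open>Twisted representations\<close>

record ('g, 'v) rep =
  hspace :: "'v hilbert"
  act :: "'g \<Rightarrow> 'v \<Rightarrow> 'v"

definition sigma_rep :: "('g::topological_group_add \<Rightarrow> 'g \<Rightarrow> complex) \<Rightarrow> ('g, 'v) rep \<Rightarrow> bool" where
  "sigma_rep \<sigma> \<pi> \<longleftrightarrow>
     hilbert_space (hspace \<pi>) \<and>
     (\<forall>x. unitary_map (hspace \<pi>) (hspace \<pi>) (act \<pi> x)) \<and>
     (\<forall>x y. \<forall>v\<in>carrier (hspace \<pi>).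
        act \<pi> x (act \<pi> y v) = \<sigma> x y \<odot>\<^bsub>hspace \<pi>\<^esub> act \<pi> (x + y) v)"

definition rep_sum :: "('g, 'v) rep \<Rightarrow> ('g, 'w) rep \<Rightarrow> ('g, 'v \<times> 'w) rep" where
  "rep_sum \<pi> \<rho> =
     \<lparr>hspace = hilbert_sum (hspace \<pi>) (hspace \<rho>), act = (\<lambda>x (u, v). (act \<pi> x u, act \<rho> x v))\<rparr>"

definition unitarily_equivalent :: "('g, 'v) rep \<Rightarrow> ('g, 'w) rep \<Rightarrow> bool" where
  "unitarily_equivalent \<pi> \<rho> \<longleftrightarrow>
     (\<exists>U. unitary_map (hspace \<pi>) (hspace \<rho>) U \<and>
          (\<forall>x. \<forall>v\<in>carrier (hspace \<pi>). U (act \<pi> x v) = act \<rho> x (U v)))"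

text \<open>
  Only binary (hence finite) direct sums are demanded: a set of representations cannot contain
  direct sums of arbitrary cardinality. The sum of two spaces with carriers in \<open>'v\<close> has its carrier
  in \<open>'v \<times> 'v\<close>, so membership is up to unitary equivalence.
\<close>

definition closed_under_direct_sums :: "('g, 'v) rep set \<Rightarrow> bool" where
  "closed_under_direct_sums R \<longleftrightarrow>
     (\<forall>\<pi>\<in>R. \<forall>\<rho>\<in>R. \<exists>\<tau>\<in>R. unitarily_equivalent \<tau> (rep_sum \<pi> \<rho>))"


section \<open>The twisted discrete group algebra\<close>

text \<open>A finitely supported function \<open>a\<close> stands for \<open>\<Sum>\<^sub>x a(x) \<delta>\<^sub>x\<close>; the following is \<open>\<pi>(a)\<close>.\<close>

definition finsupp :: "('g \<Rightarrow> complex) \<Rightarrow> bool" where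
  "finsupp a \<longleftrightarrow> finite {x. a x \<noteq> 0}"

definition alg_op :: "('g, 'v) rep \<Rightarrow> ('g \<Rightarrow> complex) \<Rightarrow> 'v \<Rightarrow> 'v" where
  "alg_op \<pi> a = (\<lambda>v\<in>carrier (hspace \<pi>).
     finsum (hspace \<pi>) (\<lambda>x. a x \<odot>\<^bsub>hspace \<pi>\<^esub> act \<pi> x v) {x. a x \<noteq> 0})"

text \<open>
  The universal C*-norm, i.e. the supremum of \<open>\<parallel>\<pi>(a)\<parallel>\<close> over all \<open>\<sigma>\<close>-representations of the discrete
  group. Quantifying over Hilbert spaces with carrier in \<^typ>\<open>'g \<Rightarrow> complex\<close> loses nothing:
  the norm is determined by the cyclic representations, and if \<open>\<phi>\<close> is a cyclic vector of \<open>\<pi>\<close>, then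
  \<open>v \<mapsto> (x \<mapsto> (\<pi>(x)\<phi>, v))\<close> is linear and injective, so that \<open>\<pi>\<close> has a unitarily equivalent copy
  on a space of functions on the group.
\<close>

definition universal_norm ::
    "('g::topological_group_add \<Rightarrow> 'g \<Rightarrow> complex) \<Rightarrow> ('g \<Rightarrow> complex) \<Rightarrow> real" where
  "universal_norm \<sigma> a =
     Sup {op_norm (hspace \<pi>) (alg_op \<pi> a) | \<pi> :: ('g, 'g \<Rightarrow> complex) rep. sigma_rep \<sigma> \<pi>}"

text \<open>
  \<open>C*\<^sub>\<sigma>(G\<^sub>d)\<close> is the completion for this norm, realised as Cauchy sequences modulo null
  sequences. Its product and involution do not enter the definitions below, which only need its
  elements, their norms, and the extension of representations to it.
\<close>

definition alg_Cauchy :: "('g::topological_group_add \<Rightarrow> 'g \<Rightarrow> complex) \<Rightarrow> (nat \<Rightarrow> 'g \<Rightarrow> complex) set" where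
  "alg_Cauchy \<sigma> = {s. (\<forall>n. finsupp (s n)) \<and>
     dist_Cauchy (\<lambda>a b. universal_norm \<sigma> (\<lambda>x. a x - b x)) s}"

definition alg_null_rel ::
    "('g::topological_group_add \<Rightarrow> 'g \<Rightarrow> complex)
      \<Rightarrow> ((nat \<Rightarrow> 'g \<Rightarrow> complex) \<times> (nat \<Rightarrow> 'g \<Rightarrow> complex)) set" where
  "alg_null_rel \<sigma> = {(s, t). s \<in> alg_Cauchy \<sigma> \<and> t \<in> alg_Cauchy \<sigma> \<and>
     (\<lambda>n. universal_norm \<sigma> (\<lambda>x. s n x - t n x)) \<longlonglongrightarrow> 0}"

definition twisted_group_cstar ::
    "('g::topological_group_add \<Rightarrow> 'g \<Rightarrow> complex) \<Rightarrow> (nat \<Rightarrow> 'g \<Rightarrow> complex) set set" where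
  "twisted_group_cstar \<sigma> = alg_Cauchy \<sigma> // alg_null_rel \<sigma>"

definition group_cstar_norm ::
    "('g::topological_group_add \<Rightarrow> 'g \<Rightarrow> complex) \<Rightarrow> (nat \<Rightarrow> 'g \<Rightarrow> complex) set \<Rightarrow> real" where
  "group_cstar_norm \<sigma> A = (THE r. \<forall>s\<in>A. (\<lambda>n. universal_norm \<sigma> (s n)) \<longlonglongrightarrow> r)"

definition group_cstar_op :: "('g, 'v) rep \<Rightarrow> (nat \<Rightarrow> 'g \<Rightarrow> complex) set \<Rightarrow> 'v \<Rightarrow> 'v" where
  "group_cstar_op \<pi> A = (THE T. T \<in> bounded_ops (hspace \<pi>) \<and>
     (\<forall>s\<in>A. (\<lambda>n. op_norm (hspace \<pi>)
        (\<lambda>v\<in>carrier (hspace \<pi>). alg_op \<pi> (s n) v \<ominus>\<^bsub>hspace \<pi>\<^esub> T v)) \<longlonglongrightarrow> 0))"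


section \<open>The spaces of coefficient functions\<close>

definition coeff_fun :: "('g, 'v) rep \<Rightarrow> 'v \<Rightarrow> 'v \<Rightarrow> 'g \<Rightarrow> complex" where
  "coeff_fun \<pi> \<psi> \<phi> = (\<lambda>x. hinner (hspace \<pi>) \<psi> (act \<pi> x \<phi>))"

definition B_space :: "('g, 'v) rep set \<Rightarrow> ('g \<Rightarrow> complex) set" where
  "B_space R = {coeff_fun \<pi> \<psi> \<phi> | \<pi> \<psi> \<phi>.
     \<pi> \<in> R \<and> \<psi> \<in> carrier (hspace \<pi>) \<and> \<phi> \<in> carrier (hspace \<pi>)}"

text \<open>
  \<open>(\<psi>, \<pi>(A)\<phi>)\<close> depends only on \<open>A\<close> and on the function \<open>x \<mapsto> (\<psi>, \<pi>(x)\<phi>)\<close>, so it is harmless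
  that the supremum runs over all ways to write \<open>f\<close> as a coefficient function.
\<close>

definition B_norm ::
    "('g::topological_group_add \<Rightarrow> 'g \<Rightarrow> complex) \<Rightarrow> ('g, 'v) rep set \<Rightarrow> ('g \<Rightarrow> complex) \<Rightarrow> real" where
  "B_norm \<sigma> R f = Sup {cmod (hinner (hspace \<pi>) \<psi> (group_cstar_op \<pi> A \<phi>)) | \<pi> \<psi> \<phi> A.
     \<pi> \<in> R \<and> \<psi> \<in> carrier (hspace \<pi>) \<and> \<phi> \<in> carrier (hspace \<pi>) \<and> f = coeff_fun \<pi> \<psi> \<phi> \<and>
     A \<in> twisted_group_cstar \<sigma> \<and> group_cstar_norm \<sigma> A \<le> 1}"

text \<open>
  The completion of \<open>B\<^sub>\<sigma>(\<R>)\<close> as a space of functions. Since \<open>\<bar>f(x)\<bar> \<le> \<parallel>f\<parallel>\<^sub>*\<close>, Cauchy sequences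
  converge uniformly; since the \<open>\<delta>\<^sub>x\<close> span a dense subspace of \<open>C*\<^sub>\<sigma>(G\<^sub>d)\<close>, a Cauchy sequence with
  pointwise limit \<open>0\<close> is null. So elements of the abstract completion are determined by their limits.
\<close>

definition J_approx ::
    "('g::topological_group_add \<Rightarrow> 'g \<Rightarrow> complex) \<Rightarrow> ('g, 'v) rep set
      \<Rightarrow> (nat \<Rightarrow> 'g \<Rightarrow> complex) \<Rightarrow> ('g \<Rightarrow> complex) \<Rightarrow> bool" where
  "J_approx \<sigma> R F f \<longleftrightarrow>
     (\<forall>n. F n \<in> B_space R) \<and>
     dist_Cauchy (\<lambda>g h. B_norm \<sigma> R (\<lambda>x. g x - h x)) F \<and>
     (\<forall>x. (\<lambda>n. F n x) \<longlonglongrightarrow> f x)"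

definition J_space ::
    "('g::topological_group_add \<Rightarrow> 'g \<Rightarrow> complex) \<Rightarrow> ('g, 'v) rep set \<Rightarrow> ('g \<Rightarrow> complex) set" where
  "J_space \<sigma> R = {f. \<exists>F. J_approx \<sigma> R F f}"

definition J_norm ::
    "('g::topological_group_add \<Rightarrow> 'g \<Rightarrow> complex) \<Rightarrow> ('g, 'v) rep set \<Rightarrow> ('g \<Rightarrow> complex) \<Rightarrow> real" where
  "J_norm \<sigma> R f = (THE r. \<forall>F. J_approx \<sigma> R F f \<longrightarrow> (\<lambda>n. B_norm \<sigma> R (F n)) \<longlonglongrightarrow> r)"


section \<open>C*-algebras\<close>

text \<open>
  Algebras are not assumed to be unital; the field \<open>one\<close> of the record is not constrained
  (and meaningless for a subalgebra without unit).
\<close>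

record 'a star_algebra = "(complex, 'a) module" +
  astar :: "'a \<Rightarrow> 'a"
  anorm :: "'a \<Rightarrow> real"

definition is_star_algebra :: "'a star_algebra \<Rightarrow> bool" where
  "is_star_algebra A \<longleftrightarrow>
     module complex_ring A \<and>
     (\<forall>a\<in>carrier A. \<forall>b\<in>carrier A. a \<otimes>\<^bsub>A\<^esub> b \<in> carrier A) \<and>
     (\<forall>a\<in>carrier A. \<forall>b\<in>carrier A. \<forall>c\<in>carrier A.
        (a \<otimes>\<^bsub>A\<^esub> b) \<otimes>\<^bsub>A\<^esub> c = a \<otimes>\<^bsub>A\<^esub> (b \<otimes>\<^bsub>A\<^esub> c) \<and>
        (a \<oplus>\<^bsub>A\<^esub> b) \<otimes>\<^bsub>A\<^esub> c = a \<otimes>\<^bsub>A\<^esub> c \<oplus>\<^bsub>A\<^esub> b \<otimes>\<^bsub>A\<^esub> c \<and>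
        a \<otimes>\<^bsub>A\<^esub> (b \<oplus>\<^bsub>A\<^esub> c) = a \<otimes>\<^bsub>A\<^esub> b \<oplus>\<^bsub>A\<^esub> a \<otimes>\<^bsub>A\<^esub> c) \<and>
     (\<forall>z. \<forall>a\<in>carrier A. \<forall>b\<in>carrier A.
        (z \<odot>\<^bsub>A\<^esub> a) \<otimes>\<^bsub>A\<^esub> b = z \<odot>\<^bsub>A\<^esub> (a \<otimes>\<^bsub>A\<^esub> b) \<and>
        a \<otimes>\<^bsub>A\<^esub> (z \<odot>\<^bsub>A\<^esub> b) = z \<odot>\<^bsub>A\<^esub> (a \<otimes>\<^bsub>A\<^esub> b)) \<and>
     (\<forall>a\<in>carrier A. astar A a \<in> carrier A \<and> astar A (astar A a) = a) \<and>
     (\<forall>z. \<forall>a\<in>carrier A. astar A (z \<odot>\<^bsub>A\<^esub> a) = cnj z \<odot>\<^bsub>A\<^esub> astar A a) \<and>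
     (\<forall>a\<in>carrier A. \<forall>b\<in>carrier A.
        astar A (a \<oplus>\<^bsub>A\<^esub> b) = astar A a \<oplus>\<^bsub>A\<^esub> astar A b \<and>
        astar A (a \<otimes>\<^bsub>A\<^esub> b) = astar A b \<otimes>\<^bsub>A\<^esub> astar A a)"

definition has_cstar_norm :: "'a star_algebra \<Rightarrow> bool" where
  "has_cstar_norm A \<longleftrightarrow>
     (\<forall>a\<in>carrier A. 0 \<le> anorm A a \<and> (anorm A a = 0 \<longleftrightarrow> a = \<zero>\<^bsub>A\<^esub>)) \<and>
     (\<forall>z. \<forall>a\<in>carrier A. anorm A (z \<odot>\<^bsub>A\<^esub> a) = cmod z * anorm A a) \<and>
     (\<forall>a\<in>carrier A. \<forall>b\<in>carrier A. anorm A (a \<oplus>\<^bsub>A\<^esub> b) \<le> anorm A a + anorm A b) \<and>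
     (\<forall>a\<in>carrier A. \<forall>b\<in>carrier A. anorm A (a \<otimes>\<^bsub>A\<^esub> b) \<le> anorm A a * anorm A b) \<and>
     (\<forall>a\<in>carrier A. anorm A (astar A a \<otimes>\<^bsub>A\<^esub> a) = (anorm A a)\<^sup>2)"

definition is_cstar_algebra :: "'a star_algebra \<Rightarrow> bool" where
  "is_cstar_algebra A \<longleftrightarrow> is_star_algebra A \<and> has_cstar_norm A \<and> complete_for A (anorm A)"


section \<open>The dual algebra\<close>

text \<open>Functionals on \<open>J\<^sub>\<sigma>(\<R>)\<close> are made \<^const>\<open>extensional\<close>, so that equality is equality on \<open>J\<^sub>\<sigma>(\<R>)\<close>.\<close>

definition J_dual_set ::
    "('g::topological_group_add \<Rightarrow> 'g \<Rightarrow> complex) \<Rightarrow> ('g, 'v) rep set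
      \<Rightarrow> (('g \<Rightarrow> complex) \<Rightarrow> complex) set" where
  "J_dual_set \<sigma> R = {A \<in> extensional (J_space \<sigma> R).
     (\<forall>f\<in>J_space \<sigma> R. \<forall>g\<in>J_space \<sigma> R. A (\<lambda>x. f x + g x) = A f + A g) \<and>
     (\<forall>c. \<forall>f\<in>J_space \<sigma> R. A (\<lambda>x. c * f x) = c * A f) \<and>
     (\<exists>C. \<forall>f\<in>J_space \<sigma> R. cmod (A f) \<le> C * J_norm \<sigma> R f)}"

definition eval_at ::
    "('g::topological_group_add \<Rightarrow> 'g \<Rightarrow> complex) \<Rightarrow> ('g, 'v) rep set
      \<Rightarrow> 'g \<Rightarrow> ('g \<Rightarrow> complex) \<Rightarrow> complex" where
  "eval_at \<sigma> R x = (\<lambda>f\<in>J_space \<sigma> R. f x)"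

definition J_dual ::
    "('g::topological_group_add \<Rightarrow> 'g \<Rightarrow> complex) \<Rightarrow> ('g, 'v) rep set
      \<Rightarrow> (('g \<Rightarrow> complex) \<Rightarrow> complex) star_algebra" where
  "J_dual \<sigma> R =
     \<lparr>carrier = J_dual_set \<sigma> R,
      mult = (\<lambda>\<xi> \<omega>. \<lambda>f\<in>J_space \<sigma> R. \<xi> (\<lambda>x. \<omega> (\<lambda>y. \<sigma> x y * f (x + y)))),
      one = eval_at \<sigma> R 0,
      zero = (\<lambda>f\<in>J_space \<sigma> R. 0),
      add = (\<lambda>\<xi> \<omega>. \<lambda>f\<in>J_space \<sigma> R. \<xi> f + \<omega> f),
      smult = (\<lambda>c \<omega>. \<lambda>f\<in>J_space \<sigma> R. c * \<omega> f),
      astar = (\<lambda>\<omega>. \<lambda>f\<in>J_space \<sigma> R. cnj (\<omega> (\<lambda>x. cnj (f (- x))))),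
      anorm = (\<lambda>\<omega>. Sup {cmod (\<omega> f) | f. f \<in> J_space \<sigma> R \<and> J_norm \<sigma> R f \<le> 1})\<rparr>"

definition dual_op :: "('g, 'v) rep \<Rightarrow> (('g \<Rightarrow> complex) \<Rightarrow> complex) \<Rightarrow> 'v \<Rightarrow> 'v" where
  "dual_op \<pi> A = (THE T. T \<in> bounded_ops (hspace \<pi>) \<and>
     (\<forall>\<psi>\<in>carrier (hspace \<pi>). \<forall>\<phi>\<in>carrier (hspace \<pi>).
        A (coeff_fun \<pi> \<psi> \<phi>) = hinner (hspace \<pi>) \<psi> (T \<phi>)))"

definition d_ideal ::
    "('g::topological_group_add \<Rightarrow> 'g \<Rightarrow> complex) \<Rightarrow> ('g, 'v) rep set
      \<Rightarrow> (('g \<Rightarrow> complex) \<Rightarrow> complex) set \<Rightarrow> bool" where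
  "d_ideal \<sigma> R \<A> \<longleftrightarrow> (let D = J_dual \<sigma> R in
     \<A> \<subseteq> carrier D \<and> \<zero>\<^bsub>D\<^esub> \<in> \<A> \<and> \<A> \<noteq> {\<zero>\<^bsub>D\<^esub>} \<and>
     (\<forall>a\<in>\<A>. \<forall>b\<in>\<A>. a \<oplus>\<^bsub>D\<^esub> b \<in> \<A> \<and> a \<otimes>\<^bsub>D\<^esub> b \<in> \<A>) \<and>
     (\<forall>c. \<forall>a\<in>\<A>. c \<odot>\<^bsub>D\<^esub> a \<in> \<A>) \<and>
     (\<forall>a\<in>\<A>. astar D a \<in> \<A>) \<and>
     (\<forall>s. \<forall>a\<in>carrier D. (\<forall>n. s n \<in> \<A>) \<and> (\<lambda>n. anorm D (s n \<ominus>\<^bsub>D\<^esub> a)) \<longlonglongrightarrow> 0 \<longrightarrow> a \<in> \<A>) \<and>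
     (\<forall>x. \<forall>a\<in>\<A>. eval_at \<sigma> R x \<otimes>\<^bsub>D\<^esub> a \<in> \<A> \<and> a \<otimes>\<^bsub>D\<^esub> eval_at \<sigma> R x \<in> \<A>))"

end

theory Submission
  imports Defs
begin

text \<open>
  Write \<open>u\<close> for the universal norm on the finitely supported functions and \<open>\<langle>a, f\<rangle> = \<Sum>\<^sub>x a(x) f(x)\<close>. Then
  \<open>\<parallel>f\<parallel>\<^sub>*\<close> is the norm of \<open>a \<mapsto> \<langle>a, f\<rangle>\<close> with respect to \<open>u\<close>, and \<open>J\<^sub>\<sigma>(\<R>)\<close> is the closure of \<open>B\<^sub>\<sigma>(\<R>)\<close> in
  this norm. The Riesz lemma turns a functional \<open>A\<close> into the operators \<open>\<pi>(A)\<close>, and \<open>A \<mapsto> \<pi>(A)\<close> is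
  multiplicative, *-preserving and jointly injective. So everything follows from the norm formula.
  Its nontrivial half is \<open>\<bar>(\<psi>, \<pi>(A)\<phi>)\<bar> \<le> \<parallel>\<pi>(A)\<parallel> \<parallel>f\<parallel>\<^sub>*\<close> for \<open>f(x) = (\<psi>, \<pi>(x)\<phi>)\<close>, a form of Kaplansky's
  density theorem: if \<open>T = \<pi>(A)\<close> has norm less than 1, write \<open>T = 2S(1 + S\<^sup>*S)\<inverse>\<close>, approximate \<open>S\<close> and
  its adjoint on one vector each by some \<open>\<pi>(a)\<close> and \<open>\<pi>(a)\<^sup>*\<close>, and use that \<open>2a(1 + a\<^sup>*a)\<inverse>\<close> has norm at most 1
  in every representation.
\<close>

section \<open>Hilbert spaces\<close>

text \<open>The obstacle: a bound on \<open>A\<close> is available only in the representations from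
  \<open>R\<close>, whereas the norm of a coefficient function is measured against the universal
  norm, a supremum over all representations. An \<open>a\<close> with \<open>\<pi>(a)\<close> close
  to \<open>T\<close> on a vector may have a huge universal norm. The map
  \<open>S \<mapsto> 2S(1 + S'S)^-1\<close> repairs this: it lands in the unit ball of every
  representation, and it is continuous for simultaneous strong convergence of \<open>S\<close> and
  its adjoint \<open>S'\<close>, with estimates that do not involve the size of the approximants.
  This is why the adjoint has to be approximated as well. One vector for each suffices, because a
  coefficient function involves one pair of vectors in one representation. In place of a functional
  calculus, the root \<open>S\<close> comes from a contraction and the resolvents from polynomial
  iterations; in place of the bicommutant theorem stands a condition on linear relations between two
  coefficient functions. Direct sums make the coefficient functions a vector space.\<close>

lemma complex_ring_simps [simp]:
  "carrier complex_ring = UNIV" "mult complex_ring = (*)" "one complex_ring = 1"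
  "zero complex_ring = 0" "add complex_ring = (+)"
  by (simp_all add: complex_ring_def)

lemma cring_complex_ring: "cring complex_ring"
proof -
  have "\<exists>y. x + y = 0" for x :: complex
    using add.right_inverse by blast
  then show ?thesis
    by unfold_locales (auto simp: algebra_simps Units_def)
qed

lemma null_comparison:
  fixes f :: "nat \<Rightarrow> 'a::real_normed_vector"
  assumes "g \<longlonglongrightarrow> 0" "\<And>n. norm (f n) \<le> g n"
  shows "f \<longlonglongrightarrow> 0"
  by (rule tendsto_0_le[OF assms(1), of _ 1], rule always_eventually)
    (use assms(2) abs_ge_self order_trans in fastforce)

text \<open>The first order condition at a minimum: \<open>a\<close> will be a squared norm and
  \<open>b\<close> the real part of an inner product.\<close>

lemma quadratic_nonneg_imp_linear_zero:
  fixes a b :: real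
  assumes "0 \<le> a" "\<And>t. 0 \<le> t\<^sup>2 * a - 2 * t * b"
  shows "b = 0"
proof -
  \<comment> \<open>The natural test value is \<open>b / a\<close>; the added 1 covers the case
    \<open>a = 0\<close>.\<close>
  define s where "s = b / (a + 1)"
  have b: "b = s * (a + 1)" using assms(1) by (simp add: s_def)
  have "0 \<le> - (s\<^sup>2 * (a + 2))"
    using assms(2)[of s] by (simp add: b algebra_simps power2_eq_square)
  then have "s\<^sup>2 * (a + 2) \<le> 0" by simp
  then show ?thesis using assms(1) by (simp add: b mult_le_0_iff)
qed

lemma module_complex_ringI:
  fixes V :: "(complex, 'v, 'm) module_scheme"
  assumes closed: "\<zero>\<^bsub>V\<^esub> \<in> carrier V"
      "\<And>u v. u \<in> carrier V \<Longrightarrow> v \<in> carrier V \<Longrightarrow> u \<oplus>\<^bsub>V\<^esub> v \<in> carrier V"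
      "\<And>c v. v \<in> carrier V \<Longrightarrow> c \<odot>\<^bsub>V\<^esub> v \<in> carrier V"
    and assoc: "\<And>u v w. u \<in> carrier V \<Longrightarrow> v \<in> carrier V \<Longrightarrow> w \<in> carrier V
      \<Longrightarrow> (u \<oplus>\<^bsub>V\<^esub> v) \<oplus>\<^bsub>V\<^esub> w = u \<oplus>\<^bsub>V\<^esub> (v \<oplus>\<^bsub>V\<^esub> w)"
    and comm: "\<And>u v. u \<in> carrier V \<Longrightarrow> v \<in> carrier V \<Longrightarrow> u \<oplus>\<^bsub>V\<^esub> v = v \<oplus>\<^bsub>V\<^esub> u"
    and zero: "\<And>v. v \<in> carrier V \<Longrightarrow> \<zero>\<^bsub>V\<^esub> \<oplus>\<^bsub>V\<^esub> v = v"
    and neg: "\<And>v. v \<in> carrier V \<Longrightarrow> v \<oplus>\<^bsub>V\<^esub> (-1) \<odot>\<^bsub>V\<^esub> v = \<zero>\<^bsub>V\<^esub>"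
    and smult: "\<And>c d v. v \<in> carrier V \<Longrightarrow> (c + d) \<odot>\<^bsub>V\<^esub> v = c \<odot>\<^bsub>V\<^esub> v \<oplus>\<^bsub>V\<^esub> d \<odot>\<^bsub>V\<^esub> v"
      "\<And>c u v. u \<in> carrier V \<Longrightarrow> v \<in> carrier V \<Longrightarrow> c \<odot>\<^bsub>V\<^esub> (u \<oplus>\<^bsub>V\<^esub> v) = c \<odot>\<^bsub>V\<^esub> u \<oplus>\<^bsub>V\<^esub> c \<odot>\<^bsub>V\<^esub> v"
      "\<And>c d v. v \<in> carrier V \<Longrightarrow> (c * d) \<odot>\<^bsub>V\<^esub> v = c \<odot>\<^bsub>V\<^esub> (d \<odot>\<^bsub>V\<^esub> v)"
      "\<And>v. v \<in> carrier V \<Longrightarrow> 1 \<odot>\<^bsub>V\<^esub> v = v"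
  shows "module complex_ring V"
proof (rule moduleI)
  show "abelian_group V"
  proof (rule abelian_groupI)
    show "\<exists>y\<in>carrier V. y \<oplus>\<^bsub>V\<^esub> v = \<zero>\<^bsub>V\<^esub>" if "v \<in> carrier V" for v
      using neg[OF that] comm[OF that closed(3)[OF that]] closed(3)[OF that] by metis
  qed (use assms in auto)
qed (use assms cring_complex_ring in auto)

lemma (in abelian_group) minus_eqI:
  "x = z \<oplus> y \<Longrightarrow> y \<in> carrier G \<Longrightarrow> z \<in> carrier G \<Longrightarrow> x \<ominus> y = z"
  by (simp add: a_minus_def a_assoc r_neg)

text \<open>Subtraction goes through an inverse chosen inside the carrier, which cannot be read off
  the operations of a newly built record. The scalar -1 makes it computable in sums, copies and
  subalgebras.\<close>

lemma complex_module_minus: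
  assumes "module complex_ring M" and uv: "u \<in> carrier M" "v \<in> carrier M"
  shows "u \<ominus>\<^bsub>M\<^esub> v = u \<oplus>\<^bsub>M\<^esub> (-1) \<odot>\<^bsub>M\<^esub> v"
proof -
  interpret module complex_ring M by fact
  have c: "(-1) \<odot>\<^bsub>M\<^esub> v \<in> carrier M" "1 \<odot>\<^bsub>M\<^esub> v = v"
    using smult_closed[of "-1" v] smult_one[of v] uv by simp_all
  have "(-1) \<odot>\<^bsub>M\<^esub> v \<oplus>\<^bsub>M\<^esub> v = (-1 + 1) \<odot>\<^bsub>M\<^esub> v"
    using smult_l_distr[of "-1" 1 v] uv c by simp
  also have "\<dots> = \<zero>\<^bsub>M\<^esub>" using smult_l_null[of v] uv by simp
  finally have "(-1) \<odot>\<^bsub>M\<^esub> v \<oplus>\<^bsub>M\<^esub> v = \<zero>\<^bsub>M\<^esub>" .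
  then show ?thesis
    using uv c by (intro M.minus_eqI) (auto simp: M.a_assoc)
qed

section \<open>Inner product calculus\<close>

locale hilb =
  fixes H :: "'v hilbert" (structure)
  assumes hilbert: "hilbert_space H"
begin

abbreviation V where "V \<equiv> carrier H"
abbreviation ip where "ip \<equiv> hinner H"
abbreviation nrm where "nrm \<equiv> hnorm H"

sublocale module complex_ring H
  using hilbert by (simp add: hilbert_space_def)

lemma closed [simp, intro]:
  "\<zero> \<in> V" "u \<in> V \<Longrightarrow> v \<in> V \<Longrightarrow> u \<oplus> v \<in> V" "u \<in> V \<Longrightarrow> v \<in> V \<Longrightarrow> u \<ominus> v \<in> V"
  "v \<in> V \<Longrightarrow> c \<odot> v \<in> V" "v \<in> V \<Longrightarrow> \<ominus> v \<in> V"
  using smult_closed by auto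

lemma complete: "complete_for H nrm"
  using hilbert by (simp add: hilbert_space_def)

lemma ip_add: "u \<in> V \<Longrightarrow> v \<in> V \<Longrightarrow> w \<in> V \<Longrightarrow> ip u (v \<oplus> w) = ip u v + ip u w"
  and ip_smult: "u \<in> V \<Longrightarrow> v \<in> V \<Longrightarrow> ip u (c \<odot> v) = c * ip u v"
  and ip_commute: "u \<in> V \<Longrightarrow> v \<in> V \<Longrightarrow> ip v u = cnj (ip u v)"
  and ip_pos: "v \<in> V \<Longrightarrow> v \<noteq> \<zero> \<Longrightarrow> 0 < Re (ip v v)"
  using hilbert unfolding hilbert_space_def by blast+

lemma ip_zero: "u \<in> V \<Longrightarrow> ip u \<zero> = 0"
  using ip_add[of u \<zero> \<zero>] by simp

lemma minus_eq_smult: "u \<in> V \<Longrightarrow> v \<in> V \<Longrightarrow> u \<ominus> v = u \<oplus> (-1) \<odot> v"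
  by (rule complex_module_minus) unfold_locales

lemma ip_minus: "u \<in> V \<Longrightarrow> v \<in> V \<Longrightarrow> w \<in> V \<Longrightarrow> ip u (v \<ominus> w) = ip u v - ip u w"
  by (simp add: minus_eq_smult ip_add ip_smult)

lemma ip_add_left: "u \<in> V \<Longrightarrow> v \<in> V \<Longrightarrow> w \<in> V \<Longrightarrow> ip (u \<oplus> v) w = ip u w + ip v w"
  using ip_commute[of w "u \<oplus> v"] ip_commute[of w u] ip_commute[of w v] by (simp add: ip_add)

lemma ip_smult_left: "u \<in> V \<Longrightarrow> v \<in> V \<Longrightarrow> ip (c \<odot> u) v = cnj c * ip u v"
  using ip_commute[of v "c \<odot> u"] ip_commute[of v u] by (simp add: ip_smult)

lemma ip_minus_left: "u \<in> V \<Longrightarrow> v \<in> V \<Longrightarrow> w \<in> V \<Longrightarrow> ip (u \<ominus> v) w = ip u w - ip v w"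
  by (simp add: minus_eq_smult ip_add_left ip_smult_left)

lemma ip_zero_left: "u \<in> V \<Longrightarrow> ip \<zero> u = 0"
  using ip_commute[of u \<zero>] by (simp add: ip_zero)

lemmas ip_simps = ip_add ip_smult ip_zero ip_minus ip_add_left ip_smult_left ip_minus_left ip_zero_left

lemma ip_self_nonneg: "v \<in> V \<Longrightarrow> 0 \<le> Re (ip v v)"
  using ip_pos[of v] ip_zero[of \<zero>] by (cases "v = \<zero>") auto

lemma nrm_sq: "v \<in> V \<Longrightarrow> (nrm v)\<^sup>2 = Re (ip v v)"
  by (simp add: hnorm_def ip_self_nonneg)

lemma ip_self: "v \<in> V \<Longrightarrow> ip v v = of_real ((nrm v)\<^sup>2)"
  using ip_commute[of v v] by (simp add: nrm_sq complex_eq_iff)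

lemma nrm_nonneg [simp]: "v \<in> V \<Longrightarrow> 0 \<le> nrm v"
  by (simp add: hnorm_def ip_self_nonneg)

lemma nrm_zero [simp]: "nrm \<zero> = 0"
  by (simp add: hnorm_def ip_zero)

lemma nrm_eq_0: "v \<in> V \<Longrightarrow> nrm v = 0 \<longleftrightarrow> v = \<zero>"
  using ip_pos[of v] nrm_sq[of v] by fastforce

text \<open>The workhorse for vector identities: pairing with an arbitrary \<open>w\<close> turns
  them into arithmetic of complex numbers.\<close>

lemma ip_eqI:
  assumes "u \<in> V" "v \<in> V" "\<And>w. w \<in> V \<Longrightarrow> ip w u = ip w v"
  shows "u = v"
proof -
  have "(nrm (u \<ominus> v))\<^sup>2 = 0"
    using assms nrm_sq[of "u \<ominus> v"] by (simp add: ip_minus del: zero_eq_power2)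
  then have *: "u \<ominus> v = \<zero>"
    using assms(1,2) by (simp add: nrm_eq_0)
  have "u = (u \<ominus> v) \<oplus> v"
    using assms(1,2) by (simp add: a_minus_def M.a_assoc M.l_neg)
  then show ?thesis
    using assms(2) unfolding * by simp
qed

lemma Cauchy_Schwarz:
  assumes "u \<in> V" "v \<in> V"
  shows "cmod (ip u v) \<le> nrm u * nrm v"
proof (cases "v = \<zero>")
  case True
  then show ?thesis using assms by (simp add: ip_zero)
next
  case False
  \<comment> \<open>This is \<open>(nrm v)^2\<close> times the component of \<open>u\<close>
    orthogonal to \<open>v\<close>, written without division.\<close>
  define z where "z = of_real ((nrm v)\<^sup>2) \<odot> u \<ominus> ip v u \<odot> v"
  have "ip z z = of_real ((nrm v)\<^sup>2 * ((nrm v)\<^sup>2 * (nrm u)\<^sup>2 - (cmod (ip u v))\<^sup>2))"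
    using assms unfolding z_def complex_norm_square of_real_mult of_real_diff
    by (simp add: ip_simps ip_self[OF assms(1)] ip_self[OF assms(2)] ip_commute[of u v] algebra_simps power2_eq_square)
  moreover have "z \<in> V" using assms by (simp add: z_def)
  ultimately have "0 \<le> (nrm v)\<^sup>2 * ((nrm v)\<^sup>2 * (nrm u)\<^sup>2 - (cmod (ip u v))\<^sup>2)"
    using ip_self_nonneg[of z] by (simp only: Re_complex_of_real)
  moreover have "0 < (nrm v)\<^sup>2"
    using False assms nrm_eq_0 by auto
  ultimately have "(cmod (ip u v))\<^sup>2 \<le> (nrm u * nrm v)\<^sup>2"
    by (simp add: zero_le_mult_iff power_mult_distrib mult.commute)
  then show ?thesis
    by (rule power2_le_imp_le) (use assms in auto)
qed

lemma Re_ip_le: "u \<in> V \<Longrightarrow> v \<in> V \<Longrightarrow> Re (ip u v) \<le> nrm u * nrm v"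
  using Cauchy_Schwarz complex_Re_le_cmod order_trans by blast

lemma nrm_smult: "v \<in> V \<Longrightarrow> nrm (c \<odot> v) = cmod c * nrm v"
proof -
  assume v: "v \<in> V"
  have "ip (c \<odot> v) (c \<odot> v) = of_real ((cmod c * nrm v)\<^sup>2)"
    using v by (simp add: ip_smult ip_smult_left ip_self[OF v] power_mult_distrib mult.assoc[symmetric] complex_norm_square[of c, symmetric] mult.commute[of "cnj c"])
  then have "(nrm (c \<odot> v))\<^sup>2 = (cmod c * nrm v)\<^sup>2"
    using v by (simp add: nrm_sq)
  then show ?thesis
    using v by (simp add: power2_eq_iff_nonneg)
qed

lemma nrm_add_sq:
  "u \<in> V \<Longrightarrow> v \<in> V \<Longrightarrow> (nrm (u \<oplus> v))\<^sup>2 = (nrm u)\<^sup>2 + 2 * Re (ip u v) + (nrm v)\<^sup>2"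
  using ip_commute[of u v] by (simp add: nrm_sq ip_simps)

lemma nrm_minus_sq:
  "u \<in> V \<Longrightarrow> v \<in> V \<Longrightarrow> (nrm (u \<ominus> v))\<^sup>2 = (nrm u)\<^sup>2 - 2 * Re (ip u v) + (nrm v)\<^sup>2"
  using ip_commute[of u v] by (simp add: nrm_sq ip_simps)

lemma nrm_triangle: "u \<in> V \<Longrightarrow> v \<in> V \<Longrightarrow> nrm (u \<oplus> v) \<le> nrm u + nrm v"
  by (rule power2_le_imp_le) (use Re_ip_le[of u v] in \<open>auto simp: nrm_add_sq power2_sum\<close>)

lemma nrm_minus_le: "u \<in> V \<Longrightarrow> v \<in> V \<Longrightarrow> nrm (u \<ominus> v) \<le> nrm u + nrm v"
  using nrm_triangle[of u "(-1) \<odot> v"] by (simp add: minus_eq_smult nrm_smult)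

lemma nrm_minus_commute: "u \<in> V \<Longrightarrow> v \<in> V \<Longrightarrow> nrm (u \<ominus> v) = nrm (v \<ominus> u)"
  using ip_commute[of u v] by (simp add: hnorm_def ip_simps)

lemma nrm_minus_triangle:
  assumes "u \<in> V" "v \<in> V" "w \<in> V"
  shows "nrm (u \<ominus> w) \<le> nrm (u \<ominus> v) + nrm (v \<ominus> w)"
proof -
  have "u \<ominus> w = (u \<ominus> v) \<oplus> (v \<ominus> w)"
    by (rule ip_eqI) (use assms in \<open>auto simp: ip_simps\<close>)
  then show ?thesis using assms nrm_triangle by simp
qed

text \<open>Bounds operators that are known only through their matrix coefficients. The test vector
  is \<open>v\<close> itself.\<close>

lemma nrm_le_ipI:
  assumes "v \<in> V" "0 \<le> c" "\<And>w. w \<in> V \<Longrightarrow> cmod (ip w v) \<le> c * nrm w"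
  shows "nrm v \<le> c"
proof (cases "nrm v = 0")
  case False
  have "nrm v * nrm v \<le> c * nrm v"
    using assms(3)[OF assms(1)] ip_self[OF assms(1)]
    by (simp add: power2_eq_square norm_mult)
  then show ?thesis using False assms(1) by (simp add: mult_le_cancel_right order_less_le)
qed (use assms in simp)

section \<open>Limits, nearest points and the Riesz representation\<close>

lemma tendsto_ip:
  assumes "\<And>n. s n \<in> V" "l \<in> V" "w \<in> V" "(\<lambda>n. nrm (s n \<ominus> l)) \<longlonglongrightarrow> 0"
  shows "(\<lambda>n. ip w (s n)) \<longlonglongrightarrow> ip w l"
proof (rule LIM_zero_cancel)
  have "(\<lambda>n. nrm w * nrm (s n \<ominus> l)) \<longlonglongrightarrow> 0"
    using tendsto_mult_left[OF assms(4), of "nrm w"] by simp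
  then show "(\<lambda>n. ip w (s n) - ip w l) \<longlonglongrightarrow> 0"
    by (rule null_comparison)
      (use Cauchy_Schwarz[of w "s _ \<ominus> l"] assms in \<open>auto simp: ip_minus\<close>)
qed

lemma complete_limit:
  assumes "\<And>n. s n \<in> V" "\<And>e. 0 < e \<Longrightarrow> \<exists>N. \<forall>m\<ge>N. \<forall>n\<ge>N. nrm (s m \<ominus> s n) < e"
  obtains l where "l \<in> V" "(\<lambda>n. nrm (s n \<ominus> l)) \<longlonglongrightarrow> 0"
  using complete assms unfolding complete_for_def dist_Cauchy_def by blast

text \<open>\<open>K\<close> is only a real subspace because the density argument below treats an operator and its
  adjoint at once, and \<open>a \<mapsto> \<pi>(a)\<^sup>*\<close> is conjugate linear.\<close>

lemma orthogonal_witness: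
  assumes K: "K \<subseteq> V" "\<zero> \<in> K" "\<And>u v. u \<in> K \<Longrightarrow> v \<in> K \<Longrightarrow> u \<oplus> v \<in> K"
      "\<And>(r::real) v. v \<in> K \<Longrightarrow> of_real r \<odot> v \<in> K"
    and s: "s \<in> V" and e: "0 < e" and far: "\<And>k. k \<in> K \<Longrightarrow> e \<le> nrm (s \<ominus> k)"
  obtains w where "w \<in> V" "\<And>k. k \<in> K \<Longrightarrow> Re (ip w k) = 0" "Re (ip w s) > 0"
proof -
  define D where "D = (\<lambda>k. (nrm (s \<ominus> k))\<^sup>2) ` K"
  define d where "d = Inf D"
  have KV: "k \<in> K \<Longrightarrow> k \<in> V" for k using K by auto
  have bdd: "bdd_below D" unfolding D_def by (rule bdd_belowI[of _ 0]) auto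
  have ne: "D \<noteq> {}" using K(2) by (auto simp: D_def)
  have d_le: "d \<le> (nrm (s \<ominus> k))\<^sup>2" if "k \<in> K" for k
    unfolding d_def by (rule cInf_lower) (use bdd that in \<open>auto simp: D_def\<close>)
  have "e\<^sup>2 \<le> d"
    unfolding d_def using far e ne by (intro cInf_greatest) (auto simp: D_def intro: power_mono)
  then have d_pos: "0 < d" using e by (meson less_le_trans zero_less_power)
  have "\<exists>k\<in>K. (nrm (s \<ominus> k))\<^sup>2 < d + inverse (real (Suc n))" for n
    using cInf_lessD[OF ne, of "d + inverse (real (Suc n))"] by (auto simp: d_def D_def)
  then obtain k where kK: "\<And>n. k n \<in> K"
    and k: "\<And>n. (nrm (s \<ominus> k n))\<^sup>2 < d + inverse (real (Suc n))" by metis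
  have kV: "k n \<in> V" for n using kK KV by auto
  \<comment> \<open>Parallelogram law: the midpoint of \<open>k m\<close> and \<open>k n\<close>
    lies in \<open>K\<close>, so its squared distance from \<open>s\<close> is at least
    \<open>d\<close>.\<close>
  have par: "(nrm (k m \<ominus> k n))\<^sup>2 \<le> 2 * (inverse (real (Suc m)) + inverse (real (Suc n)))" for m n
  proof -
    have "(nrm (k m \<ominus> k n))\<^sup>2 + 4 * (nrm (s \<ominus> of_real (1/2) \<odot> (k m \<oplus> k n)))\<^sup>2
        = 2 * (nrm (s \<ominus> k m))\<^sup>2 + 2 * (nrm (s \<ominus> k n))\<^sup>2"
      using kV[of m] kV[of n] s ip_commute[of s "k m"] ip_commute[of s "k n"] ip_commute[of "k m" "k n"]
      by (simp add: nrm_sq ip_simps algebra_simps)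
    moreover have "d \<le> (nrm (s \<ominus> of_real (1/2) \<odot> (k m \<oplus> k n)))\<^sup>2"
      by (intro d_le K(4) K(3) kK)
    ultimately show ?thesis using k[of m] k[of n] by (simp add: algebra_simps)
  qed
  have "\<exists>N. \<forall>m\<ge>N. \<forall>n\<ge>N. nrm (k m \<ominus> k n) < \<epsilon>" if "0 < \<epsilon>" for \<epsilon>
  proof -
    obtain N where N: "inverse (real (Suc N)) < \<epsilon>\<^sup>2 / 4"
      using reals_Archimedean[of "\<epsilon>\<^sup>2 / 4"] \<open>0 < \<epsilon>\<close>
      by (metis zero_less_divide_iff zero_less_numeral zero_less_power)
    have "nrm (k m \<ominus> k n) < \<epsilon>" if mn: "m \<ge> N" "n \<ge> N" for m n
    proof -
      have "inverse (real (Suc m)) \<le> inverse (real (Suc N))" "inverse (real (Suc n)) \<le> inverse (real (Suc N))"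
        using mn by (auto intro: le_imp_inverse_le)
      moreover have "x < \<epsilon>\<^sup>2" if "x \<le> 2 * (a + b)" "a \<le> c" "b \<le> c" "c < \<epsilon>\<^sup>2 / 4" for a b c x :: real
        using that by (simp add: field_simps)
      ultimately have "(nrm (k m \<ominus> k n))\<^sup>2 < \<epsilon>\<^sup>2"
        using par[of m n] N by blast
      then show ?thesis using \<open>0 < \<epsilon>\<close> power_less_imp_less_base by fastforce
    qed
    then show ?thesis by blast
  qed
  then obtain l where lV: "l \<in> V" and l: "(\<lambda>n. nrm (k n \<ominus> l)) \<longlonglongrightarrow> 0"
    using complete_limit[of k] kV by blast
  \<comment> \<open>The limit \<open>l\<close> is the nearest point in the closure of
    \<open>K\<close> and need not lie in \<open>K\<close>, so every property of \<open>w\<close> is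
    obtained by passing to the limit along \<open>k n\<close>.\<close>
  define w where "w = s \<ominus> l"
  have wV: "w \<in> V" using s lV by (simp add: w_def)
  have "(\<lambda>n. (nrm (s \<ominus> k n))\<^sup>2) \<longlonglongrightarrow> d"
  proof (rule LIM_zero_cancel, rule null_comparison[OF LIMSEQ_inverse_real_of_nat])
    show "norm ((nrm (s \<ominus> k n))\<^sup>2 - d) \<le> inverse (real (Suc n))" for n
      using d_le[OF kK, of n] k[of n] by (simp add: abs_le_iff del: of_nat_Suc)
  qed
  moreover have "(\<lambda>n. nrm (s \<ominus> k n)) \<longlonglongrightarrow> nrm w"
  proof (rule LIM_zero_cancel, rule null_comparison[OF l])
    fix n
    have "nrm (s \<ominus> k n) \<le> nrm w + nrm (k n \<ominus> l)" "nrm w \<le> nrm (s \<ominus> k n) + nrm (k n \<ominus> l)"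
      using nrm_minus_triangle[of s l "k n"] nrm_minus_triangle[of s "k n" l]
        nrm_minus_commute[of l "k n"] kV[of n] s lV by (auto simp: w_def)
    then show "norm (nrm (s \<ominus> k n) - nrm w) \<le> nrm (k n \<ominus> l)" by simp
  qed
  then have "(\<lambda>n. (nrm (s \<ominus> k n))\<^sup>2) \<longlonglongrightarrow> (nrm w)\<^sup>2" by (rule tendsto_power)
  ultimately have wd: "(nrm w)\<^sup>2 = d" using LIMSEQ_unique by blast
  \<comment> \<open>Moving \<open>k n\<close> by \<open>t\<close> times \<open>u\<close> stays in
    \<open>K\<close>, so the squared distance remains at least \<open>d\<close>. In the limit this
    is a quadratic inequality in \<open>t\<close> whose linear coefficient must vanish.\<close>
  have orth: "Re (ip w u) = 0" if u: "u \<in> K" for u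
  proof -
    have uV: "u \<in> V" using u KV by auto
    have ge: "0 \<le> t\<^sup>2 * (nrm u)\<^sup>2 - 2 * t * Re (ip w u)" for t :: real
    proof -
      have lim: "(\<lambda>n. (nrm (s \<ominus> k n))\<^sup>2 - 2 * t * Re (ip u (s \<ominus> k n)) + t\<^sup>2 * (nrm u)\<^sup>2)
          \<longlonglongrightarrow> d - 2 * t * Re (ip u w) + t\<^sup>2 * (nrm u)\<^sup>2"
      proof (intro tendsto_add tendsto_diff tendsto_mult tendsto_const tendsto_Re)
        show "(\<lambda>n. (nrm (s \<ominus> k n))\<^sup>2) \<longlonglongrightarrow> d" by fact
        have "(\<lambda>n. ip u s - ip u (k n)) \<longlonglongrightarrow> ip u s - ip u l"
          by (intro tendsto_diff tendsto_const tendsto_ip[OF kV lV uV l])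
        then show "(\<lambda>n. ip u (s \<ominus> k n)) \<longlonglongrightarrow> ip u w"
          using s kV lV uV by (simp add: ip_minus w_def)
      qed
      have "d \<le> (nrm (s \<ominus> k n))\<^sup>2 - 2 * t * Re (ip u (s \<ominus> k n)) + t\<^sup>2 * (nrm u)\<^sup>2" for n
      proof -
        have "d \<le> (nrm (s \<ominus> (k n \<oplus> of_real t \<odot> u)))\<^sup>2"
          by (intro d_le K(4) K(3) kK u)
        also have "\<dots> = (nrm (s \<ominus> k n))\<^sup>2 - 2 * t * Re (ip u (s \<ominus> k n)) + t\<^sup>2 * (nrm u)\<^sup>2"
        proof -
          have eq: "s \<ominus> (k n \<oplus> of_real t \<odot> u) = (s \<ominus> k n) \<ominus> of_real t \<odot> u"
            by (rule ip_eqI) (use kV[of n] s uV in \<open>auto simp: ip_simps\<close>)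
          show ?thesis
            using kV[of n] s uV ip_commute[of u "s \<ominus> k n"] unfolding eq
            by (simp add: nrm_minus_sq nrm_smult ip_smult power_mult_distrib)
        qed
        finally show ?thesis .
      qed
      then have "d \<le> d - 2 * t * Re (ip u w) + t\<^sup>2 * (nrm u)\<^sup>2"
        using LIMSEQ_le_const[OF lim] by blast
      then show ?thesis using ip_commute[OF uV wV] by simp
    qed
    show ?thesis
      by (rule quadratic_nonneg_imp_linear_zero[of "(nrm u)\<^sup>2"]) (use ge in auto)
  qed
  have "(\<lambda>n. Re (ip w (k n))) \<longlonglongrightarrow> Re (ip w l)"
    by (intro tendsto_Re tendsto_ip[OF kV lV wV l])
  then have "Re (ip w l) = 0" by (simp add: orth kK LIMSEQ_const_iff)
  moreover have "Re (ip w s) = Re (ip w w) + Re (ip w l)"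
    using wV s lV by (simp add: ip_minus w_def)
  ultimately have "Re (ip w s) = d" using wd nrm_sq[OF wV] by simp
  then show ?thesis using that[OF wV orth] d_pos by simp
qed

text \<open>A representing vector is orthogonal to the kernel of \<open>g\<close>. A witness
  separating the kernel from some \<open>s\<close> with \<open>g s \<noteq> 0\<close> therefore is
  one, up to a scalar.\<close>

lemma Riesz:
  assumes add: "\<And>u v. u \<in> V \<Longrightarrow> v \<in> V \<Longrightarrow> g (u \<oplus> v) = g u + g v"
    and smult: "\<And>c v. v \<in> V \<Longrightarrow> g (c \<odot> v) = c * g v"
    and bound: "\<And>v. v \<in> V \<Longrightarrow> cmod (g v) \<le> C * nrm v"
  obtains w where "w \<in> V" "\<And>v. v \<in> V \<Longrightarrow> g v = ip w v"
proof (cases "\<forall>v\<in>V. g v = 0")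
  case True
  then show ?thesis using that[of \<zero>] by (simp add: ip_zero_left)
next
  case False
  then obtain s where s: "s \<in> V" "g s \<noteq> 0" by auto
  define K where "K = {v \<in> V. g v = 0}"
  have minus: "g (u \<ominus> v) = g u - g v" if "u \<in> V" "v \<in> V" for u v
    using that by (simp add: minus_eq_smult add smult)
  have g0: "g \<zero> = 0" using add[of \<zero> \<zero>] by simp
  have C0: "0 < C"
    using bound[OF s(1)] s by (metis mult_nonpos_nonneg norm_le_zero_iff not_le nrm_nonneg order_trans)
  obtain w where w: "w \<in> V" "\<And>k. k \<in> K \<Longrightarrow> Re (ip w k) = 0" "Re (ip w s) > 0"
  proof (rule orthogonal_witness[of K s "cmod (g s) / C"])
    \<comment> \<open>On the kernel, \<open>g s = g (s \<ominus> k)\<close>, which the bound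
      \<open>C\<close> controls by the distance.\<close>
    show "cmod (g s) / C \<le> nrm (s \<ominus> k)" if "k \<in> K" for k
      using bound[of "s \<ominus> k"] that s C0 by (simp add: K_def minus field_simps)
  qed (use s C0 in \<open>auto simp: K_def add smult g0\<close>)
  \<comment> \<open>The kernel is complex linear: applying the real orthogonality to
    \<open>\<i> \<odot> k\<close> gives the imaginary part.\<close>
  have orth: "ip w k = 0" if "k \<in> K" for k
    using w(2)[OF that] w(2)[of "\<i> \<odot> k"] w(1) that
    by (auto simp: K_def smult ip_simps complex_eq_iff)
  have ws: "ip w s \<noteq> 0" using w(3) by auto
  have "g v = ip (cnj (g s / ip w s) \<odot> w) v" if v: "v \<in> V" for v
  proof -
    \<comment> \<open>Splits \<open>v\<close> into a kernel element and a multiple of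
      \<open>s\<close>.\<close>
    have "v \<ominus> (g v / g s) \<odot> s \<in> K" using v s by (simp add: K_def minus smult)
    from orth[OF this] show ?thesis
      using v s w(1) ws by (simp add: ip_simps field_simps)
  qed
  then show ?thesis using that[of "cnj (g s / ip w s) \<odot> w"] w by auto
qed

section \<open>Adjoint pairs and operator norms\<close>

text \<open>An operator travels together with its adjoint as an explicit pair. Linearity of both is
  then a consequence, by moving the operator to the other side of the inner product.\<close>

definition adj :: "('v \<Rightarrow> 'v) \<Rightarrow> ('v \<Rightarrow> 'v) \<Rightarrow> bool" where
  "adj S S' \<longleftrightarrow> S \<in> V \<rightarrow> V \<and> S' \<in> V \<rightarrow> V \<and> (\<forall>u\<in>V. \<forall>v\<in>V. ip (S u) v = ip u (S' v))"

lemma adj_closed: "adj S S' \<Longrightarrow> v \<in> V \<Longrightarrow> S v \<in> V" "adj S S' \<Longrightarrow> v \<in> V \<Longrightarrow> S' v \<in> V"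
  by (auto simp: adj_def)

lemma adj_ip: "adj S S' \<Longrightarrow> u \<in> V \<Longrightarrow> v \<in> V \<Longrightarrow> ip (S u) v = ip u (S' v)"
  by (auto simp: adj_def)

lemma adj_sym: "adj S S' \<Longrightarrow> adj S' S"
  unfolding adj_def by (metis funcset_mem ip_commute)

lemma adj_ip': "adj S S' \<Longrightarrow> u \<in> V \<Longrightarrow> v \<in> V \<Longrightarrow> ip u (S v) = ip (S' u) v"
  by (simp add: adj_ip[OF adj_sym])

lemma adj_add: "adj S S' \<Longrightarrow> u \<in> V \<Longrightarrow> v \<in> V \<Longrightarrow> S (u \<oplus> v) = S u \<oplus> S v"
  by (rule ip_eqI) (auto simp: adj_closed adj_ip' ip_simps)

lemma adj_smult: "adj S S' \<Longrightarrow> v \<in> V \<Longrightarrow> S (c \<odot> v) = c \<odot> S v"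
  by (rule ip_eqI) (auto simp: adj_closed adj_ip' ip_simps)

lemma adj_minus: "adj S S' \<Longrightarrow> u \<in> V \<Longrightarrow> v \<in> V \<Longrightarrow> S (u \<ominus> v) = S u \<ominus> S v"
  by (rule ip_eqI) (auto simp: adj_closed adj_ip' ip_simps)

lemma adj_zero: "adj S S' \<Longrightarrow> S \<zero> = \<zero>"
  by (rule ip_eqI) (auto simp: adj_closed adj_ip' ip_simps)

lemma adj_bound:
  assumes "adj S S'" "\<And>v. v \<in> V \<Longrightarrow> nrm (S v) \<le> c * nrm v" "0 \<le> c" "v \<in> V"
  shows "nrm (S' v) \<le> c * nrm v"
proof (rule nrm_le_ipI)
  fix w assume w: "w \<in> V"
  have "cmod (ip w (S' v)) \<le> nrm (S w) * nrm v"
    using Cauchy_Schwarz[of "S w" v] w assms by (simp add: adj_ip adj_closed)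
  also have "\<dots> \<le> (c * nrm w) * nrm v"
    using assms w by (intro mult_right_mono) auto
  finally show "cmod (ip w (S' v)) \<le> c * nrm v * nrm w" by (simp add: ac_simps)
qed (use assms in \<open>auto simp: adj_closed\<close>)

text \<open>The inequality behind the C*-identity: \<open>(S v, S v) = (v, S'S v)\<close>.\<close>

lemma adj_bound_sq:
  assumes "adj S S'" "0 \<le> c" "\<And>v. v \<in> V \<Longrightarrow> nrm (S' (S v)) \<le> c * nrm v" "v \<in> V"
  shows "(nrm (S v))\<^sup>2 \<le> c * (nrm v)\<^sup>2"
proof -
  have "(nrm (S v))\<^sup>2 = Re (ip v (S' (S v)))"
    using assms by (simp add: nrm_sq adj_closed adj_ip)
  also have "\<dots> \<le> nrm v * nrm (S' (S v))"
    using assms by (intro Re_ip_le) (auto simp: adj_closed)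
  also have "\<dots> \<le> nrm v * (c * nrm v)"
    using assms by (intro mult_left_mono) auto
  finally show ?thesis by (simp add: power2_eq_square ac_simps)
qed

lemma op_norm_le:
  assumes "\<And>v. v \<in> V \<Longrightarrow> nrm (T v) \<le> c * nrm v" "0 \<le> c"
  shows "op_norm H T \<le> c"
  unfolding op_norm_def
proof (rule cSup_least)
  show "{nrm (T v) |v. v \<in> V \<and> nrm v \<le> 1} \<noteq> {}"
    by (auto intro: exI[of _ \<zero>])
  fix r assume "r \<in> {nrm (T v) |v. v \<in> V \<and> nrm v \<le> 1}"
  then obtain v where v: "r = nrm (T v)" "v \<in> V" "nrm v \<le> 1" by auto
  then have "r \<le> c * nrm v" using assms by auto
  also have "\<dots> \<le> c * 1" using v assms by (intro mult_left_mono) auto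
  finally show "r \<le> c" by simp
qed

text \<open>The supremum of an unbounded set of reals has no meaning, so some crude bound
  \<open>c\<close> must be supplied before \<open>op_norm\<close> can be used. The estimate itself
  is rescaling to a unit vector.\<close>

lemma op_norm_bound:
  assumes T: "T \<in> V \<rightarrow> V" "\<And>c v. v \<in> V \<Longrightarrow> T (c \<odot> v) = c \<odot> T v"
    and b: "\<And>v. v \<in> V \<Longrightarrow> nrm (T v) \<le> c * nrm v"
  shows "v \<in> V \<Longrightarrow> nrm (T v) \<le> op_norm H T * nrm v" and "0 \<le> op_norm H T"
proof -
  have bdd: "bdd_above {nrm (T v) |v. v \<in> V \<and> nrm v \<le> 1}"
  proof (rule bdd_aboveI[of _ "\<bar>c\<bar>"])
    fix r assume "r \<in> {nrm (T v) |v. v \<in> V \<and> nrm v \<le> 1}"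
    then obtain v where v: "r = nrm (T v)" "v \<in> V" "nrm v \<le> 1" by auto
    then have "r \<le> c * nrm v" using b by auto
    also have "\<dots> \<le> \<bar>c\<bar> * nrm v" using v by (intro mult_right_mono) auto
    also have "\<dots> \<le> \<bar>c\<bar> * 1" using v by (intro mult_left_mono) auto
    finally show "r \<le> \<bar>c\<bar>" by simp
  qed
  have up: "nrm (T v) \<le> op_norm H T" if "v \<in> V" "nrm v \<le> 1" for v
    unfolding op_norm_def using that bdd by (intro cSup_upper) auto
  have TV: "T v \<in> V" if "v \<in> V" for v using T that by auto
  show nn: "0 \<le> op_norm H T"
    using up[of \<zero>] nrm_nonneg[OF TV[of \<zero>]] by simp
  show "nrm (T v) \<le> op_norm H T * nrm v" if v: "v \<in> V"
  proof (cases "nrm v = 0")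
    case True
    then show ?thesis using b[OF v] by simp
  next
    case False
    then have pos: "0 < nrm v" using v nrm_nonneg[of v] by linarith
    have "nrm (T (of_real (1 / nrm v) \<odot> v)) \<le> op_norm H T"
      using v pos by (intro up) (auto simp: nrm_smult norm_divide)
    then show ?thesis using v pos TV by (simp add: T nrm_smult norm_divide field_simps)
  qed
qed

end

section \<open>The direct sum of two Hilbert spaces\<close>

lemma hilbert_sum_simps [simp]:
  "carrier (hilbert_sum H K) = carrier H \<times> carrier K"
  "\<zero>\<^bsub>hilbert_sum H K\<^esub> = (\<zero>\<^bsub>H\<^esub>, \<zero>\<^bsub>K\<^esub>)"
  "(u, v) \<oplus>\<^bsub>hilbert_sum H K\<^esub> (u', v') = (u \<oplus>\<^bsub>H\<^esub> u', v \<oplus>\<^bsub>K\<^esub> v')"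
  "c \<odot>\<^bsub>hilbert_sum H K\<^esub> (u, v) = (c \<odot>\<^bsub>H\<^esub> u, c \<odot>\<^bsub>K\<^esub> v)"
  "hinner (hilbert_sum H K) (u, v) (u', v') = hinner H u u' + hinner K v v'"
  by (simp_all add: hilbert_sum_def)

lemma module_hilbert_sum:
  assumes "module complex_ring H" "module complex_ring K"
  shows "module complex_ring (hilbert_sum H K)"
proof -
  interpret H: module complex_ring H by fact
  interpret K: module complex_ring K by fact
  have neg: "v \<oplus>\<^bsub>L\<^esub> (-1) \<odot>\<^bsub>L\<^esub> v = \<zero>\<^bsub>L\<^esub>" if "module complex_ring L" "v \<in> carrier L" for v :: 'c and L :: "'c hilbert"
    using complex_module_minus[OF that(1) that(2) that(2)] that
    by (simp add: a_minus_def module_def abelian_group.r_neg)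
  show ?thesis
    by (rule module_complex_ringI)
      (auto intro: H.M.a_comm K.M.a_comm simp: H.M.a_assoc K.M.a_assoc H.smult_closed[simplified] K.smult_closed[simplified]
        neg[OF assms(1)] neg[OF assms(2)] H.smult_l_distr[simplified] K.smult_l_distr[simplified]
        H.smult_r_distr[simplified] K.smult_r_distr[simplified] H.smult_assoc1[simplified] K.smult_assoc1[simplified]
        H.smult_one[simplified] K.smult_one[simplified])
qed

lemma hilbert_sum_minus:
  assumes "module complex_ring H" "module complex_ring K"
    "u \<in> carrier H" "u' \<in> carrier H" "v \<in> carrier K" "v' \<in> carrier K"
  shows "(u, v) \<ominus>\<^bsub>hilbert_sum H K\<^esub> (u', v') = (u \<ominus>\<^bsub>H\<^esub> u', v \<ominus>\<^bsub>K\<^esub> v')"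
  using assms by (simp add: complex_module_minus module_hilbert_sum)

text \<open>Approximating an operator on one vector and its adjoint on another by the same algebra
  element is one approximation problem in the sum of two copies of the space.\<close>

lemma hilbert_space_hilbert_sum:
  assumes "hilbert_space H" "hilbert_space K"
  shows "hilbert_space (hilbert_sum H K)"
proof -
  interpret H: hilb H by unfold_locales fact
  interpret K: hilb K by unfold_locales fact
  let ?S = "hilbert_sum H K"
  have mods: "module complex_ring H" "module complex_ring K" by unfold_locales
  note minus = hilbert_sum_minus[OF mods]
  have nrm: "(hnorm ?S (u, v))\<^sup>2 = (hnorm H u)\<^sup>2 + (hnorm K v)\<^sup>2" "0 \<le> hnorm ?S (u, v)"
    if "u \<in> carrier H" "v \<in> carrier K" for u v
    using that by (simp_all add: hnorm_def H.ip_self_nonneg K.ip_self_nonneg)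
  have le: "hnorm H u \<le> hnorm ?S (u, v)" "hnorm K v \<le> hnorm ?S (u, v)"
      "hnorm ?S (u, v) \<le> hnorm H u + hnorm K v"
    if uv: "u \<in> carrier H" "v \<in> carrier K" for u v
    by (rule power2_le_imp_le; use nrm[OF uv] uv in \<open>simp add: power2_sum\<close>)+
  have "complete_for ?S (hnorm ?S)"
    unfolding complete_for_def dist_Cauchy_def
  proof (intro allI impI, elim conjE)
    fix s :: "nat \<Rightarrow> _" assume s: "\<forall>n. s n \<in> carrier ?S"
      and C: "\<forall>e>0. \<exists>N. \<forall>m\<ge>N. \<forall>n\<ge>N. hnorm ?S (s m \<ominus>\<^bsub>?S\<^esub> s n) < e"
    define a b where "a n = fst (s n)" and "b n = snd (s n)" for n
    have ab: "s n = (a n, b n)" "a n \<in> carrier H" "b n \<in> carrier K" for n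
      using spec[OF s, of n] by (auto simp: a_def b_def)
    have ab_le: "hnorm H (a m \<ominus>\<^bsub>H\<^esub> a n) \<le> hnorm ?S (s m \<ominus>\<^bsub>?S\<^esub> s n)"
        "hnorm K (b m \<ominus>\<^bsub>K\<^esub> b n) \<le> hnorm ?S (s m \<ominus>\<^bsub>?S\<^esub> s n)" for m n
      using le(1,2)[of "a m \<ominus>\<^bsub>H\<^esub> a n" "b m \<ominus>\<^bsub>K\<^esub> b n"] ab by (simp_all add: minus H.closed K.closed)
    have Ca: "\<exists>N. \<forall>m\<ge>N. \<forall>n\<ge>N. hnorm H (a m \<ominus>\<^bsub>H\<^esub> a n) < e"
     and Cb: "\<exists>N. \<forall>m\<ge>N. \<forall>n\<ge>N. hnorm K (b m \<ominus>\<^bsub>K\<^esub> b n) < e" if e: "0 < e" for e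
    proof -
      obtain N where N: "\<And>m n. m \<ge> N \<Longrightarrow> n \<ge> N \<Longrightarrow> hnorm ?S (s m \<ominus>\<^bsub>?S\<^esub> s n) < e"
        using C[rule_format, OF e] by metis
      show "\<exists>N. \<forall>m\<ge>N. \<forall>n\<ge>N. hnorm H (a m \<ominus>\<^bsub>H\<^esub> a n) < e"
        by (intro exI[of _ N] allI impI order_le_less_trans[OF ab_le(1)] N)
      show "\<exists>N. \<forall>m\<ge>N. \<forall>n\<ge>N. hnorm K (b m \<ominus>\<^bsub>K\<^esub> b n) < e"
        by (intro exI[of _ N] allI impI order_le_less_trans[OF ab_le(2)] N)
    qed
    obtain l m where l: "l \<in> carrier H" "(\<lambda>n. hnorm H (a n \<ominus>\<^bsub>H\<^esub> l)) \<longlonglongrightarrow> 0"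
      and m: "m \<in> carrier K" "(\<lambda>n. hnorm K (b n \<ominus>\<^bsub>K\<^esub> m)) \<longlonglongrightarrow> 0"
      using H.complete_limit[OF ab(2) Ca] K.complete_limit[OF ab(3) Cb] by metis
    have "(\<lambda>n. hnorm ?S (s n \<ominus>\<^bsub>?S\<^esub> (l, m))) \<longlonglongrightarrow> 0"
    proof (rule null_comparison)
      show "(\<lambda>n. hnorm H (a n \<ominus>\<^bsub>H\<^esub> l) + hnorm K (b n \<ominus>\<^bsub>K\<^esub> m)) \<longlonglongrightarrow> 0"
        using tendsto_add[OF l(2) m(2)] by simp
      show "norm (hnorm ?S (s n \<ominus>\<^bsub>?S\<^esub> (l, m))) \<le> hnorm H (a n \<ominus>\<^bsub>H\<^esub> l) + hnorm K (b n \<ominus>\<^bsub>K\<^esub> m)" for n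
        using le(3)[OF H.closed(3)[OF ab(2)[of n] l(1)] K.closed(3)[OF ab(3)[of n] m(1)]]
          nrm(2)[OF H.closed(3)[OF ab(2)[of n] l(1)] K.closed(3)[OF ab(3)[of n] m(1)]]
        unfolding ab(1)[of n] minus[OF ab(2)[of n] l(1) ab(3)[of n] m(1)] by simp
    qed
    then show "\<exists>x\<in>carrier ?S. (\<lambda>n. hnorm ?S (s n \<ominus>\<^bsub>?S\<^esub> x)) \<longlonglongrightarrow> 0"
      using l(1) m(1) by (intro bexI[of _ "(l, m)"]) auto
  qed
  moreover have "0 < Re (hinner ?S v v)" if "v \<in> carrier ?S" "v \<noteq> \<zero>\<^bsub>?S\<^esub>" for v
    using that H.ip_pos K.ip_pos H.ip_self_nonneg K.ip_self_nonneg
    by (cases v) (auto simp: add_pos_nonneg add_nonneg_pos)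
  ultimately show ?thesis
    unfolding hilbert_space_def using module_hilbert_sum[OF mods]
    by (auto simp: H.ip_simps K.ip_simps algebra_simps) (metis H.ip_commute K.ip_commute)
qed

section \<open>Resolvents of \<open>A'A\<close>\<close>

context hilb
begin

text \<open>Pairing the equation with \<open>u\<close> gives
  \<open>x^2 + y^2 \<le> x p + y q\<close> in the notation of the proof. The size of
  \<open>A\<close> does not enter; this matters because \<open>A\<close> will be
  \<open>\<pi>(a)\<close> with no control over \<open>a\<close>.\<close>

lemma resolvent_bound:
  assumes A: "adj A A'" and V: "u \<in> V" "e \<in> V" "g \<in> V"
    and eq: "u \<oplus> A' (A u) = e \<oplus> A' g"
  shows "nrm (A u) \<le> nrm e + nrm g"
proof (rule ccontr)
  define x y p q where "x = nrm u" and "y = nrm (A u)" and "p = nrm e" and "q = nrm g"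
  have nn: "0 \<le> x" "0 \<le> p" "0 \<le> q"
    using A V by (simp_all add: x_def p_def q_def)
  have "Re (ip u (u \<oplus> A' (A u))) = x\<^sup>2 + y\<^sup>2"
    using A V by (simp add: ip_add adj_ip[symmetric] adj_closed nrm_sq x_def y_def)
  moreover have "Re (ip u (e \<oplus> A' g)) \<le> x * p + y * q"
    using A V Re_ip_le[of u e] Re_ip_le[of "A u" g]
    by (simp add: ip_add adj_ip[symmetric] adj_closed x_def y_def p_def q_def)
  ultimately have "x\<^sup>2 + y\<^sup>2 \<le> x * p + y * q"
    using eq by simp
  assume "\<not> ?thesis"
  then have y: "p + q < y" by (simp add: y_def p_def q_def)
  \<comment> \<open>Completing the square eliminates \<open>x\<close> and leaves
    \<open>y^2 \<le> p^2/4 + y q\<close>, which fails for \<open>y > p + q\<close>.\<close>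
  have "0 \<le> (x - p / 2)\<^sup>2" by simp
  then have "x * p - x\<^sup>2 \<le> p\<^sup>2 / 4"
    by (simp add: power2_eq_square algebra_simps)
  moreover have "p\<^sup>2 \<le> y * p" using y nn by (simp add: power2_eq_square mult_right_mono)
  moreover have "y * (p + q) < y * y" using y nn by (intro mult_strict_left_mono) auto
  then have "y * p + y * q < y\<^sup>2" by (simp add: power2_eq_square distrib_left)
  moreover have "0 \<le> p\<^sup>2" by simp
  ultimately show False
    using \<open>x\<^sup>2 + y\<^sup>2 \<le> x * p + y * q\<close> by linarith
qed

text \<open>The iteration approximates \<open>(1 + A'A)\<inverse>v\<close> by polynomials in \<open>A'A\<close>.\<close>

lemma resolvent_iteration:
  assumes A: "adj A A'" and v: "v \<in> V"
    and bound: "\<And>v. v \<in> V \<Longrightarrow> nrm (A' v) \<le> l * nrm v" and l: "0 \<le> l"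
    and K: "1 + l\<^sup>2 \<le> K"
    and w0: "w 0 = \<zero>"
    and wS: "\<And>n. w (Suc n) = w n \<oplus> of_real (1 / K) \<odot> (v \<ominus> (w n \<oplus> A' (A (w n))))"
  shows "w n \<in> V" "nrm (v \<ominus> (w n \<oplus> A' (A (w n)))) \<le> (1 - 1 / K) ^ n * nrm v"
    "2 * nrm (A (w n)) \<le> (1 + (1 - 1 / K) ^ n) * nrm v"
proof -
  have K1: "1 \<le> K" using K l by (meson le_add_same_cancel1 order_trans zero_le_power2)
  note cl = adj_closed[OF A]
  have wV: "w n \<in> V" for n
    by (induction n) (simp_all add: w0 wS cl v)
  then show "w n \<in> V" .
  define C where "C u = u \<oplus> A' (A u)" for u
  define r where "r n = v \<ominus> C (w n)" for n
  have CV: "C u \<in> V" if "u \<in> V" for u using that by (simp add: C_def cl)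
  have rV: "r n \<in> V" for n by (simp add: r_def CV wV v)
  have C_sq: "(nrm (C u))\<^sup>2 = (nrm u)\<^sup>2 + 2 * (nrm (A u))\<^sup>2 + (nrm (A' (A u)))\<^sup>2" if "u \<in> V" for u
    using that by (simp add: C_def nrm_add_sq cl adj_ip[OF A, symmetric] ip_self)
  \<comment> \<open>Spectrally, \<open>C = 1 + A'A\<close> lies between 1 and
    \<open>1 + l^2 \<le> K\<close>, hence \<open>1 - C/K\<close> between 0 and
    \<open>1 - 1/K\<close>. The direct proof expands the squared norm and uses
    \<open>l^2 \<le> 2K - 2\<close>.\<close>
  have contr: "nrm (u \<ominus> of_real (1 / K) \<odot> C u) \<le> (1 - 1 / K) * nrm u" if u: "u \<in> V" for u
  proof (rule power2_le_imp_le)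
    have "(nrm (A' (A u)))\<^sup>2 \<le> l\<^sup>2 * (nrm (A u))\<^sup>2"
      using bound[OF cl(1)[OF u]] u by (metis cl nrm_nonneg power_mono power_mult_distrib)
    also have "\<dots> \<le> (2 * K - 2) * (nrm (A u))\<^sup>2"
      using K zero_le_power2[of l] by (intro mult_right_mono, linarith) simp
    finally have le: "(nrm (A' (A u)))\<^sup>2 + 2 * (nrm (A u))\<^sup>2 \<le> 2 * K * (nrm (A u))\<^sup>2"
      by (simp add: algebra_simps)
    have "(nrm (u \<ominus> of_real (1 / K) \<odot> C u))\<^sup>2
        = (nrm u)\<^sup>2 - 2 / K * ((nrm u)\<^sup>2 + (nrm (A u))\<^sup>2) + (nrm (C u))\<^sup>2 / K\<^sup>2"
      using u CV[OF u] K1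
      by (simp add: nrm_minus_sq nrm_smult power_mult_distrib power_divide ip_smult norm_divide)
        (simp add: C_def ip_add cl adj_ip[OF A, symmetric] ip_self)
    also have "\<dots> = (nrm u)\<^sup>2 * (1 - 1 / K)\<^sup>2
        + (2 * (nrm (A u))\<^sup>2 + (nrm (A' (A u)))\<^sup>2 - 2 * K * (nrm (A u))\<^sup>2) / K\<^sup>2"
      unfolding C_sq[OF u] using K1 by (simp add: field_simps power2_eq_square)
    also have "\<dots> \<le> (nrm u)\<^sup>2 * (1 - 1 / K)\<^sup>2"
      using le K1 by (simp add: divide_nonpos_pos)
    finally show "(nrm (u \<ominus> of_real (1 / K) \<odot> C u))\<^sup>2 \<le> ((1 - 1 / K) * nrm u)\<^sup>2"
      by (simp add: power_mult_distrib mult.commute)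
  qed (use u K1 in simp)
  \<comment> \<open>The residual is multiplied by \<open>1 - C/K\<close> in every step, so the
    contraction applies to it.\<close>
  have rS: "r (Suc n) = r n \<ominus> of_real (1 / K) \<odot> C (r n)" for n
  proof -
    have wr: "w (Suc n) = w n \<oplus> of_real (1 / K) \<odot> r n"
      by (simp add: wS r_def C_def)
    show ?thesis
      by (rule ip_eqI)
        (use rV[of n] wV[of n] wV[of "Suc n"] v CV in
          \<open>simp_all add: wr r_def[of "Suc n"], simp_all add: r_def C_def ip_simps cl adj_ip'[OF A] adj_ip[OF A, symmetric] algebra_simps\<close>)
  qed
  show r: "nrm (v \<ominus> (w n \<oplus> A' (A (w n)))) \<le> (1 - 1 / K) ^ n * nrm v" for n
  proof (fold C_def, fold r_def, induction n)
    case 0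
    have "r 0 = v"
      by (rule ip_eqI) (use v A in \<open>simp_all add: r_def C_def w0 adj_zero[OF A] adj_zero[OF adj_sym[OF A]] ip_simps\<close>)
    then show ?case by simp
  next
    case (Suc n)
    have "nrm (r (Suc n)) \<le> (1 - 1 / K) * nrm (r n)"
      unfolding rS by (rule contr[OF rV])
    also have "\<dots> \<le> (1 - 1 / K) * ((1 - 1 / K) ^ n * nrm v)"
      using Suc K1 by (intro mult_left_mono) auto
    finally show ?case by (simp add: ac_simps)
  qed
  \<comment> \<open>The operator form of \<open>2s \<le> 1 + s^2\<close>, valid for \<open>A\<close>
    of any size. It gives the norm bound 1 for \<open>2A(1 + A'A)^-1\<close>.\<close>
  have "2 * nrm (A (w n)) \<le> nrm (C (w n))"
  proof (rule power2_le_imp_le)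
    have "(nrm (A (w n)))\<^sup>2 \<le> nrm (w n) * nrm (A' (A (w n)))"
      using Re_ip_le[of "w n" "A' (A (w n))"] wV[of n] by (simp add: cl adj_ip[OF A, symmetric] nrm_sq)
    moreover have "2 * (nrm (w n) * nrm (A' (A (w n)))) \<le> (nrm (w n))\<^sup>2 + (nrm (A' (A (w n))))\<^sup>2"
      using sum_squares_bound[of "nrm (w n)" "nrm (A' (A (w n)))"] by simp
    ultimately show "(2 * nrm (A (w n)))\<^sup>2 \<le> (nrm (C (w n)))\<^sup>2"
      using C_sq[OF wV, of n] by (simp add: power_mult_distrib)
  qed (simp add: CV wV)
  also have "nrm (C (w n)) \<le> nrm v + nrm (r n)"
  proof -
    have "C (w n) = v \<ominus> r n"
      by (rule ip_eqI) (use v CV wV in \<open>simp_all add: r_def ip_simps\<close>)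
    then show ?thesis using nrm_minus_le[OF v rV[of n]] by simp
  qed
  also have "nrm (r n) \<le> (1 - 1 / K) ^ n * nrm v"
    using r by (simp add: r_def C_def)
  finally show "2 * nrm (A (w n)) \<le> (1 + (1 - 1 / K) ^ n) * nrm v"
    by (simp add: algebra_simps)
qed

text \<open>In the application \<open>\<chi>\<close> is close to \<open>(1 + S'S)^-1 \<phi>\<close>,
  \<open>\<eta> = S\<chi>\<close> and \<open>\<zeta> = S'\<eta>\<close>, while \<open>A\<close> is
  close to \<open>S\<close> only at \<open>\<chi>\<close> and \<open>A'\<close> to \<open>S'\<close>
  only at \<open>\<eta>\<close>. Then \<open>w \<ominus> \<chi>\<close> solves a resolvent equation
  with small data, and \<open>resolvent_bound\<close> applies. The constant is 3 for the three
  errors collected in \<open>e\<close>, 1 for \<open>\<eta> \<ominus> A \<chi>\<close> in the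
  equation, and 1 for returning from \<open>A \<chi>\<close> to \<open>\<eta>\<close>.\<close>

lemma resolvent_perturbation:
  assumes A: "adj A A'" and V: "\<phi> \<in> V" "\<chi> \<in> V" "\<eta> \<in> V" "\<zeta> \<in> V" "w \<in> V"
    and 1: "nrm (\<phi> \<ominus> (\<chi> \<oplus> \<zeta>)) \<le> \<epsilon>" and 2: "nrm (\<zeta> \<ominus> A' \<eta>) \<le> \<epsilon>"
    and 3: "nrm (\<eta> \<ominus> A \<chi>) \<le> \<epsilon>" and 4: "nrm (\<phi> \<ominus> (w \<oplus> A' (A w))) \<le> \<epsilon>"
  shows "nrm (\<eta> \<ominus> A w) \<le> 5 * \<epsilon>"
proof -
  note cl = adj_closed[OF A]
  define Cw where "Cw = w \<oplus> A' (A w)"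
  have CwV: "Cw \<in> V" using V by (simp add: Cw_def cl)
  define e where "e = (\<phi> \<ominus> (\<chi> \<oplus> \<zeta>)) \<oplus> ((\<zeta> \<ominus> A' \<eta>) \<ominus> (\<phi> \<ominus> Cw))"
  have eV: "e \<in> V" using V CwV by (simp add: e_def cl)
  have "nrm e \<le> nrm (\<phi> \<ominus> (\<chi> \<oplus> \<zeta>)) + nrm ((\<zeta> \<ominus> A' \<eta>) \<ominus> (\<phi> \<ominus> Cw))"
    unfolding e_def by (rule nrm_triangle) (use V CwV in \<open>auto simp: cl\<close>)
  also have "nrm ((\<zeta> \<ominus> A' \<eta>) \<ominus> (\<phi> \<ominus> Cw)) \<le> nrm (\<zeta> \<ominus> A' \<eta>) + nrm (\<phi> \<ominus> Cw)"
    by (rule nrm_minus_le) (use V CwV in \<open>auto simp: cl\<close>)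
  finally have e: "nrm e \<le> 3 * \<epsilon>" using 1 2 4 by (simp add: Cw_def)
  have "nrm (A (w \<ominus> \<chi>)) \<le> nrm e + nrm (\<eta> \<ominus> A \<chi>)"
  proof (rule resolvent_bound[OF A])
    show "(w \<ominus> \<chi>) \<oplus> A' (A (w \<ominus> \<chi>)) = e \<oplus> A' (\<eta> \<ominus> A \<chi>)"
      by (rule ip_eqI)
        (use V eV in \<open>simp_all add: cl e_def Cw_def adj_minus[OF A] adj_minus[OF adj_sym[OF A]] ip_simps algebra_simps\<close>)
  qed (use V eV in \<open>simp_all add: cl\<close>)
  then have "nrm (A (w \<ominus> \<chi>)) \<le> 4 * \<epsilon>" using e 3 by simp
  then have "nrm (A \<chi> \<ominus> A w) \<le> 4 * \<epsilon>"
    using V by (simp add: adj_minus[OF A] nrm_minus_commute[of "A \<chi>" "A w"] cl)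
  then show ?thesis
    using nrm_minus_triangle[of \<eta> "A \<chi>" "A w"] V 3 by (simp add: cl)
qed

text \<open>The fixed point equation \<open>2S = T(1 + S'S)\<close> says \<open>T = 2S(1 + S'S)\<inverse>\<close>. Iterating it from \<open>S = 0\<close>
  stays inside every class \<open>P\<close> of pairs of adjoint operators closed under the iteration step.\<close>

lemma cayley_root_approx:
  assumes T: "adj T T'" and t: "0 \<le> t" "t < 1"
    and bT: "\<And>v. v \<in> V \<Longrightarrow> nrm (T v) \<le> t * nrm v"
    and P0: "P (\<lambda>_. \<zero>) (\<lambda>_. \<zero>)"
    and PS: "\<And>S S'. P S S' \<Longrightarrow> P (\<lambda>v. of_real (1/2) \<odot> T (v \<oplus> S' (S v)))
        (\<lambda>v. of_real (1/2) \<odot> (T' v \<oplus> S' (S (T' v))))"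
    and Padj: "\<And>S S'. P S S' \<Longrightarrow> adj S S'"
    and e: "0 < e"
  obtains S S' where "P S S'" "\<And>v. v \<in> V \<Longrightarrow> nrm (S v) \<le> t * nrm v" "\<And>v. v \<in> V \<Longrightarrow> nrm (S' v) \<le> t * nrm v"
    "\<And>v. v \<in> V \<Longrightarrow> nrm (T (v \<oplus> S' (S v)) \<ominus> 2 \<odot> S v) \<le> e * nrm v"
proof -
  \<comment> \<open>The second component is the formal adjoint of the first:
    \<open>T(1 + S'S)/2\<close> turns into \<open>(1 + S'S)T'/2\<close>.\<close>
  define step :: "('v \<Rightarrow> 'v) \<times> ('v \<Rightarrow> 'v) \<Rightarrow> ('v \<Rightarrow> 'v) \<times> ('v \<Rightarrow> 'v)"
    where "step = (\<lambda>(S, S'). (\<lambda>v. of_real (1/2) \<odot> T (v \<oplus> S' (S v)),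
        \<lambda>v. of_real (1/2) \<odot> (T' v \<oplus> S' (S (T' v)))))"
  define s where "s n = (step ^^ n) (\<lambda>_. \<zero>, \<lambda>_. \<zero>)" for n
  define S S' where "S n = fst (s n)" and "S' n = snd (s n)" for n
  have S0: "S 0 = (\<lambda>_. \<zero>)" "S' 0 = (\<lambda>_. \<zero>)" by (simp_all add: S_def S'_def s_def)
  have SS: "S (Suc n) = (\<lambda>v. of_real (1/2) \<odot> T (v \<oplus> S' n (S n v)))"
    "S' (Suc n) = (\<lambda>v. of_real (1/2) \<odot> (T' v \<oplus> S' n (S n (T' v))))" for n
    by (simp_all add: S_def S'_def s_def step_def split_beta)
  have P: "P (S n) (S' n)" for n
    by (induction n) (simp_all only: S0 SS P0 PS)
  note adjS = Padj[OF P]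
  note cl = adj_closed[OF T] adj_closed[OF adjS]
  note add = adj_add[OF T] adj_add[OF adjS] adj_add[OF adj_sym[OF adjS]]
    adj_minus[OF T] adj_minus[OF adjS] adj_minus[OF adj_sym[OF adjS]]
  have bT': "nrm (T' v) \<le> t * nrm v" if "v \<in> V" for v
    using adj_bound[OF T bT t(1) that] .
  have two: "t * (t * x) \<le> x" "t * x \<le> x" if "0 \<le> x" for x :: real
    using t that by (simp_all add: mult_left_le_one_le flip: mult.assoc) (simp add: mult_le_one mult_left_le_one_le)
  \<comment> \<open>The ball of radius \<open>t\<close> is preserved because
    \<open>t(1 + t^2)/2 \<le> t\<close>.\<close>
  have b: "nrm (S n v) \<le> t * nrm v \<and> nrm (S' n v) \<le> t * nrm v" if "v \<in> V" for v n
    using that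
  proof (induction n arbitrary: v)
    case 0
    then show ?case using t by (simp add: S0)
  next
    case (Suc n)
    have inner: "nrm (v \<oplus> S' n (S n v)) \<le> 2 * nrm v" if v: "v \<in> V" for v
    proof -
      have "nrm (S' n (S n v)) \<le> t * (t * nrm v)"
        using Suc.IH[OF v] Suc.IH[OF cl(3)[OF v, of n]] t v cl by (meson mult_left_mono order_trans)
      then show ?thesis
        using nrm_triangle[of v "S' n (S n v)"] v two(1)[of "nrm v"] by (simp add: cl)
    qed
    have "nrm (T (v \<oplus> S' n (S n v))) \<le> t * (2 * nrm v)"
      using bT[of "v \<oplus> S' n (S n v)"] inner[of v] Suc.prems t cl
      by (meson closed(2) mult_left_mono order_trans)
    moreover have "nrm (T' v \<oplus> S' n (S n (T' v))) \<le> 2 * (t * nrm v)"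
      using inner[of "T' v"] bT'[of v] Suc.prems by (simp add: cl)
    ultimately show ?case
      using Suc.prems by (simp add: SS nrm_smult cl)
  qed
  \<comment> \<open>On the ball of radius \<open>t\<close> the step is a contraction: telescoping
    \<open>S'S\<close> costs a factor \<open>2t\<close>, which the factor 1/2 and the multiplication
    by \<open>T\<close> or \<open>T'\<close> bring down to at most \<open>t\<close>.\<close>
  have d: "nrm (S (Suc n) v \<ominus> S n v) \<le> t ^ n * nrm v \<and> nrm (S' (Suc n) v \<ominus> S' n v) \<le> t ^ n * nrm v"
    if "v \<in> V" for v n
    using that
  proof (induction n arbitrary: v)
    case 0
    then show ?case
      using b[of v "Suc 0"] two(2)[of "nrm v"] nrm_minus_le[of "S (Suc 0) v" \<zero>] nrm_minus_le[of "S' (Suc 0) v" \<zero>]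
      by (simp add: S0 cl)
  next
    case (Suc n)
    have inner: "nrm (S' (Suc n) (S (Suc n) v) \<ominus> S' n (S n v)) \<le> 2 * (t ^ Suc n * nrm v)" if v: "v \<in> V" for v
    proof -
      have "S' (Suc n) (S (Suc n) v) \<ominus> S' n (S n v)
          = S' (Suc n) (S (Suc n) v \<ominus> S n v) \<oplus> (S' (Suc n) (S n v) \<ominus> S' n (S n v))"
        by (rule ip_eqI) (use v in \<open>simp_all add: cl add ip_simps\<close>)
      also have "nrm \<dots> \<le> nrm (S' (Suc n) (S (Suc n) v \<ominus> S n v)) + nrm (S' (Suc n) (S n v) \<ominus> S' n (S n v))"
        by (rule nrm_triangle) (use v in \<open>simp_all add: cl\<close>)
      also have "nrm (S' (Suc n) (S (Suc n) v \<ominus> S n v)) \<le> t * (t ^ n * nrm v)"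
      proof -
        have "nrm (S' (Suc n) (S (Suc n) v \<ominus> S n v)) \<le> t * nrm (S (Suc n) v \<ominus> S n v)"
          using b[of "S (Suc n) v \<ominus> S n v" "Suc n"] v by (simp add: cl)
        also have "\<dots> \<le> t * (t ^ n * nrm v)"
          using Suc.IH[OF v] t by (intro mult_left_mono) auto
        finally show ?thesis .
      qed
      also have "nrm (S' (Suc n) (S n v) \<ominus> S' n (S n v)) \<le> t ^ n * (t * nrm v)"
      proof -
        have "nrm (S' (Suc n) (S n v) \<ominus> S' n (S n v)) \<le> t ^ n * nrm (S n v)"
          using Suc.IH[of "S n v"] v by (simp add: cl)
        also have "\<dots> \<le> t ^ n * (t * nrm v)"
          using b[OF v, of n] t by (intro mult_left_mono) auto
        finally show ?thesis .
      qed
      finally show ?thesis by (simp add: ac_simps)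
    qed
    have v: "v \<in> V" by fact
    have "S (Suc (Suc n)) v \<ominus> S (Suc n) v = of_real (1/2) \<odot> T (S' (Suc n) (S (Suc n) v) \<ominus> S' n (S n v))"
      unfolding SS(1)[of "Suc n"] SS(1)[of n]
      by (rule ip_eqI) (use v in \<open>simp_all add: cl add ip_simps algebra_simps flip: SS(1)\<close>)
    moreover have "nrm (T (S' (Suc n) (S (Suc n) v) \<ominus> S' n (S n v))) \<le> t * (2 * (t ^ Suc n * nrm v))"
      using bT[of "S' (Suc n) (S (Suc n) v) \<ominus> S' n (S n v)"] mult_left_mono[OF inner[OF v] t(1)] v
      by (simp add: cl)
    ultimately have 1: "nrm (S (Suc (Suc n)) v \<ominus> S (Suc n) v) \<le> t ^ Suc n * nrm v"
      using two(2)[of "t ^ Suc n * nrm v"] v t by (simp add: nrm_smult cl)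
    have "S' (Suc (Suc n)) v \<ominus> S' (Suc n) v
        = of_real (1/2) \<odot> (S' (Suc n) (S (Suc n) (T' v)) \<ominus> S' n (S n (T' v)))"
      unfolding SS(2)[of "Suc n"] SS(2)[of n]
      by (rule ip_eqI) (use v in \<open>simp_all add: cl add ip_simps algebra_simps flip: SS(2)\<close>)
    moreover have "nrm (S' (Suc n) (S (Suc n) (T' v)) \<ominus> S' n (S n (T' v))) \<le> 2 * (t ^ Suc n * nrm v)"
    proof -
      have "t ^ Suc n * nrm (T' v) \<le> t ^ Suc n * nrm v"
        using bT'[OF v] two(2)[of "nrm v"] v t by (intro mult_left_mono) auto
      then show ?thesis using inner[of "T' v"] v cl by fastforce
    qed
    ultimately have "nrm (S' (Suc (Suc n)) v \<ominus> S' (Suc n) v) \<le> t ^ Suc n * nrm v"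
      using v by (simp add: nrm_smult cl)
    with 1 show ?case by blast
  qed
  obtain n where n: "t ^ n < e / 2"
    using real_arch_pow_inv[of "e / 2" t] e t by auto
  have "nrm (T (v \<oplus> S' n (S n v)) \<ominus> 2 \<odot> S n v) \<le> e * nrm v" if v: "v \<in> V" for v
  proof -
    \<comment> \<open>The defect of the fixed point equation is twice the next increment, so a late
      iterate suffices and the limit of the iteration is never formed.\<close>
    have "T (v \<oplus> S' n (S n v)) \<ominus> 2 \<odot> S n v = 2 \<odot> (S (Suc n) v \<ominus> S n v)"
      unfolding SS(1)[of n] by (rule ip_eqI) (use v in \<open>simp_all add: cl ip_simps\<close>)
    then have "nrm (T (v \<oplus> S' n (S n v)) \<ominus> 2 \<odot> S n v) \<le> 2 * (t ^ n * nrm v)"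
      using d[OF v, of n] v by (simp add: nrm_smult cl)
    also have "\<dots> \<le> e * nrm v"
      using n mult_right_mono[of "2 * t ^ n" e "nrm v"] v by simp
    finally show ?thesis .
  qed
  then show ?thesis using that[OF P] b by blast
qed

text \<open>Neumann iteration for \<open>(1 + S'S)^-1 \<phi>\<close>, convergent since
  \<open>S'S\<close> has norm at most \<open>t < 1\<close>. The bound on \<open>\<chi>\<close> is
  recorded because the error in the equation for \<open>T\<close> is proportional to the norm of
  \<open>\<chi>\<close>.\<close>

lemma resolvent_approx:
  assumes S: "adj S S'" and t: "0 \<le> t" "t < 1"
    and b: "\<And>v. v \<in> V \<Longrightarrow> nrm (S v) \<le> t * nrm v" "\<And>v. v \<in> V \<Longrightarrow> nrm (S' v) \<le> t * nrm v"
    and V: "\<phi> \<in> V" and e: "0 < e"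
  obtains \<chi> where "\<chi> \<in> V" "nrm (\<phi> \<ominus> (\<chi> \<oplus> S' (S \<chi>))) \<le> e" "nrm \<chi> \<le> nrm \<phi> / (1 - t)"
proof -
  define c where "c n = ((\<lambda>u. \<phi> \<ominus> S' (S u)) ^^ n) \<phi>" for n
  have c0: "c 0 = \<phi>" and cS: "c (Suc n) = \<phi> \<ominus> S' (S (c n))" for n
    by (simp_all add: c_def)
  note cl = adj_closed[OF S]
  have cV: "c n \<in> V" for n by (induction n) (simp_all add: c0 cS V cl)
  have bb: "nrm (S' (S u)) \<le> t * nrm u" if u: "u \<in> V" for u
  proof -
    have "nrm (S' (S u)) \<le> t * (t * nrm u)"
      using b(2)[of "S u"] mult_left_mono[OF b(1)[OF u] t(1)] u by (simp add: cl)
    also have "\<dots> \<le> t * nrm u" using t u by (intro mult_left_mono) (auto simp: mult_left_le_one_le)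
    finally show ?thesis .
  qed
  define r where "r n = \<phi> \<ominus> (c n \<oplus> S' (S (c n)))" for n
  have rV: "r n \<in> V" for n by (simp add: r_def V cV cl)
  have r: "nrm (r n) \<le> t ^ n * nrm \<phi>" for n
  proof (induction n)
    case 0
    have "r 0 = (-1) \<odot> S' (S \<phi>)"
      by (rule ip_eqI) (simp_all add: r_def c0 V cl ip_simps)
    then show ?case using bb[OF V] t V mult_left_le_one_le[of "nrm \<phi>" t] by (simp add: nrm_smult cl)
  next
    case (Suc n)
    \<comment> \<open>The residual is multiplied by \<open>- S'S\<close> in every step.\<close>
    have "r (Suc n) = (-1) \<odot> S' (S (r n))"
      by (rule ip_eqI) (simp_all add: r_def cS V cV cl ip_simps adj_minus[OF S] adj_minus[OF adj_sym[OF S]] adj_add[OF S] adj_add[OF adj_sym[OF S]])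
    then have "nrm (r (Suc n)) \<le> t * nrm (r n)"
      using bb[OF rV] rV by (simp add: nrm_smult cl)
    also have "\<dots> \<le> t * (t ^ n * nrm \<phi>)" using Suc t by (intro mult_left_mono) auto
    finally show ?case by (simp add: ac_simps)
  qed
  have bound: "nrm (c n) \<le> nrm \<phi> / (1 - t)" for n
  proof (induction n)
    case 0
    then show ?case using t V by (simp add: c0 field_simps)
  next
    case (Suc n)
    have "nrm (c (Suc n)) \<le> nrm \<phi> + t * nrm (c n)"
      using nrm_minus_le[of \<phi> "S' (S (c n))"] bb[OF cV, of n] by (simp add: cS V cV cl)
    also have "\<dots> \<le> nrm \<phi> + t * (nrm \<phi> / (1 - t))"
      using Suc t by (intro add_left_mono mult_left_mono) auto
    also have "\<dots> = nrm \<phi> / (1 - t)" using t by (simp add: field_simps)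
    finally show ?case .
  qed
  have "(\<lambda>n. t ^ n * nrm \<phi>) \<longlonglongrightarrow> 0"
    using tendsto_mult_right[OF LIMSEQ_realpow_zero[OF t], of "nrm \<phi>"] by simp
  then obtain n where "t ^ n * nrm \<phi> < e"
    using e by (metis (no_types, lifting) eventually_sequentially order_refl order_tendstoD(2))
  then have "nrm (r n) \<le> e" using r[of n] by simp
  then show ?thesis using that[OF cV _ bound] by (simp add: r_def)
qed

end

section \<open>The twisted group algebra and its representations\<close>

text \<open>A sum over an infinite support is 0 by convention; hence additivity in \<open>a\<close>
  is stated for \<open>finsupp\<close> arguments, while linearity in \<open>f\<close> holds for
  every \<open>a\<close>.\<close>

definition pairing :: "('g \<Rightarrow> complex) \<Rightarrow> ('g \<Rightarrow> complex) \<Rightarrow> complex" where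
  "pairing a f = (\<Sum>x | a x \<noteq> 0. a x * f x)"

text \<open>The product determined by
  \<open>\<delta>_x \<delta>_y = \<sigma>(x,y) \<delta>_{xy}\<close>: the coefficient at
  \<open>z\<close> collects the factorisations of \<open>z\<close> into \<open>x\<close> and
  \<open>- x + z\<close>.\<close>

definition twisted_conv ::
    "('g::group_add \<Rightarrow> 'g \<Rightarrow> complex) \<Rightarrow> ('g \<Rightarrow> complex) \<Rightarrow> ('g \<Rightarrow> complex) \<Rightarrow> 'g \<Rightarrow> complex" where
  "twisted_conv \<sigma> a b = (\<lambda>z. \<Sum>x | a x \<noteq> 0. a x * (b (- x + z) * \<sigma> x (- x + z)))"

text \<open>No cocycle factor appears because \<open>\<sigma> x (- x) = 1\<close> makes the adjoint
  of \<open>\<delta>_x\<close> equal to \<open>\<delta>\<close> at the inverse.\<close>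

definition alg_star :: "('g::group_add \<Rightarrow> complex) \<Rightarrow> 'g \<Rightarrow> complex" where
  "alg_star a = (\<lambda>x. cnj (a (- x)))"

definition single :: "'g \<Rightarrow> 'g \<Rightarrow> complex" where
  "single x = (\<lambda>y. if y = x then 1 else 0)"

lemma finsupp_add: "finsupp a \<Longrightarrow> finsupp b \<Longrightarrow> finsupp (\<lambda>x. a x + b x)"
  unfolding finsupp_def
  by (rule finite_subset[of _ "{x. a x \<noteq> 0} \<union> {x. b x \<noteq> 0}"]) auto

lemma finsupp_diff: "finsupp a \<Longrightarrow> finsupp b \<Longrightarrow> finsupp (\<lambda>x. a x - b x)"
  unfolding finsupp_def
  by (rule finite_subset[of _ "{x. a x \<noteq> 0} \<union> {x. b x \<noteq> 0}"]) auto

lemma finsupp_smult: "finsupp a \<Longrightarrow> finsupp (\<lambda>x. c * a x)"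
  unfolding finsupp_def by (rule finite_subset) auto

lemma finsupp_zero: "finsupp (\<lambda>_. 0)"
  by (simp add: finsupp_def)

lemma finsupp_single: "finsupp (single x)"
  unfolding finsupp_def single_def by (rule finite_subset[of _ "{x}"]) auto

lemma finsupp_star: "finsupp a \<Longrightarrow> finsupp (alg_star a)"
  unfolding finsupp_def alg_star_def
  by (rule finite_subset[of _ "uminus ` {x. a x \<noteq> 0}"]) (auto intro: image_eqI[of _ _ "- _"])

lemma finsupp_conv:
  assumes "finsupp a" "finsupp b"
  shows "finsupp (twisted_conv \<sigma> a b)"
  unfolding finsupp_def
proof (rule finite_subset)
  show "finite ((\<lambda>(x, y). x + y) ` ({x. a x \<noteq> 0} \<times> {y. b y \<noteq> 0}))"
    using assms by (simp add: finsupp_def)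
  show "{z. twisted_conv \<sigma> a b z \<noteq> 0} \<subseteq> (\<lambda>(x, y). x + y) ` ({x. a x \<noteq> 0} \<times> {y. b y \<noteq> 0})"
  proof
    fix z assume "z \<in> {z. twisted_conv \<sigma> a b z \<noteq> 0}"
    then obtain x where "a x \<noteq> 0" "b (- x + z) \<noteq> 0"
      unfolding twisted_conv_def by (auto elim!: sum.not_neutral_contains_not_neutral)
    then show "z \<in> (\<lambda>(x, y). x + y) ` ({x. a x \<noteq> 0} \<times> {y. b y \<noteq> 0})"
      by (intro image_eqI[of _ _ "(x, - x + z)"]) (auto)
  qed
qed

lemmas finsupp_intros = finsupp_add finsupp_diff finsupp_smult finsupp_zero finsupp_single
  finsupp_star finsupp_conv

lemma pairing_superset:
  "finite S \<Longrightarrow> {x. a x \<noteq> 0} \<subseteq> S \<Longrightarrow> pairing a f = (\<Sum>x\<in>S. a x * f x)"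
  unfolding pairing_def by (rule sum.mono_neutral_left) auto

lemma pairing_add_left:
  assumes "finsupp a" "finsupp b"
  shows "pairing (\<lambda>x. a x + b x) f = pairing a f + pairing b f"
proof -
  let ?S = "{x. a x \<noteq> 0} \<union> {x. b x \<noteq> 0}"
  have "finite ?S" using assms by (simp add: finsupp_def)
  then show ?thesis
    by (subst (1 2 3) pairing_superset[of ?S]) (auto simp: sum.distrib ring_distribs)
qed

lemma pairing_smult_left: "pairing (\<lambda>x. c * a x) f = c * pairing a f"
  by (cases "c = 0") (auto simp: pairing_def sum_distrib_left mult.assoc)

lemma pairing_diff_left:
  assumes "finsupp a" "finsupp b"
  shows "pairing (\<lambda>x. a x - b x) f = pairing a f - pairing b f"
  using pairing_add_left[OF assms(1) finsupp_smult[OF assms(2), of "-1"], of f]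
    pairing_smult_left[of "-1" b f] by simp

lemma pairing_zero_left [simp]: "pairing (\<lambda>_. 0) f = 0"
  by (simp add: pairing_def)

lemma pairing_single [simp]: "pairing (single x) f = f x"
  using pairing_superset[of "{x}" "single x" f] by (auto simp: single_def)

lemma pairing_add: "pairing a (\<lambda>x. f x + g x) = pairing a f + pairing a g"
  by (simp add: pairing_def sum.distrib ring_distribs)

lemma pairing_diff: "pairing a (\<lambda>x. f x - g x) = pairing a f - pairing a g"
  by (simp add: pairing_def sum_subtractf ring_distribs)

lemma pairing_smult: "pairing a (\<lambda>x. c * f x) = c * pairing a f"
  by (simp add: pairing_def sum_distrib_left ac_simps)

lemma tendsto_pairing: "(\<And>x. (\<lambda>n. F n x) \<longlonglongrightarrow> f x) \<Longrightarrow> (\<lambda>n. pairing a (F n)) \<longlonglongrightarrow> pairing a f"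
  unfolding pairing_def by (intro tendsto_sum tendsto_mult tendsto_const)

text \<open>The same formula as for the convolution of functionals: finitely supported functions act
  as functionals through the pairing, and their two products agree.\<close>

lemma pairing_conv:
  fixes a b :: "'g::group_add \<Rightarrow> complex"
  assumes "finsupp a" "finsupp b"
  shows "pairing (twisted_conv \<sigma> a b) f = pairing a (\<lambda>x. pairing b (\<lambda>y. \<sigma> x y * f (x + y)))"
proof -
  let ?A = "{x. a x \<noteq> 0}" and ?B = "{y. b y \<noteq> 0}"
  let ?Z = "{z. twisted_conv \<sigma> a b z \<noteq> 0} \<union> (\<lambda>(x, y). x + y) ` (?A \<times> ?B)"
  have fin: "finite ?Z" "finite ?A" "finite ?B"
    using assms finsupp_conv[OF assms, of \<sigma>] by (simp_all add: finsupp_def)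
  have "pairing (twisted_conv \<sigma> a b) f = (\<Sum>z\<in>?Z. \<Sum>x\<in>?A. a x * (b (- x + z) * \<sigma> x (- x + z)) * f z)"
    using fin by (subst pairing_superset[of ?Z]) (auto simp: twisted_conv_def sum_distrib_right)
  also have "\<dots> = (\<Sum>x\<in>?A. \<Sum>z\<in>?Z. a x * (b (- x + z) * \<sigma> x (- x + z)) * f z)"
    by (rule sum.swap)
  also have "\<dots> = (\<Sum>x\<in>?A. a x * pairing b (\<lambda>y. \<sigma> x y * f (x + y)))"
  proof (rule sum.cong)
    fix x assume x: "x \<in> ?A"
    \<comment> \<open>For fixed \<open>x\<close> only the points \<open>z = x + y\<close> with
      \<open>y\<close> in the support of \<open>b\<close> contribute.\<close>
    have "(\<Sum>z\<in>?Z. a x * (b (- x + z) * \<sigma> x (- x + z)) * f z)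
        = (\<Sum>z\<in>(+) x ` ?B. a x * (b (- x + z) * \<sigma> x (- x + z)) * f z)"
    proof (rule sum.mono_neutral_right)
      show "(+) x ` ?B \<subseteq> ?Z" using x by auto
      show "\<forall>z\<in>?Z - (+) x ` ?B. a x * (b (- x + z) * \<sigma> x (- x + z)) * f z = 0"
      proof
        fix z assume z: "z \<in> ?Z - (+) x ` ?B"
        have "b (- x + z) = 0"
        proof (rule ccontr)
          assume "b (- x + z) \<noteq> 0"
          then have "x + (- x + z) \<in> (+) x ` ?B" by blast
          then show False using z by simp
        qed
        then show "a x * (b (- x + z) * \<sigma> x (- x + z)) * f z = 0" by simp
      qed
    qed (rule fin)
    also have "\<dots> = (\<Sum>y\<in>?B. a x * (b y * \<sigma> x y) * f (x + y))"
      by (subst sum.reindex) (auto simp: inj_on_def)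
    finally show "(\<Sum>z\<in>?Z. a x * (b (- x + z) * \<sigma> x (- x + z)) * f z)
        = a x * pairing b (\<lambda>y. \<sigma> x y * f (x + y))"
      by (simp add: pairing_def sum_distrib_left ac_simps)
  qed simp
  finally show ?thesis by (simp add: pairing_def[of a])
qed

lemma pairing_star: "pairing (alg_star a) f = cnj (pairing a (\<lambda>x. cnj (f (- x))))"
  unfolding pairing_def alg_star_def cnj_sum
  by (rule sum.reindex_bij_witness[of _ uminus uminus]) auto

section \<open>Operators of the group algebra in one representation\<close>

locale twisted_rep =
  fixes \<sigma> :: "'g::topological_group_add \<Rightarrow> 'g \<Rightarrow> complex" and \<pi> :: "('g, 'v) rep"
  assumes cocycle: "normalized_cocycle \<sigma>" and rep: "sigma_rep \<sigma> \<pi>"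
begin

abbreviation H where "H \<equiv> hspace \<pi>"
abbreviation unorm where "unorm \<equiv> universal_norm \<sigma>"

sublocale hilb "hspace \<pi>"
  using rep by unfold_locales (simp add: sigma_rep_def)

lemma cocycle_zero: "\<sigma> x 0 = 1" "\<sigma> 0 x = 1"
  and cocycle_minus: "\<sigma> x (- x) = 1" "\<sigma> (- x) x = 1"
proof -
  have *: "\<forall>x. \<sigma> x 0 = 1 \<and> \<sigma> 0 x = 1 \<and> \<sigma> x (- x) = 1"
    using cocycle unfolding normalized_cocycle_def by simp_all
  then show "\<sigma> x 0 = 1" "\<sigma> 0 x = 1" "\<sigma> x (- x) = 1" by simp_all
  show "\<sigma> (- x) x = 1" using spec[OF *, of "- x"] by simp
qed

lemma act_closed [simp, intro]: "v \<in> V \<Longrightarrow> act \<pi> x v \<in> V"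
  using rep by (auto simp: sigma_rep_def unitary_map_def linear_map_def)

lemma act_ip: "u \<in> V \<Longrightarrow> v \<in> V \<Longrightarrow> ip (act \<pi> x u) (act \<pi> x v) = ip u v"
  using rep by (auto simp: sigma_rep_def unitary_map_def)

lemma act_act: "v \<in> V \<Longrightarrow> act \<pi> x (act \<pi> y v) = \<sigma> x y \<odot>\<^bsub>H\<^esub> act \<pi> (x + y) v"
  using rep by (simp add: sigma_rep_def)

lemma act_surj: "v \<in> V \<Longrightarrow> \<exists>u\<in>V. v = act \<pi> x u"
  using rep unfolding sigma_rep_def unitary_map_def by blast

lemma smult_one' [simp]: "v \<in> V \<Longrightarrow> 1 \<odot>\<^bsub>H\<^esub> v = v"
  using smult_one by simp

text \<open>The operator \<open>act \<pi> 0\<close> is idempotent, as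
  \<open>\<sigma> 0 0 = 1\<close>, and it is onto.\<close>

lemma act_zero: "v \<in> V \<Longrightarrow> act \<pi> 0 v = v"
  using act_surj[of v 0] by (auto simp: act_act cocycle_zero)

lemma act_inverse: "v \<in> V \<Longrightarrow> act \<pi> (- x) (act \<pi> x v) = v" "v \<in> V \<Longrightarrow> act \<pi> x (act \<pi> (- x) v) = v"
  by (simp_all add: act_act cocycle_minus act_zero)

text \<open>The normalisation \<open>\<sigma> x (- x) = 1\<close> makes
  \<open>act \<pi> (- x)\<close> the inverse of the unitary \<open>act \<pi> x\<close>, hence its
  adjoint.\<close>

lemma adj_act: "adj (act \<pi> x) (act \<pi> (- x))"
proof -
  have "ip (act \<pi> x u) v = ip u (act \<pi> (- x) v)" if "u \<in> V" "v \<in> V" for u v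
    using act_ip[of u "act \<pi> (- x) v" x] that by (simp add: act_inverse)
  then show ?thesis by (auto simp: adj_def)
qed

lemma nrm_act: "v \<in> V \<Longrightarrow> nrm (act \<pi> x v) = nrm v"
  by (simp add: hnorm_def act_ip)

text \<open>A twisted translation only moves the left vector, so coefficient functions stay
  coefficient functions of the same representation.\<close>

lemma coeff_translate:
  "\<psi> \<in> V \<Longrightarrow> \<phi> \<in> V \<Longrightarrow> \<sigma> x y * coeff_fun \<pi> \<psi> \<phi> (x + y) = coeff_fun \<pi> (act \<pi> (- x) \<psi>) \<phi> y"
  by (simp add: coeff_fun_def adj_ip[OF adj_act] act_act ip_smult)

lemma coeff_star:
  "\<psi> \<in> V \<Longrightarrow> \<phi> \<in> V \<Longrightarrow> cnj (coeff_fun \<pi> \<psi> \<phi> (- x)) = coeff_fun \<pi> \<phi> \<psi> x"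
  using ip_commute[of \<psi> "act \<pi> (- x) \<phi>"] by (simp add: coeff_fun_def adj_ip[OF adj_act])

lemma coeff_bound: "\<psi> \<in> V \<Longrightarrow> \<phi> \<in> V \<Longrightarrow> cmod (coeff_fun \<pi> \<psi> \<phi> x) \<le> nrm \<psi> * nrm \<phi>"
  using Cauchy_Schwarz[of \<psi> "act \<pi> x \<phi>"] by (simp add: coeff_fun_def nrm_act)

lemma ip_finsum:
  assumes "finite A" "\<And>x. x \<in> A \<Longrightarrow> f x \<in> V" "w \<in> V"
  shows "finsum H f A \<in> V \<and> ip w (finsum H f A) = (\<Sum>x\<in>A. ip w (f x))"
  using assms
proof (induction A rule: finite_induct)
  case empty
  then show ?case by (simp add: ip_zero)
next
  case (insert x A)
  then have "f \<in> A \<rightarrow> V" "f x \<in> V" by auto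
  then show ?case using insert by (simp add: M.finsum_insert ip_add)
qed

text \<open>The finite sum defining \<open>alg_op\<close> is now replaced by its matrix
  coefficients, so that operator identities become identities between pairings.\<close>

lemma
  assumes "finsupp a" "\<phi> \<in> V"
  shows alg_op_closed: "alg_op \<pi> a \<phi> \<in> V"
    and ip_alg_op: "\<psi> \<in> V \<Longrightarrow> ip \<psi> (alg_op \<pi> a \<phi>) = pairing a (coeff_fun \<pi> \<psi> \<phi>)"
  using assms ip_finsum[of "{x. a x \<noteq> 0}" "\<lambda>x. a x \<odot>\<^bsub>H\<^esub> act \<pi> x \<phi>"]
  by (auto simp: alg_op_def finsupp_def pairing_def coeff_fun_def ip_smult)

lemma alg_op_eqI:
  assumes "finsupp a" "\<phi> \<in> V" "u \<in> V" "\<And>\<psi>. \<psi> \<in> V \<Longrightarrow> pairing a (coeff_fun \<pi> \<psi> \<phi>) = ip \<psi> u"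
  shows "alg_op \<pi> a \<phi> = u"
  by (rule ip_eqI) (use assms in \<open>auto simp: alg_op_closed ip_alg_op\<close>)

lemma adj_alg_op: "finsupp a \<Longrightarrow> adj (alg_op \<pi> a) (alg_op \<pi> (alg_star a))"
  unfolding adj_def
  by (auto simp: alg_op_closed finsupp_star ip_alg_op pairing_star coeff_star
      ip_commute[of _ "alg_op \<pi> a _"])

lemma alg_op_add: "finsupp a \<Longrightarrow> finsupp b \<Longrightarrow> v \<in> V
    \<Longrightarrow> alg_op \<pi> (\<lambda>x. a x + b x) v = alg_op \<pi> a v \<oplus>\<^bsub>H\<^esub> alg_op \<pi> b v"
  by (rule alg_op_eqI) (auto simp: finsupp_intros alg_op_closed ip_add ip_alg_op pairing_add_left)

lemma alg_op_diff: "finsupp a \<Longrightarrow> finsupp b \<Longrightarrow> v \<in> V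
    \<Longrightarrow> alg_op \<pi> (\<lambda>x. a x - b x) v = alg_op \<pi> a v \<ominus>\<^bsub>H\<^esub> alg_op \<pi> b v"
  by (rule alg_op_eqI) (auto simp: finsupp_intros alg_op_closed ip_minus ip_alg_op pairing_diff_left)

lemma alg_op_smult: "finsupp a \<Longrightarrow> v \<in> V \<Longrightarrow> alg_op \<pi> (\<lambda>x. c * a x) v = c \<odot>\<^bsub>H\<^esub> alg_op \<pi> a v"
  by (rule alg_op_eqI) (auto simp: finsupp_intros alg_op_closed ip_smult ip_alg_op pairing_smult_left)

lemma alg_op_zero: "v \<in> V \<Longrightarrow> alg_op \<pi> (\<lambda>_. 0) v = \<zero>\<^bsub>H\<^esub>"
  by (rule alg_op_eqI) (auto simp: finsupp_intros ip_zero)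

lemma alg_op_single: "v \<in> V \<Longrightarrow> alg_op \<pi> (single x) v = act \<pi> x v"
  by (rule alg_op_eqI) (auto simp: finsupp_intros coeff_fun_def)

lemma alg_op_conv:
  assumes "finsupp a" "finsupp b" "v \<in> V"
  shows "alg_op \<pi> (twisted_conv \<sigma> a b) v = alg_op \<pi> a (alg_op \<pi> b v)"
proof (rule alg_op_eqI)
  fix \<psi> assume \<psi>: "\<psi> \<in> V"
  have "pairing b (coeff_fun \<pi> (act \<pi> (- x) \<psi>) v) = coeff_fun \<pi> \<psi> (alg_op \<pi> b v) x" for x
  proof -
    have "pairing b (coeff_fun \<pi> (act \<pi> (- x) \<psi>) v) = ip (act \<pi> (- x) \<psi>) (alg_op \<pi> b v)"
      using assms \<psi> by (simp add: ip_alg_op)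
    then show ?thesis
      using assms \<psi> by (simp add: coeff_fun_def adj_ip[OF adj_act] alg_op_closed)
  qed
  then show "pairing (twisted_conv \<sigma> a b) (coeff_fun \<pi> \<psi> v) = ip \<psi> (alg_op \<pi> a (alg_op \<pi> b v))"
    using assms \<psi> by (simp add: pairing_conv coeff_translate ip_alg_op alg_op_closed)
qed (use assms in \<open>auto simp: alg_op_closed finsupp_conv\<close>)

text \<open>A crude l1 bound. It is independent of \<open>\<pi>\<close>, which makes the supremum in
  the universal norm finite.\<close>

lemma alg_op_bound_sum:
  assumes "finsupp a" "v \<in> V"
  shows "nrm (alg_op \<pi> a v) \<le> (\<Sum>x | a x \<noteq> 0. cmod (a x)) * nrm v"
proof (rule nrm_le_ipI)
  fix w assume w: "w \<in> V"
  have "cmod (ip w (alg_op \<pi> a v)) \<le> (\<Sum>x | a x \<noteq> 0. cmod (a x) * (nrm w * nrm v))"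
    using assms w coeff_bound[OF w assms(2)] unfolding ip_alg_op[OF assms w] pairing_def
    by (intro order_trans[OF norm_sum] sum_mono) (auto simp: norm_mult intro: mult_left_mono)
  then show "cmod (ip w (alg_op \<pi> a v)) \<le> (\<Sum>x | a x \<noteq> 0. cmod (a x)) * nrm v * nrm w"
    by (simp add: sum_distrib_right[symmetric] ac_simps)
qed (use assms in \<open>auto simp: alg_op_closed intro!: mult_nonneg_nonneg sum_nonneg\<close>)

lemma op_norm_alg_op_le: "finsupp a \<Longrightarrow> op_norm H (alg_op \<pi> a) \<le> (\<Sum>x | a x \<noteq> 0. cmod (a x))"
  by (rule op_norm_le) (auto intro: alg_op_bound_sum sum_nonneg)

lemma alg_op_op_norm: "finsupp a \<Longrightarrow> v \<in> V \<Longrightarrow> nrm (alg_op \<pi> a v) \<le> op_norm H (alg_op \<pi> a) * nrm v"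
  by (rule op_norm_bound(1)[OF _ _ alg_op_bound_sum])
    (auto simp: alg_op_closed adj_smult[OF adj_alg_op])

text \<open>The length of \<open>\<pi>(a)v\<close> depends only on \<open>a\<close> and on the
  positive definite function of \<open>v\<close>. Representations sharing that function can
  therefore be exchanged in norm estimates.\<close>

lemma nrm_alg_op_sq:
  assumes "finsupp a" "v \<in> V"
  shows "(nrm (alg_op \<pi> a v))\<^sup>2 = Re (pairing (twisted_conv \<sigma> (alg_star a) a) (coeff_fun \<pi> v v))"
  using assms
  by (simp add: nrm_sq alg_op_closed adj_ip[OF adj_alg_op] finsupp_intros alg_op_conv flip: ip_alg_op)

lemma alg_op_norm_eq_if_coeff_eq:
  assumes "sigma_rep \<sigma> \<rho>" "\<phi> \<in> V" "\<phi>' \<in> carrier (hspace \<rho>)"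
    and eq: "coeff_fun \<rho> \<phi>' \<phi>' = coeff_fun \<pi> \<phi> \<phi>" and a: "finsupp a"
  shows "hnorm (hspace \<rho>) (alg_op \<rho> a \<phi>') = nrm (alg_op \<pi> a \<phi>)"
    and "hnorm (hspace \<rho>) \<phi>' = nrm \<phi>"
proof -
  interpret \<rho>: twisted_rep \<sigma> \<rho> using cocycle assms by unfold_locales
  have "(hnorm (hspace \<rho>) (alg_op \<rho> a \<phi>'))\<^sup>2 = (nrm (alg_op \<pi> a \<phi>))\<^sup>2"
    using assms by (simp add: nrm_alg_op_sq \<rho>.nrm_alg_op_sq)
  then show "hnorm (hspace \<rho>) (alg_op \<rho> a \<phi>') = nrm (alg_op \<pi> a \<phi>)"
    using assms by (simp add: power2_eq_iff_nonneg alg_op_closed \<rho>.alg_op_closed)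
  have "coeff_fun \<rho> \<phi>' \<phi>' 0 = coeff_fun \<pi> \<phi> \<phi> 0" using eq by simp
  then show "hnorm (hspace \<rho>) \<phi>' = nrm \<phi>"
    using assms by (simp add: coeff_fun_def act_zero \<rho>.act_zero hnorm_def)
qed

text \<open>The space generated by \<open>\<phi>\<close> is a double orthogonal complement, on which
  \<open>v \<mapsto> (x \<mapsto> (\<pi>(x)\<phi>, v))\<close> is injective.\<close>

lemma cyclic_copy:
  assumes \<phi>: "\<phi> \<in> V"
  obtains \<rho> :: "('g, 'g \<Rightarrow> complex) rep" and \<phi>' where "sigma_rep \<sigma> \<rho>" "\<phi>' \<in> carrier (hspace \<rho>)"
    "coeff_fun \<rho> \<phi>' \<phi>' = coeff_fun \<pi> \<phi> \<phi>"
proof -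
  define K where "K = {v \<in> V. \<forall>w\<in>V. (\<forall>x. ip (act \<pi> x \<phi>) w = 0) \<longrightarrow> ip w v = 0}"
  define \<iota> where "\<iota> v = (\<lambda>x. ip (act \<pi> x \<phi>) v)" for v
  define \<kappa> where "\<kappa> = inv_into K \<iota>"
  have KV: "v \<in> K \<Longrightarrow> v \<in> V" for v by (simp add: K_def)
  have K0: "\<zero>\<^bsub>H\<^esub> \<in> K" by (simp add: K_def ip_zero)
  have K_add: "u \<in> K \<Longrightarrow> v \<in> K \<Longrightarrow> u \<oplus>\<^bsub>H\<^esub> v \<in> K" for u v by (simp add: K_def ip_add)
  have K_smult: "v \<in> K \<Longrightarrow> c \<odot>\<^bsub>H\<^esub> v \<in> K" for c v by (simp add: K_def ip_smult)
  have K_minus: "u \<in> K \<Longrightarrow> v \<in> K \<Longrightarrow> u \<ominus>\<^bsub>H\<^esub> v \<in> K" for u v by (simp add: K_def ip_minus)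
  have K\<phi>: "\<phi> \<in> K"
  proof -
    have "ip w \<phi> = 0" if "w \<in> V" "\<forall>x. ip (act \<pi> x \<phi>) w = 0" for w
      using that(2)[rule_format, of 0] ip_commute[OF \<phi> that(1)] \<phi> by (simp add: act_zero)
    then show ?thesis using \<phi> by (simp add: K_def)
  qed
  \<comment> \<open>The operators \<open>act \<pi> (- y)\<close> map the orthogonal complement of
    the orbit of \<open>\<phi>\<close> into itself; passing to adjoints gives invariance of the
    double complement.\<close>
  have K_act: "act \<pi> y v \<in> K" if v: "v \<in> K" for y v
  proof -
    have "ip w (act \<pi> y v) = 0" if w: "w \<in> V" "\<forall>x. ip (act \<pi> x \<phi>) w = 0" for w
    proof -
      have "ip (act \<pi> x \<phi>) (act \<pi> (- y) w) = 0" for x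
        using w \<phi> by (simp add: adj_ip[OF adj_act, of _ w y, symmetric] adj_ip[OF adj_act[of "- y"], symmetric]
            adj_ip'[OF adj_act] act_act ip_smult_left)
      then have "ip (act \<pi> (- y) w) v = 0" using v w by (simp add: K_def)
      then show ?thesis using v w by (simp add: adj_ip[OF adj_act] KV)
    qed
    then show ?thesis using v by (simp add: K_def)
  qed
  have inj: "inj_on \<iota> K"
  proof (rule inj_onI)
    fix u v assume uv: "u \<in> K" "v \<in> K" and eq: "\<iota> u = \<iota> v"
    let ?w = "u \<ominus>\<^bsub>H\<^esub> v"
    have "\<forall>x. ip (act \<pi> x \<phi>) ?w = 0"
      using fun_cong[OF eq] uv \<phi> by (simp add: \<iota>_def KV ip_minus)
    \<comment> \<open>The difference is orthogonal to the orbit, and \<open>u\<close> and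
      \<open>v\<close> lie in the double complement; hence the difference is orthogonal to
      itself.\<close>
    then have orth: "ip ?w u = 0" "ip ?w v = 0" using uv by (simp_all add: K_def)
    have "(nrm ?w)\<^sup>2 = Re (ip ?w u - ip ?w v)"
      using uv by (simp add: nrm_sq KV ip_minus)
    then have "?w = \<zero>\<^bsub>H\<^esub>"
      using orth uv nrm_eq_0[of ?w] by (simp add: KV)
    show "u = v"
    proof (rule ip_eqI)
      show "ip w u = ip w v" if "w \<in> V" for w
        using ip_minus[of w u v] \<open>?w = \<zero>\<^bsub>H\<^esub>\<close> that uv by (simp add: KV ip_zero)
    qed (use uv KV in auto)
  qed
  have \<kappa>: "\<kappa> (\<iota> v) = v" if "v \<in> K" for v
    unfolding \<kappa>_def using inj that by (rule inv_into_f_f)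
  have \<iota>_add: "(\<lambda>x. \<iota> u x + \<iota> v x) = \<iota> (u \<oplus>\<^bsub>H\<^esub> v)" if "u \<in> K" "v \<in> K" for u v
    using that \<phi> by (simp add: \<iota>_def KV ip_add)
  have \<iota>_smult: "(\<lambda>x. c * \<iota> v x) = \<iota> (c \<odot>\<^bsub>H\<^esub> v)" if "v \<in> K" for c v
    using that \<phi> by (simp add: \<iota>_def KV ip_smult)
  have \<iota>_zero: "(\<lambda>_. 0) = \<iota> \<zero>\<^bsub>H\<^esub>"
    using \<phi> by (simp add: \<iota>_def ip_zero)
  \<comment> \<open>Only the vector space operations are those of functions; the inner product is
    transported from \<open>K\<close>.\<close>
  define L :: "('g \<Rightarrow> complex) hilbert" where
    "L = \<lparr>carrier = \<iota> ` K, mult = undefined, one = undefined, zero = (\<lambda>_. 0),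
      add = (\<lambda>f g x. f x + g x), smult = (\<lambda>c f x. c * f x), hinner = (\<lambda>f g. ip (\<kappa> f) (\<kappa> g))\<rparr>"
  have L [simp]: "carrier L = \<iota> ` K" "\<zero>\<^bsub>L\<^esub> = (\<lambda>_. 0)" "f \<oplus>\<^bsub>L\<^esub> g = (\<lambda>x. f x + g x)"
    "c \<odot>\<^bsub>L\<^esub> f = (\<lambda>x. c * f x)" "hinner L f g = ip (\<kappa> f) (\<kappa> g)" for f g c
    by (simp_all add: L_def)
  have mod: "module complex_ring L"
    by (rule module_complex_ringI)
      (auto simp: \<iota>_add \<iota>_smult K_add K_smult algebra_simps, auto simp: \<iota>_zero K0)
  have L_minus: "\<iota> u \<ominus>\<^bsub>L\<^esub> \<iota> v = \<iota> (u \<ominus>\<^bsub>H\<^esub> v)" if "u \<in> K" "v \<in> K" for u v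
  proof -
    have "\<iota> u \<ominus>\<^bsub>L\<^esub> \<iota> v = \<iota> u \<oplus>\<^bsub>L\<^esub> (-1) \<odot>\<^bsub>L\<^esub> \<iota> v"
      using that by (intro complex_module_minus mod) auto
    then show ?thesis
      using that by (simp only: L \<iota>_smult \<iota>_add K_smult) (simp add: minus_eq_smult KV)
  qed
  have L_norm: "hnorm L (\<iota> v) = nrm v" if "v \<in> K" for v
    using that by (simp add: hnorm_def \<kappa>)
  have "complete_for L (hnorm L)"
    unfolding complete_for_def dist_Cauchy_def
  proof (intro allI impI, elim conjE)
    fix s :: "nat \<Rightarrow> _" assume s: "\<forall>n. s n \<in> carrier L"
      and C: "\<forall>e>0. \<exists>N. \<forall>m\<ge>N. \<forall>n\<ge>N. hnorm L (s m \<ominus>\<^bsub>L\<^esub> s n) < e"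
    have "\<forall>n. \<exists>v. v \<in> K \<and> s n = \<iota> v" using s by auto
    then obtain v where v: "\<And>n. v n \<in> K" "\<And>n. s n = \<iota> (v n)" by metis
    have "\<exists>N. \<forall>m\<ge>N. \<forall>n\<ge>N. nrm (v m \<ominus>\<^bsub>H\<^esub> v n) < e" if "0 < e" for e
      using C that by (simp add: v L_minus L_norm K_minus)
    then obtain l where l: "l \<in> V" "(\<lambda>n. nrm (v n \<ominus>\<^bsub>H\<^esub> l)) \<longlonglongrightarrow> 0"
      using complete_limit[of v] KV[OF v(1)] by blast
    have "ip w l = 0" if w: "w \<in> V" "\<forall>x. ip (act \<pi> x \<phi>) w = 0" for w
    proof -
      have "ip w (v n) = 0" for n using v(1)[of n] w by (simp add: K_def)
      then show ?thesis
        using tendsto_ip[OF KV[OF v(1)] l(1) w(1) l(2)] by (simp add: LIMSEQ_const_iff)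
    qed
    then have lK: "l \<in> K" using l by (simp add: K_def)
    show "\<exists>x\<in>carrier L. (\<lambda>n. hnorm L (s n \<ominus>\<^bsub>L\<^esub> x)) \<longlonglongrightarrow> 0"
      using l lK by (intro bexI[of _ "\<iota> l"]) (simp_all add: v L_minus L_norm K_minus)
  qed
  moreover have "0 < Re (hinner L f f)" if f: "f \<in> carrier L" "f \<noteq> \<zero>\<^bsub>L\<^esub>" for f
  proof -
    obtain v where v: "v \<in> K" "f = \<iota> v" using f by auto
    then have "v \<noteq> \<zero>\<^bsub>H\<^esub>" using f \<iota>_zero by auto
    then show ?thesis using v by (simp add: \<kappa> ip_pos KV)
  qed
  ultimately have hL: "hilbert_space L"
    unfolding hilbert_space_def using mod
    by (auto simp: \<iota>_add \<iota>_smult \<kappa> K_add K_smult ip_add ip_smult KV intro: ip_commute)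
  define \<rho> where "\<rho> = \<lparr>hspace = L, act = (\<lambda>x f. \<iota> (act \<pi> x (\<kappa> f)))\<rparr>"
  have \<rho> [simp]: "hspace \<rho> = L" "act \<rho> x f = \<iota> (act \<pi> x (\<kappa> f))" for x f
    by (simp_all add: \<rho>_def)
  have "unitary_map L L (act \<rho> x)" for x
    unfolding unitary_map_def linear_map_def
  proof (intro conjI)
    show "act \<rho> x ` carrier L = carrier L"
    proof
      show "carrier L \<subseteq> act \<rho> x ` carrier L"
      proof
        fix f assume "f \<in> carrier L"
        then obtain v where v: "v \<in> K" "f = \<iota> v" by auto
        then have "f = act \<rho> x (\<iota> (act \<pi> (- x) v))" by (simp add: \<kappa> K_act act_inverse KV)
        then show "f \<in> act \<rho> x ` carrier L" using v K_act by auto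
      qed
    qed (auto simp: \<kappa> K_act)
  qed (auto simp: \<kappa> K_act act_ip KV \<iota>_add \<iota>_smult K_add K_smult adj_add[OF adj_act] adj_smult[OF adj_act])
  then have "sigma_rep \<sigma> \<rho>"
    unfolding sigma_rep_def using hL
    by (auto simp: \<kappa> K_act KV act_act \<iota>_smult simp del: \<rho>(2)) (auto simp: \<kappa> K_act KV act_act \<iota>_smult)
  moreover have "coeff_fun \<rho> (\<iota> \<phi>) (\<iota> \<phi>) = coeff_fun \<pi> \<phi> \<phi>"
    by (simp add: coeff_fun_def \<kappa> K_act K\<phi>)
  ultimately show ?thesis using that[of \<rho> "\<iota> \<phi>"] K\<phi> by auto
qed

end

section \<open>The universal C*-norm\<close>

lemma universal_norm_le:
  assumes "\<And>\<rho> :: ('g::topological_group_add, 'g \<Rightarrow> complex) rep. sigma_rep \<sigma> \<rho>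
      \<Longrightarrow> op_norm (hspace \<rho>) (alg_op \<rho> a) \<le> c"
    and "\<exists>\<rho> :: ('g, 'g \<Rightarrow> complex) rep. sigma_rep \<sigma> \<rho>"
  shows "universal_norm \<sigma> a \<le> c"
  unfolding universal_norm_def by (rule cSup_least) (use assms in auto)

lemma op_norm_le_universal_norm:
  fixes \<rho> :: "('g::topological_group_add, 'g \<Rightarrow> complex) rep"
  assumes "normalized_cocycle \<sigma>" "sigma_rep \<sigma> \<rho>" "finsupp a"
  shows "op_norm (hspace \<rho>) (alg_op \<rho> a) \<le> universal_norm \<sigma> a"
  unfolding universal_norm_def
proof (rule cSup_upper)
  show "bdd_above {op_norm (hspace \<pi>) (alg_op \<pi> a) |\<pi> :: ('g, 'g \<Rightarrow> complex) rep. sigma_rep \<sigma> \<pi>}"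
    using assms twisted_rep.op_norm_alg_op_le[OF twisted_rep.intro] by (auto intro!: bdd_aboveI)
qed (use assms in auto)

context twisted_rep
begin

text \<open>The universal norm ranges over Hilbert spaces of functions on the group, while
  \<open>\<pi>\<close> lives on an arbitrary type. The estimate for one vector is moved to its
  cyclic copy.\<close>

lemma alg_op_bound:
  assumes a: "finsupp a" and v: "v \<in> V"
  shows "nrm (alg_op \<pi> a v) \<le> unorm a * nrm v"
proof -
  obtain \<rho> :: "('g, 'g \<Rightarrow> complex) rep" and v' where \<rho>: "sigma_rep \<sigma> \<rho>" "v' \<in> carrier (hspace \<rho>)"
    "coeff_fun \<rho> v' v' = coeff_fun \<pi> v v"
    using cyclic_copy[OF v] .
  interpret \<rho>: twisted_rep \<sigma> \<rho> using cocycle \<rho> by unfold_locales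
  have "hnorm (hspace \<rho>) (alg_op \<rho> a v') \<le> unorm a * hnorm (hspace \<rho>) v'"
    using \<rho>.alg_op_op_norm[OF a \<rho>(2)] op_norm_le_universal_norm[OF cocycle \<rho>(1) a] \<rho>(2)
    by (meson \<rho>.nrm_nonneg mult_right_mono order_trans)
  then show ?thesis
    using alg_op_norm_eq_if_coeff_eq[OF \<rho>(1) v \<rho>(2,3) a] by simp
qed

lemma universal_norm_nonneg:
  assumes a: "finsupp a"
  shows "0 \<le> unorm a"
proof -
  obtain \<rho> :: "('g, 'g \<Rightarrow> complex) rep" and v' where \<rho>: "sigma_rep \<sigma> \<rho>"
    using cyclic_copy[of "\<zero>\<^bsub>H\<^esub>"] by auto
  interpret \<rho>: twisted_rep \<sigma> \<rho> using cocycle \<rho> by unfold_locales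
  have "0 \<le> op_norm (hspace \<rho>) (alg_op \<rho> a)"
    by (rule \<rho>.op_norm_bound(2)[OF _ _ \<rho>.alg_op_bound_sum])
      (auto simp: a \<rho>.alg_op_closed \<rho>.adj_smult[OF \<rho>.adj_alg_op])
  also have "\<dots> \<le> unorm a"
    by (rule op_norm_le_universal_norm[OF cocycle \<rho> a])
  finally show ?thesis .
qed

text \<open>The supremum needs at least one representation on a space of functions; the cyclic copy
  generated by the zero vector supplies it.\<close>

lemma universal_norm_leI:
  assumes bound: "\<And>(\<rho> :: ('g, 'g \<Rightarrow> complex) rep) v. twisted_rep \<sigma> \<rho> \<Longrightarrow> v \<in> carrier (hspace \<rho>)
      \<Longrightarrow> hnorm (hspace \<rho>) (alg_op \<rho> a v) \<le> c * hnorm (hspace \<rho>) v"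
    and c: "0 \<le> c"
  shows "unorm a \<le> c"
proof (rule universal_norm_le)
  show "\<exists>\<rho> :: ('g, 'g \<Rightarrow> complex) rep. sigma_rep \<sigma> \<rho>"
    using cyclic_copy[of "\<zero>\<^bsub>H\<^esub>"] by auto
  fix \<rho> :: "('g, 'g \<Rightarrow> complex) rep" assume \<rho>: "sigma_rep \<sigma> \<rho>"
  then interpret \<rho>: twisted_rep \<sigma> \<rho> using cocycle by unfold_locales
  show "op_norm (hspace \<rho>) (alg_op \<rho> a) \<le> c"
    using bound c by (intro \<rho>.op_norm_le) (auto intro: \<rho>.twisted_rep_axioms)
qed

lemma universal_norm_add:
  assumes "finsupp a" "finsupp b"
  shows "unorm (\<lambda>x. a x + b x) \<le> unorm a + unorm b"
proof (rule universal_norm_leI)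
  fix \<rho> :: "('g, 'g \<Rightarrow> complex) rep" and v
  assume "twisted_rep \<sigma> \<rho>" and v: "v \<in> carrier (hspace \<rho>)"
  then interpret \<rho>: twisted_rep \<sigma> \<rho> by simp
  show "hnorm (hspace \<rho>) (alg_op \<rho> (\<lambda>x. a x + b x) v)
      \<le> (unorm a + unorm b) * hnorm (hspace \<rho>) v"
    using \<rho>.nrm_triangle[of "alg_op \<rho> a v" "alg_op \<rho> b v"] \<rho>.alg_op_bound[OF assms(1) v]
      \<rho>.alg_op_bound[OF assms(2) v] assms v
    by (simp add: \<rho>.alg_op_add \<rho>.alg_op_closed distrib_right)
qed (use assms in \<open>simp add: universal_norm_nonneg\<close>)

lemma universal_norm_smult:
  assumes a: "finsupp a"
  shows "unorm (\<lambda>x. c * a x) \<le> cmod c * unorm a"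
proof (rule universal_norm_leI)
  fix \<rho> :: "('g, 'g \<Rightarrow> complex) rep" and v
  assume "twisted_rep \<sigma> \<rho>" and v: "v \<in> carrier (hspace \<rho>)"
  then interpret \<rho>: twisted_rep \<sigma> \<rho> by simp
  show "hnorm (hspace \<rho>) (alg_op \<rho> (\<lambda>x. c * a x) v) \<le> cmod c * unorm a * hnorm (hspace \<rho>) v"
    using mult_left_mono[OF \<rho>.alg_op_bound[OF a v], of "cmod c"] a v
    by (simp add: \<rho>.alg_op_smult \<rho>.nrm_smult \<rho>.alg_op_closed ac_simps)
qed (use assms in \<open>simp add: universal_norm_nonneg\<close>)

lemma universal_norm_zero: "unorm (\<lambda>_. 0) = 0"
  using universal_norm_smult[of "\<lambda>_. 0" 0] universal_norm_nonneg[of "\<lambda>_. 0"] by (simp add: finsupp_zero)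

lemma universal_norm_diff_ge:
  assumes "finsupp a" "finsupp b"
  shows "\<bar>unorm a - unorm b\<bar> \<le> unorm (\<lambda>x. a x - b x)"
proof -
  have "unorm (\<lambda>x. b x - a x) \<le> unorm (\<lambda>x. a x - b x)"
    using universal_norm_smult[OF finsupp_diff[OF assms], of "-1"] by simp
  moreover have "unorm a \<le> unorm (\<lambda>x. a x - b x) + unorm b"
    using universal_norm_add[OF finsupp_diff[OF assms] assms(2)] by simp
  moreover have "unorm b \<le> unorm (\<lambda>x. b x - a x) + unorm a"
    using universal_norm_add[OF finsupp_diff[OF assms(2,1)] assms(1)] by simp
  ultimately show ?thesis by linarith
qed

lemma universal_norm_conv:
  assumes "finsupp a" "finsupp b"
  shows "unorm (twisted_conv \<sigma> a b) \<le> unorm a * unorm b"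
proof (rule universal_norm_leI)
  fix \<rho> :: "('g, 'g \<Rightarrow> complex) rep" and v
  assume "twisted_rep \<sigma> \<rho>" and v: "v \<in> carrier (hspace \<rho>)"
  then interpret \<rho>: twisted_rep \<sigma> \<rho> by simp
  have "hnorm (hspace \<rho>) (alg_op \<rho> a (alg_op \<rho> b v)) \<le> unorm a * hnorm (hspace \<rho>) (alg_op \<rho> b v)"
    using assms v by (intro \<rho>.alg_op_bound) (auto simp: \<rho>.alg_op_closed)
  also have "\<dots> \<le> unorm a * (unorm b * hnorm (hspace \<rho>) v)"
    using assms v by (intro mult_left_mono \<rho>.alg_op_bound universal_norm_nonneg)
  finally show "hnorm (hspace \<rho>) (alg_op \<rho> (twisted_conv \<sigma> a b) v)
      \<le> unorm a * unorm b * hnorm (hspace \<rho>) v"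
    using assms v by (simp add: \<rho>.alg_op_conv ac_simps)
qed (use assms in \<open>simp add: universal_norm_nonneg\<close>)

lemma universal_norm_single: "unorm (single x) \<le> 1"
proof (rule universal_norm_leI)
  fix \<rho> :: "('g, 'g \<Rightarrow> complex) rep" and v
  assume "twisted_rep \<sigma> \<rho>" and v: "v \<in> carrier (hspace \<rho>)"
  then interpret \<rho>: twisted_rep \<sigma> \<rho> by simp
  show "hnorm (hspace \<rho>) (alg_op \<rho> (single x) v) \<le> 1 * hnorm (hspace \<rho>) v"
    using v by (simp add: \<rho>.alg_op_single \<rho>.nrm_act)
qed simp

lemma coeff_pairing_bound:
  assumes "finsupp a" "\<psi> \<in> V" "\<phi> \<in> V"
  shows "cmod (pairing a (coeff_fun \<pi> \<psi> \<phi>)) \<le> nrm \<psi> * nrm \<phi> * unorm a"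
proof -
  have "cmod (pairing a (coeff_fun \<pi> \<psi> \<phi>)) \<le> nrm \<psi> * nrm (alg_op \<pi> a \<phi>)"
    using assms Cauchy_Schwarz[of \<psi> "alg_op \<pi> a \<phi>"] by (simp add: ip_alg_op alg_op_closed)
  also have "\<dots> \<le> nrm \<psi> * (unorm a * nrm \<phi>)"
    using assms by (intro mult_left_mono alg_op_bound) auto
  finally show ?thesis by (simp add: ac_simps)
qed

section \<open>Representations of the completed group algebra\<close>

lemma alg_CauchyD:
  assumes "s \<in> alg_Cauchy \<sigma>"
  shows "finsupp (s n)"
    and "0 < e \<Longrightarrow> \<exists>N. \<forall>m\<ge>N. \<forall>n\<ge>N. unorm (\<lambda>x. s m x - s n x) < e"
  using assms by (auto simp: alg_Cauchy_def dist_Cauchy_def)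

lemma bounded_opsD:
  assumes "T \<in> bounded_ops H"
  shows "v \<in> V \<Longrightarrow> T v \<in> V" "v \<in> V \<Longrightarrow> T (c \<odot>\<^bsub>H\<^esub> v) = c \<odot>\<^bsub>H\<^esub> T v" "T \<in> extensional V"
    "\<exists>c. \<forall>v\<in>V. nrm (T v) \<le> c * nrm v"
  using assms by (auto simp: bounded_ops_def linear_map_def)

lemma diff_op_norm:
  assumes a: "finsupp a" and T: "T \<in> bounded_ops H"
  shows "v \<in> V \<Longrightarrow> nrm (alg_op \<pi> a v \<ominus>\<^bsub>H\<^esub> T v) \<le> op_norm H (\<lambda>v\<in>V. alg_op \<pi> a v \<ominus>\<^bsub>H\<^esub> T v) * nrm v"
    and "0 \<le> op_norm H (\<lambda>v\<in>V. alg_op \<pi> a v \<ominus>\<^bsub>H\<^esub> T v)"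
proof -
  note TD = bounded_opsD[OF T]
  obtain c where c: "\<And>v. v \<in> V \<Longrightarrow> nrm (T v) \<le> c * nrm v" using TD(4) by blast
  have b: "nrm ((\<lambda>v\<in>V. alg_op \<pi> a v \<ominus>\<^bsub>H\<^esub> T v) v) \<le> (unorm a + c) * nrm v" if "v \<in> V" for v
    using nrm_minus_le[of "alg_op \<pi> a v" "T v"] c[OF that] alg_op_bound[OF a that] a TD(1) that
    by (simp add: alg_op_closed distrib_right)
  have lin: "(\<lambda>v\<in>V. alg_op \<pi> a v \<ominus>\<^bsub>H\<^esub> T v) (c \<odot>\<^bsub>H\<^esub> v) = c \<odot>\<^bsub>H\<^esub> (\<lambda>v\<in>V. alg_op \<pi> a v \<ominus>\<^bsub>H\<^esub> T v) v"
    if "v \<in> V" for c v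
    by (rule ip_eqI) (use that a TD in
      \<open>auto simp: alg_op_closed adj_smult[OF adj_alg_op] ip_minus ip_smult algebra_simps\<close>)
  have mem: "(\<lambda>v\<in>V. alg_op \<pi> a v \<ominus>\<^bsub>H\<^esub> T v) \<in> V \<rightarrow> V" using a TD by (auto simp: alg_op_closed)
  show "v \<in> V \<Longrightarrow> nrm (alg_op \<pi> a v \<ominus>\<^bsub>H\<^esub> T v) \<le> op_norm H (\<lambda>v\<in>V. alg_op \<pi> a v \<ominus>\<^bsub>H\<^esub> T v) * nrm v"
    using op_norm_bound(1)[OF mem lin b, of v] by (simp add: restrict_apply' del: restrict_apply)
  show "0 \<le> op_norm H (\<lambda>v\<in>V. alg_op \<pi> a v \<ominus>\<^bsub>H\<^esub> T v)"
    using op_norm_bound(2)[OF mem lin b] .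
qed

text \<open>The Cauchy estimate is uniform on the unit ball. Pointwise limits therefore define
  \<open>T\<close>, and letting the second index tend to infinity upgrades strong convergence to
  convergence in norm.\<close>

lemma alg_Cauchy_limit:
  assumes s: "s \<in> alg_Cauchy \<sigma>"
  obtains T where "T \<in> bounded_ops H"
    "(\<lambda>n. op_norm H (\<lambda>v\<in>V. alg_op \<pi> (s n) v \<ominus>\<^bsub>H\<^esub> T v)) \<longlonglongrightarrow> 0"
proof -
  note fs = alg_CauchyD(1)[OF s]
  have diff: "nrm (alg_op \<pi> (s m) v \<ominus>\<^bsub>H\<^esub> alg_op \<pi> (s n) v) \<le> unorm (\<lambda>x. s m x - s n x) * nrm v"
    if "v \<in> V" for m n v
    using alg_op_bound[OF finsupp_diff[OF fs fs] that] that by (simp add: alg_op_diff fs)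
  have "\<exists>l. l \<in> V \<and> (\<lambda>n. nrm (alg_op \<pi> (s n) v \<ominus>\<^bsub>H\<^esub> l)) \<longlonglongrightarrow> 0" if v: "v \<in> V" for v
  proof -
    have "\<exists>N. \<forall>m\<ge>N. \<forall>n\<ge>N. nrm (alg_op \<pi> (s m) v \<ominus>\<^bsub>H\<^esub> alg_op \<pi> (s n) v) < e" if "0 < e" for e
    proof -
      have pos: "0 < nrm v + 1" using nrm_nonneg[OF v] by linarith
      then obtain N where N: "\<And>m n. m \<ge> N \<Longrightarrow> n \<ge> N \<Longrightarrow> unorm (\<lambda>x. s m x - s n x) < e / (nrm v + 1)"
        using alg_CauchyD(2)[OF s, of "e / (nrm v + 1)"] \<open>0 < e\<close> by (metis divide_pos_pos)
      have "nrm (alg_op \<pi> (s m) v \<ominus>\<^bsub>H\<^esub> alg_op \<pi> (s n) v) < e" if "m \<ge> N" "n \<ge> N" for m n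
      proof -
        have "nrm (alg_op \<pi> (s m) v \<ominus>\<^bsub>H\<^esub> alg_op \<pi> (s n) v) \<le> e / (nrm v + 1) * nrm v"
          using diff[OF v, of m n] mult_right_mono[OF less_imp_le[OF N[OF that]] nrm_nonneg[OF v]] by linarith
        also have "\<dots> < e" using pos \<open>0 < e\<close> by (simp add: field_simps)
        finally show ?thesis .
      qed
      then show ?thesis by blast
    qed
    from complete_limit[OF alg_op_closed[OF fs v] this] show ?thesis by metis
  qed
  then obtain T0 where T0: "\<And>v. v \<in> V \<Longrightarrow> T0 v \<in> V"
      "\<And>v. v \<in> V \<Longrightarrow> (\<lambda>n. nrm (alg_op \<pi> (s n) v \<ominus>\<^bsub>H\<^esub> T0 v)) \<longlonglongrightarrow> 0" by metis
  define T where "T = restrict T0 V"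
  have TV: "T v \<in> V" and T: "(\<lambda>n. nrm (alg_op \<pi> (s n) v \<ominus>\<^bsub>H\<^esub> T v)) \<longlonglongrightarrow> 0" if "v \<in> V" for v
    using T0 that by (simp_all add: T_def)
  have T_ip: "(\<lambda>n. ip w (alg_op \<pi> (s n) v)) \<longlonglongrightarrow> ip w (T v)" if "w \<in> V" "v \<in> V" for w v
    using tendsto_ip[OF alg_op_closed[OF fs that(2)] TV[OF that(2)] that(1) T[OF that(2)]] .
  have close: "nrm (alg_op \<pi> (s m) v \<ominus>\<^bsub>H\<^esub> T v) \<le> e * nrm v"
    if N: "\<And>m n. m \<ge> N \<Longrightarrow> n \<ge> N \<Longrightarrow> unorm (\<lambda>x. s m x - s n x) < e"
      and m: "m \<ge> N" and v: "v \<in> V" for N m v e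
  proof (rule LIMSEQ_le_const)
    let ?f = "\<lambda>n. e * nrm v + nrm (alg_op \<pi> (s n) v \<ominus>\<^bsub>H\<^esub> T v)"
    show "?f \<longlonglongrightarrow> e * nrm v" using tendsto_add[OF tendsto_const T[OF v]] by simp
    have "nrm (alg_op \<pi> (s m) v \<ominus>\<^bsub>H\<^esub> T v) \<le> ?f n" if "n \<ge> N" for n
      using nrm_minus_triangle[OF alg_op_closed[OF fs v] alg_op_closed[OF fs v] TV[OF v], of m n]
        diff[OF v, of m n] mult_right_mono[OF less_imp_le[OF N[OF m that]] nrm_nonneg[OF v]] by linarith
    then show "\<exists>N. \<forall>n\<ge>N. nrm (alg_op \<pi> (s m) v \<ominus>\<^bsub>H\<^esub> T v) \<le> ?f n" by blast
  qed
  have lin: "linear_map H H T"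
    unfolding linear_map_def
  proof (intro conjI allI ballI)
    show "T (u \<oplus>\<^bsub>H\<^esub> v) = T u \<oplus>\<^bsub>H\<^esub> T v" if "u \<in> V" "v \<in> V" for u v
    proof (rule ip_eqI)
      fix w assume w: "w \<in> V"
      have "(\<lambda>n. ip w (alg_op \<pi> (s n) (u \<oplus>\<^bsub>H\<^esub> v))) \<longlonglongrightarrow> ip w (T u) + ip w (T v)"
        using tendsto_add[OF T_ip[OF w that(1)] T_ip[OF w that(2)]] that w fs
        by (simp add: adj_add[OF adj_alg_op] ip_add alg_op_closed)
      then show "ip w (T (u \<oplus>\<^bsub>H\<^esub> v)) = ip w (T u \<oplus>\<^bsub>H\<^esub> T v)"
        using T_ip[of w "u \<oplus>\<^bsub>H\<^esub> v"] that w TV LIMSEQ_unique by (fastforce simp: ip_add)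
    qed (use that TV in auto)
    show "T (c \<odot>\<^bsub>H\<^esub> v) = c \<odot>\<^bsub>H\<^esub> T v" if "v \<in> V" for c v
    proof (rule ip_eqI)
      fix w assume w: "w \<in> V"
      have "(\<lambda>n. ip w (alg_op \<pi> (s n) (c \<odot>\<^bsub>H\<^esub> v))) \<longlonglongrightarrow> c * ip w (T v)"
        using tendsto_mult_left[OF T_ip[OF w that(1)], of c] that w fs
        by (simp add: adj_smult[OF adj_alg_op] ip_smult alg_op_closed)
      then show "ip w (T (c \<odot>\<^bsub>H\<^esub> v)) = ip w (c \<odot>\<^bsub>H\<^esub> T v)"
        using T_ip[of w "c \<odot>\<^bsub>H\<^esub> v"] that w TV LIMSEQ_unique by (fastforce simp: ip_smult)
    qed (use that TV in auto)
  qed (use TV in auto)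
  obtain N where N: "\<And>m n. m \<ge> N \<Longrightarrow> n \<ge> N \<Longrightarrow> unorm (\<lambda>x. s m x - s n x) < 1"
    using alg_CauchyD(2)[OF s, of 1] by auto
  have "nrm (T v) \<le> (unorm (s N) + 1) * nrm v" if v: "v \<in> V" for v
  proof -
    have "nrm (T v) \<le> nrm (alg_op \<pi> (s N) v) + nrm (alg_op \<pi> (s N) v \<ominus>\<^bsub>H\<^esub> T v)"
    proof -
      have "T v = alg_op \<pi> (s N) v \<ominus>\<^bsub>H\<^esub> (alg_op \<pi> (s N) v \<ominus>\<^bsub>H\<^esub> T v)"
        by (rule ip_eqI) (use v fs TV in \<open>auto simp: alg_op_closed ip_minus\<close>)
      then show ?thesis
        using nrm_minus_le[of "alg_op \<pi> (s N) v" "alg_op \<pi> (s N) v \<ominus>\<^bsub>H\<^esub> T v"] v fs TV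
        by (simp add: alg_op_closed)
    qed
    then show ?thesis
      using alg_op_bound[OF fs v, of N] close[where N = N and m = N and e = 1, OF N order_refl v] by (simp add: distrib_right)
  qed
  then have T_ops: "T \<in> bounded_ops H"
    unfolding bounded_ops_def using lin by (auto simp: T_def)
  have "(\<lambda>n. op_norm H (\<lambda>v\<in>V. alg_op \<pi> (s n) v \<ominus>\<^bsub>H\<^esub> T v)) \<longlonglongrightarrow> 0"
  proof (rule LIMSEQ_I)
    fix e :: real assume e: "0 < e"
    then obtain N where N: "\<And>m n. m \<ge> N \<Longrightarrow> n \<ge> N \<Longrightarrow> unorm (\<lambda>x. s m x - s n x) < e / 2"
      using alg_CauchyD(2)[OF s, of "e / 2"] by (metis half_gt_zero)
    have "norm (op_norm H (\<lambda>v\<in>V. alg_op \<pi> (s n) v \<ominus>\<^bsub>H\<^esub> T v) - 0) < e" if n: "n \<ge> N" for n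
    proof -
      have "op_norm H (\<lambda>v\<in>V. alg_op \<pi> (s n) v \<ominus>\<^bsub>H\<^esub> T v) \<le> e / 2"
        using e close[OF N n] by (intro op_norm_le) auto
      then show ?thesis using e diff_op_norm(2)[OF fs T_ops, of n] by simp
    qed
    then show "\<exists>N. \<forall>n\<ge>N. norm (op_norm H (\<lambda>v\<in>V. alg_op \<pi> (s n) v \<ominus>\<^bsub>H\<^esub> T v) - 0) < e" by blast
  qed
  then show ?thesis using that T_ops by blast
qed

lemma twisted_group_cstarD:
  assumes "A \<in> twisted_group_cstar \<sigma>"
  obtains s where "s \<in> A" "s \<in> alg_Cauchy \<sigma>"
    "\<And>t. t \<in> A \<Longrightarrow> t \<in> alg_Cauchy \<sigma> \<and> (\<lambda>n. unorm (\<lambda>x. s n x - t n x)) \<longlonglongrightarrow> 0"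
proof -
  obtain s where s: "s \<in> alg_Cauchy \<sigma>" and A: "A = alg_null_rel \<sigma> `` {s}"
    using assms unfolding twisted_group_cstar_def by (rule quotientE)
  show ?thesis
  proof (rule that)
    show "s \<in> A" using s unfolding A alg_null_rel_def by (simp add: universal_norm_zero)
  qed (use s in \<open>simp_all add: A alg_null_rel_def\<close>)
qed

text \<open>Justifies the definite description: existence comes from one representative,
  independence of the representative from the null relation, uniqueness from uniqueness of
  limits.\<close>

lemma group_cstar_op:
  assumes A: "A \<in> twisted_group_cstar \<sigma>"
  shows "group_cstar_op \<pi> A \<in> bounded_ops H \<and> (\<forall>s\<in>A. (\<lambda>n. op_norm H
        (\<lambda>v\<in>V. alg_op \<pi> (s n) v \<ominus>\<^bsub>H\<^esub> group_cstar_op \<pi> A v)) \<longlonglongrightarrow> 0)"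
proof -
  obtain s where s: "s \<in> A" "s \<in> alg_Cauchy \<sigma>"
    and A_D: "\<And>t. t \<in> A \<Longrightarrow> t \<in> alg_Cauchy \<sigma> \<and> (\<lambda>n. unorm (\<lambda>x. s n x - t n x)) \<longlonglongrightarrow> 0"
    using twisted_group_cstarD[OF A] by blast
  obtain T where T: "T \<in> bounded_ops H" "(\<lambda>n. op_norm H (\<lambda>v\<in>V. alg_op \<pi> (s n) v \<ominus>\<^bsub>H\<^esub> T v)) \<longlonglongrightarrow> 0"
    using alg_Cauchy_limit[OF s(2)] .
  have fs: "finsupp (t n)" if "t \<in> A" for t n using alg_CauchyD(1) A_D that by blast
  show ?thesis
    unfolding group_cstar_op_def
  proof (rule theI[of _ T], intro conjI ballI)
    fix t assume t: "t \<in> A"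
    show "(\<lambda>n. op_norm H (\<lambda>v\<in>V. alg_op \<pi> (t n) v \<ominus>\<^bsub>H\<^esub> T v)) \<longlonglongrightarrow> 0"
    proof (rule null_comparison)
      let ?g = "\<lambda>n. unorm (\<lambda>x. s n x - t n x) + op_norm H (\<lambda>v\<in>V. alg_op \<pi> (s n) v \<ominus>\<^bsub>H\<^esub> T v)"
      show "?g \<longlonglongrightarrow> 0" using tendsto_add[OF conjunct2[OF A_D[OF t]] T(2)] by simp
      fix n
      have "nrm (alg_op \<pi> (t n) v \<ominus>\<^bsub>H\<^esub> T v) \<le> ?g n * nrm v" if v: "v \<in> V" for v
      proof -
        have "nrm (alg_op \<pi> (t n) v \<ominus>\<^bsub>H\<^esub> T v)
            \<le> nrm (alg_op \<pi> (s n) v \<ominus>\<^bsub>H\<^esub> alg_op \<pi> (t n) v) + nrm (alg_op \<pi> (s n) v \<ominus>\<^bsub>H\<^esub> T v)"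
          using nrm_minus_triangle[of "alg_op \<pi> (t n) v" "alg_op \<pi> (s n) v" "T v"]
            nrm_minus_commute[of "alg_op \<pi> (t n) v" "alg_op \<pi> (s n) v"]
            v fs t s bounded_opsD(1)[OF T(1) v] by (simp add: alg_op_closed)
        also have "\<dots> \<le> ?g n * nrm v"
          using alg_op_bound[OF finsupp_diff[OF fs[OF s(1)] fs[OF t]] v, of n n]
            diff_op_norm(1)[OF fs[OF s(1)] T(1) v, of n] fs s t v
          by (simp add: alg_op_diff distrib_right)
        finally show ?thesis .
      qed
      moreover have "0 \<le> ?g n"
        using universal_norm_nonneg[OF finsupp_diff[OF fs[OF s(1)] fs[OF t]], of n n]
          diff_op_norm(2)[OF fs[OF s(1)] T(1), of n] by simp
      ultimately have "op_norm H (\<lambda>v\<in>V. alg_op \<pi> (t n) v \<ominus>\<^bsub>H\<^esub> T v) \<le> ?g n"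
        by (intro op_norm_le) auto
      then show "norm (op_norm H (\<lambda>v\<in>V. alg_op \<pi> (t n) v \<ominus>\<^bsub>H\<^esub> T v)) \<le> ?g n"
        using diff_op_norm(2)[OF fs[OF t] T(1), of n] by simp
    qed
  next
    fix T' assume T': "T' \<in> bounded_ops H \<and> (\<forall>s\<in>A. (\<lambda>n. op_norm H
        (\<lambda>v\<in>V. alg_op \<pi> (s n) v \<ominus>\<^bsub>H\<^esub> T' v)) \<longlonglongrightarrow> 0)"
    show "T' = T"
    proof (rule extensionalityI[of _ V])
      fix v assume v: "v \<in> V"
      have lim: "(\<lambda>n. nrm (alg_op \<pi> (s n) v \<ominus>\<^bsub>H\<^esub> S v)) \<longlonglongrightarrow> 0"
        if "S \<in> bounded_ops H" "(\<lambda>n. op_norm H (\<lambda>v\<in>V. alg_op \<pi> (s n) v \<ominus>\<^bsub>H\<^esub> S v)) \<longlonglongrightarrow> 0" for S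
      proof (rule null_comparison)
        show "(\<lambda>n. op_norm H (\<lambda>v\<in>V. alg_op \<pi> (s n) v \<ominus>\<^bsub>H\<^esub> S v) * nrm v) \<longlonglongrightarrow> 0"
          using tendsto_mult_right[OF that(2), of "nrm v"] by simp
      qed (use diff_op_norm(1)[OF fs[OF s(1)] that(1) v] bounded_opsD(1)[OF that(1) v]
          alg_op_closed[OF fs[OF s(1)] v] in simp)
      note lims = lim[OF T] lim[of T'] and cl = bounded_opsD(1)[OF T(1) v] bounded_opsD(1)[of T' v]
      show "T' v = T v"
      proof (rule ip_eqI)
        fix w assume w: "w \<in> V"
        have "(\<lambda>n. ip w (alg_op \<pi> (s n) v)) \<longlonglongrightarrow> ip w (T v)" "(\<lambda>n. ip w (alg_op \<pi> (s n) v)) \<longlonglongrightarrow> ip w (T' v)"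
          using tendsto_ip[OF alg_op_closed[OF fs[OF s(1)] v] _ w] lims cl T' v s by simp_all
        then show "ip w (T' v) = ip w (T v)" using LIMSEQ_unique by blast
      qed (use cl T' v in auto)
    qed (use T T' bounded_opsD(3) in auto)
  qed (fact T)
qed

lemma group_cstar_op_limit:
  assumes A: "A \<in> twisted_group_cstar \<sigma>" and s: "s \<in> A" and V: "\<psi> \<in> V" "\<phi> \<in> V"
  shows "(\<lambda>n. pairing (s n) (coeff_fun \<pi> \<psi> \<phi>)) \<longlonglongrightarrow> ip \<psi> (group_cstar_op \<pi> A \<phi>)"
proof -
  have fs: "finsupp (s n)" for n
    using twisted_group_cstarD[OF A] s alg_CauchyD(1) by metis
  have T: "group_cstar_op \<pi> A \<in> bounded_ops H" and lim: "(\<lambda>n. op_norm H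
        (\<lambda>v\<in>V. alg_op \<pi> (s n) v \<ominus>\<^bsub>H\<^esub> group_cstar_op \<pi> A v)) \<longlonglongrightarrow> 0"
    using group_cstar_op[OF A] s by auto
  have "(\<lambda>n. nrm (alg_op \<pi> (s n) \<phi> \<ominus>\<^bsub>H\<^esub> group_cstar_op \<pi> A \<phi>)) \<longlonglongrightarrow> 0"
  proof (rule null_comparison)
    show "(\<lambda>n. op_norm H (\<lambda>v\<in>V. alg_op \<pi> (s n) v \<ominus>\<^bsub>H\<^esub> group_cstar_op \<pi> A v) * nrm \<phi>) \<longlonglongrightarrow> 0"
      using tendsto_mult_right[OF lim, of "nrm \<phi>"] by simp
  qed (use diff_op_norm(1)[OF fs T V(2)] bounded_opsD(1)[OF T V(2)] alg_op_closed[OF fs V(2)] in simp)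
  from tendsto_ip[OF alg_op_closed[OF fs V(2)] bounded_opsD(1)[OF T V(2)] V(1) this]
  show ?thesis using V fs by (simp add: ip_alg_op)
qed

lemma group_cstar_norm_limit:
  assumes A: "A \<in> twisted_group_cstar \<sigma>" and t: "t \<in> A"
  shows "(\<lambda>n. unorm (t n)) \<longlonglongrightarrow> group_cstar_norm \<sigma> A"
proof -
  obtain s where s: "s \<in> A" "s \<in> alg_Cauchy \<sigma>"
    and A_D: "\<And>t. t \<in> A \<Longrightarrow> t \<in> alg_Cauchy \<sigma> \<and> (\<lambda>n. unorm (\<lambda>x. s n x - t n x)) \<longlonglongrightarrow> 0"
    using twisted_group_cstarD[OF A] by blast
  have fs: "finsupp (t n)" if "t \<in> A" for t n using alg_CauchyD(1) A_D that by blast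
  have "Cauchy (\<lambda>n. unorm (s n))"
  proof (rule CauchyI)
    fix e :: real assume "0 < e"
    then obtain N where N: "\<forall>m\<ge>N. \<forall>n\<ge>N. unorm (\<lambda>x. s m x - s n x) < e"
      using alg_CauchyD(2)[OF s(2)] by blast
    then show "\<exists>N. \<forall>m\<ge>N. \<forall>n\<ge>N. norm (unorm (s m) - unorm (s n)) < e"
      using universal_norm_diff_ge[OF fs[OF s(1)] fs[OF s(1)]]
      by (intro exI[of _ N] allI impI) (metis order_le_less_trans real_norm_def)
  qed
  then obtain r where r: "(\<lambda>n. unorm (s n)) \<longlonglongrightarrow> r"
    using Cauchy_convergent_iff convergent_def by blast
  have "\<forall>t\<in>A. (\<lambda>n. unorm (t n)) \<longlonglongrightarrow> group_cstar_norm \<sigma> A"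
    unfolding group_cstar_norm_def
  proof (rule theI[of _ r], intro ballI)
    fix t assume t: "t \<in> A"
    have "(\<lambda>n. unorm (s n) - unorm (t n)) \<longlonglongrightarrow> 0"
      by (rule null_comparison[OF conjunct2[OF A_D[OF t]]])
        (use universal_norm_diff_ge[OF fs[OF s(1)] fs[OF t]] in simp)
    from tendsto_diff[OF r this] show "(\<lambda>n. unorm (t n)) \<longlonglongrightarrow> r" by simp
  next
    fix r' assume "\<forall>s\<in>A. (\<lambda>n. unorm (s n)) \<longlonglongrightarrow> r'"
    then show "r' = r" using s r LIMSEQ_unique by blast
  qed
  then show ?thesis using t by blast
qed

text \<open>The embedding of the finitely supported functions into the completion.\<close>

lemma constant_class:
  assumes "finsupp a"
  obtains A where "A \<in> twisted_group_cstar \<sigma>" "(\<lambda>_. a) \<in> A"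
proof
  have "(\<lambda>_. a) \<in> alg_Cauchy \<sigma>"
    using assms by (simp add: alg_Cauchy_def dist_Cauchy_def universal_norm_zero)
  then show "alg_null_rel \<sigma> `` {\<lambda>_. a} \<in> twisted_group_cstar \<sigma>"
    unfolding twisted_group_cstar_def by (rule quotientI)
  show "(\<lambda>_. a) \<in> alg_null_rel \<sigma> `` {\<lambda>_. a}"
    using \<open>(\<lambda>_. a) \<in> alg_Cauchy \<sigma>\<close> by (simp add: alg_null_rel_def universal_norm_zero)
qed

end

section \<open>The coefficient functions and their completion\<close>

text \<open>Expresses "norm at most \<open>c\<close>" without a supremum. It carries finiteness
  along, without which the real supremum in \<open>dual_norm\<close> would be meaningless.\<close>

definition dual_bounded ::
    "('g::topological_group_add \<Rightarrow> 'g \<Rightarrow> complex) \<Rightarrow> ('g \<Rightarrow> complex) \<Rightarrow> real \<Rightarrow> bool" where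
  "dual_bounded \<sigma> f c \<longleftrightarrow> (\<forall>a. finsupp a \<longrightarrow> cmod (pairing a f) \<le> c * universal_norm \<sigma> a)"

definition dual_norm :: "('g::topological_group_add \<Rightarrow> 'g \<Rightarrow> complex) \<Rightarrow> ('g \<Rightarrow> complex) \<Rightarrow> real" where
  "dual_norm \<sigma> f = Sup {cmod (pairing a f) | a. finsupp a \<and> universal_norm \<sigma> a \<le> 1}"

lemma dual_boundedD: "dual_bounded \<sigma> f c \<Longrightarrow> finsupp a \<Longrightarrow> cmod (pairing a f) \<le> c * universal_norm \<sigma> a"
  by (simp add: dual_bounded_def)

context twisted_rep
begin

lemma dual_bounded_mono: "dual_bounded \<sigma> f c \<Longrightarrow> c \<le> d \<Longrightarrow> dual_bounded \<sigma> f d"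
  unfolding dual_bounded_def by (meson mult_right_mono order_trans universal_norm_nonneg)

lemma dual_bounded_add:
  "dual_bounded \<sigma> f c \<Longrightarrow> dual_bounded \<sigma> g d \<Longrightarrow> dual_bounded \<sigma> (\<lambda>x. f x + g x) (c + d)"
  by (simp add: dual_bounded_def pairing_add distrib_right norm_triangle_mono)

lemma dual_bounded_diff:
  "dual_bounded \<sigma> f c \<Longrightarrow> dual_bounded \<sigma> g d \<Longrightarrow> dual_bounded \<sigma> (\<lambda>x. f x - g x) (c + d)"
  by (simp add: dual_bounded_def pairing_diff distrib_right)
    (meson add_mono norm_triangle_ineq4 order_trans)

lemma dual_bounded_smult: "dual_bounded \<sigma> f c \<Longrightarrow> dual_bounded \<sigma> (\<lambda>x. k * f x) (cmod k * c)"
  by (simp add: dual_bounded_def pairing_smult norm_mult mult.assoc mult_left_mono)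

lemma dual_bounded_pointwise:
  assumes "dual_bounded \<sigma> f c" "0 \<le> c"
  shows "cmod (f x) \<le> c"
  using dual_boundedD[OF assms(1) finsupp_single, of x] mult_left_mono[OF universal_norm_single assms(2), of x]
  by simp

text \<open>A pairing looks at finitely many points only, so each single inequality survives
  pointwise limits.\<close>

lemma dual_bounded_limit:
  assumes "\<And>n. n \<ge> N \<Longrightarrow> dual_bounded \<sigma> (F n) c" "\<And>x. (\<lambda>n. F n x) \<longlonglongrightarrow> f x"
  shows "dual_bounded \<sigma> f c"
  unfolding dual_bounded_def
proof (intro allI impI)
  fix a :: "'g \<Rightarrow> complex" assume a: "finsupp a"
  show "cmod (pairing a f) \<le> c * unorm a"
    using dual_boundedD[OF assms(1) a]
    by (intro LIMSEQ_le_const2[OF tendsto_norm[OF tendsto_pairing[OF assms(2)]]]) auto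
qed

lemma dual_norm_le: "dual_bounded \<sigma> f c \<Longrightarrow> 0 \<le> c \<Longrightarrow> dual_norm \<sigma> f \<le> c"
  unfolding dual_norm_def
proof (rule cSup_least)
  show "{cmod (pairing a f) |a. finsupp a \<and> unorm a \<le> 1} \<noteq> {}"
    using finsupp_zero universal_norm_zero by (auto intro!: exI[of _ "\<lambda>_. 0"])
  fix r assume "dual_bounded \<sigma> f c" "0 \<le> c" "r \<in> {cmod (pairing a f) |a. finsupp a \<and> unorm a \<le> 1}"
  then obtain a where a: "r = cmod (pairing a f)" "finsupp a" "unorm a \<le> 1" by auto
  then show "r \<le> c"
    using dual_boundedD[OF \<open>dual_bounded \<sigma> f c\<close> a(2)] mult_left_mono[OF a(3) \<open>0 \<le> c\<close>] by simp
qed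

lemma dual_norm_upper:
  assumes "dual_bounded \<sigma> f c" "finsupp a" "unorm a \<le> 1"
  shows "cmod (pairing a f) \<le> dual_norm \<sigma> f"
  unfolding dual_norm_def
proof (rule cSup_upper)
  show "bdd_above {cmod (pairing a f) |a. finsupp a \<and> unorm a \<le> 1}"
  proof (rule bdd_aboveI[of _ "\<bar>c\<bar>"])
    fix r assume "r \<in> {cmod (pairing a f) |a. finsupp a \<and> unorm a \<le> 1}"
    then obtain a where a: "r = cmod (pairing a f)" "finsupp a" "unorm a \<le> 1" by auto
    have "dual_bounded \<sigma> f \<bar>c\<bar>" using dual_bounded_mono[OF assms(1)] by simp
    then show "r \<le> \<bar>c\<bar>"
      using dual_boundedD[of \<sigma> f "\<bar>c\<bar>", OF _ a(2)] mult_left_mono[OF a(3), of "\<bar>c\<bar>"] a(1) by simp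
  qed
qed (use assms in auto)

lemma dual_norm_nonneg: "dual_bounded \<sigma> f c \<Longrightarrow> 0 \<le> dual_norm \<sigma> f"
  using dual_norm_upper[of f c "\<lambda>_. 0"] by (simp add: finsupp_zero universal_norm_zero)

lemma dual_bounded_dual_norm:
  assumes f: "dual_bounded \<sigma> f c"
  shows "dual_bounded \<sigma> f (dual_norm \<sigma> f)"
  unfolding dual_bounded_def
proof (intro allI impI)
  fix a :: "'g \<Rightarrow> complex" assume a: "finsupp a"
  show "cmod (pairing a f) \<le> dual_norm \<sigma> f * unorm a"
  \<comment> \<open>Rescaling to norm 1 is impossible here; the a priori bound \<open>c\<close>
    already makes the pairing vanish.\<close>
  proof (cases "unorm a = 0")
    case True
    then show ?thesis using dual_boundedD[OF f a] by simp
  next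
    case False
    then have pos: "0 < unorm a" using universal_norm_nonneg[OF a] by simp
    define k where "k = complex_of_real (1 / unorm a)"
    have k: "cmod k = 1 / unorm a" using pos by (simp add: k_def norm_divide)
    have "cmod (pairing (\<lambda>x. k * a x) f) \<le> dual_norm \<sigma> f"
      using universal_norm_smult[OF a, of k] pos
      by (intro dual_norm_upper[OF f] finsupp_smult a) (simp add: k)
    then show ?thesis using pos by (simp add: pairing_smult_left norm_mult k field_simps)
  qed
qed

lemma dual_norm_triangle:
  assumes "dual_bounded \<sigma> f c" "dual_bounded \<sigma> g d"
  shows "dual_norm \<sigma> (\<lambda>x. f x + g x) \<le> dual_norm \<sigma> f + dual_norm \<sigma> g"
  by (intro dual_norm_le dual_bounded_add dual_bounded_dual_norm[OF assms(1)] dual_bounded_dual_norm[OF assms(2)]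
      add_nonneg_nonneg dual_norm_nonneg[OF assms(1)] dual_norm_nonneg[OF assms(2)])

lemma dual_norm_diff_ge:
  assumes "dual_bounded \<sigma> f c" "dual_bounded \<sigma> g d" "dual_bounded \<sigma> (\<lambda>x. f x - g x) e" "0 \<le> e"
  shows "\<bar>dual_norm \<sigma> f - dual_norm \<sigma> g\<bar> \<le> e"
proof -
  have e': "dual_bounded \<sigma> (\<lambda>x. g x - f x) e"
    using dual_bounded_smult[OF assms(3), of "-1"] by simp
  have "dual_norm \<sigma> f \<le> dual_norm \<sigma> (\<lambda>x. f x - g x) + dual_norm \<sigma> g"
    using dual_norm_triangle[OF assms(3) assms(2)] by simp
  moreover have "dual_norm \<sigma> g \<le> dual_norm \<sigma> (\<lambda>x. g x - f x) + dual_norm \<sigma> f"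
    using dual_norm_triangle[OF e' assms(1)] by simp
  ultimately show ?thesis
    using dual_norm_le[OF assms(3,4)] dual_norm_le[OF e' assms(4)] by linarith
qed

lemma dual_bounded_coeff: "\<psi> \<in> V \<Longrightarrow> \<phi> \<in> V \<Longrightarrow> dual_bounded \<sigma> (coeff_fun \<pi> \<psi> \<phi>) (nrm \<psi> * nrm \<phi>)"
  by (simp add: dual_bounded_def coeff_pairing_bound)

text \<open>Pairing with \<open>b\<close> yields the pairing of the product of \<open>a\<close> and
  \<open>b\<close> with \<open>f\<close>, so submultiplicativity of the universal norm gives the
  bound.\<close>

lemma dual_bounded_translates:
  assumes f: "dual_bounded \<sigma> f c" "0 \<le> c" and a: "finsupp a"
  shows "dual_bounded \<sigma> (\<lambda>y. pairing a (\<lambda>x. \<sigma> x y * f (x + y))) (c * unorm a)"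
  unfolding dual_bounded_def
proof (intro allI impI)
  fix b :: "'g \<Rightarrow> complex" assume b: "finsupp b"
  have "pairing b (\<lambda>y. pairing a (\<lambda>x. \<sigma> x y * f (x + y)))
      = pairing a (\<lambda>x. pairing b (\<lambda>y. \<sigma> x y * f (x + y)))"
    unfolding pairing_def by (simp add: sum_distrib_left sum.swap[of _ "{y. b y \<noteq> 0}"] ac_simps)
  also have "\<dots> = pairing (twisted_conv \<sigma> a b) f" by (simp add: pairing_conv a b)
  finally have "cmod (pairing b (\<lambda>y. pairing a (\<lambda>x. \<sigma> x y * f (x + y))))
      \<le> c * unorm (twisted_conv \<sigma> a b)"
    using dual_boundedD[OF f(1) finsupp_conv[OF a b]] by simp
  also have "\<dots> \<le> c * (unorm a * unorm b)"
    by (intro mult_left_mono universal_norm_conv a b f)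
  finally show "cmod (pairing b (\<lambda>y. pairing a (\<lambda>x. \<sigma> x y * f (x + y))))
      \<le> c * unorm a * unorm b" by (simp add: ac_simps)
qed

lemma dual_bounded_star:
  assumes f: "dual_bounded \<sigma> f c"  "0 \<le> c"
  shows "dual_bounded \<sigma> (\<lambda>x. cnj (f (- x))) c"
  unfolding dual_bounded_def
proof (intro allI impI)
  fix a :: "'g \<Rightarrow> complex" assume a: "finsupp a"
  \<comment> \<open>In each representation the two operators are adjoint to each other and so share
    their bounds.\<close>
  have "unorm (alg_star a) \<le> unorm a"
  proof (rule universal_norm_leI)
    fix \<rho> :: "('g, 'g \<Rightarrow> complex) rep" and v
    assume "twisted_rep \<sigma> \<rho>" and v: "v \<in> carrier (hspace \<rho>)"
    then interpret \<rho>: twisted_rep \<sigma> \<rho> by simp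
    show "hnorm (hspace \<rho>) (alg_op \<rho> (alg_star a) v) \<le> unorm a * hnorm (hspace \<rho>) v"
      by (rule \<rho>.adj_bound[OF \<rho>.adj_alg_op[OF a] \<rho>.alg_op_bound[OF a] universal_norm_nonneg[OF a] v])
  qed (rule universal_norm_nonneg[OF a])
  moreover have "pairing a (\<lambda>x. cnj (f (- x))) = cnj (pairing (alg_star a) f)"
    by (simp add: pairing_star)
  ultimately show "cmod (pairing a (\<lambda>x. cnj (f (- x)))) \<le> c * unorm a"
    using dual_boundedD[OF f(1) finsupp_star[OF a]] mult_left_mono[of "unorm (alg_star a)" "unorm a" c] f(2)
    by simp
qed

end

section \<open>Coefficient functions of a family of representations\<close>

locale rep_family =
  fixes \<sigma> :: "'g::topological_group_add \<Rightarrow> 'g \<Rightarrow> complex" and R :: "('g, 'v) rep set"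
  assumes cocycle: "normalized_cocycle \<sigma>" and reps: "\<forall>\<pi>\<in>R. sigma_rep \<sigma> \<pi>"
    and nonempty: "R \<noteq> {}" and sums: "closed_under_direct_sums R"
begin

abbreviation B where "B \<equiv> B_space R"
abbreviation J where "J \<equiv> J_space \<sigma> R"
abbreviation N where "N \<equiv> dual_norm \<sigma>"

lemma rep: "\<pi> \<in> R \<Longrightarrow> twisted_rep \<sigma> \<pi>"
  using cocycle reps by unfold_locales auto

text \<open>The facts on the universal norm and the dual norm were proved in the presence of a
  representation. Any member of \<open>R\<close> gives access to them.\<close>

sublocale base: twisted_rep \<sigma> "SOME \<pi>. \<pi> \<in> R"
  using rep nonempty some_in_eq by blast

lemma B_cases:
  assumes "f \<in> B"
  obtains \<pi> \<psi> \<phi> where "\<pi> \<in> R" "\<psi> \<in> carrier (hspace \<pi>)" "\<phi> \<in> carrier (hspace \<pi>)" "f = coeff_fun \<pi> \<psi> \<phi>"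
  using assms by (auto simp: B_space_def)

lemma B_I: "\<pi> \<in> R \<Longrightarrow> \<psi> \<in> carrier (hspace \<pi>) \<Longrightarrow> \<phi> \<in> carrier (hspace \<pi>) \<Longrightarrow> coeff_fun \<pi> \<psi> \<phi> \<in> B"
  by (auto simp: B_space_def)

lemma B_bounded: "f \<in> B \<Longrightarrow> \<exists>c. dual_bounded \<sigma> f c"
  by (metis B_cases rep twisted_rep.dual_bounded_coeff)

lemma B_smult:
  assumes "f \<in> B"
  shows "(\<lambda>x. c * f x) \<in> B"
proof -
  obtain \<pi> \<psi> \<phi> where \<pi>: "\<pi> \<in> R" "\<psi> \<in> carrier (hspace \<pi>)" "\<phi> \<in> carrier (hspace \<pi>)" "f = coeff_fun \<pi> \<psi> \<phi>"
    using B_cases[OF assms] .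
  interpret \<pi>: twisted_rep \<sigma> \<pi> using rep \<pi> by simp
  have "(\<lambda>x. c * f x) = coeff_fun \<pi> \<psi> (c \<odot>\<^bsub>hspace \<pi>\<^esub> \<phi>)"
    using \<pi> by (simp add: coeff_fun_def fun_eq_iff \<pi>.adj_smult[OF \<pi>.adj_act] \<pi>.ip_smult)
  then show ?thesis using B_I \<pi> \<pi>.closed by metis
qed

text \<open>Closure under direct sums enters here: the sum of two coefficient functions belongs to
  the direct sum of the representations, and the unitary equivalence pulls its vectors back to a
  member of \<open>R\<close>.\<close>

lemma B_add:
  assumes "f \<in> B" "g \<in> B"
  shows "(\<lambda>x. f x + g x) \<in> B"
proof -
  obtain \<pi> \<psi> \<phi> where \<pi>: "\<pi> \<in> R" "\<psi> \<in> carrier (hspace \<pi>)" "\<phi> \<in> carrier (hspace \<pi>)" "f = coeff_fun \<pi> \<psi> \<phi>"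
    using B_cases[OF assms(1)] .
  obtain \<rho> \<psi>' \<phi>' where \<rho>: "\<rho> \<in> R" "\<psi>' \<in> carrier (hspace \<rho>)" "\<phi>' \<in> carrier (hspace \<rho>)" "g = coeff_fun \<rho> \<psi>' \<phi>'"
    using B_cases[OF assms(2)] .
  interpret \<pi>: twisted_rep \<sigma> \<pi> using rep \<pi> by simp
  interpret \<rho>: twisted_rep \<sigma> \<rho> using rep \<rho> by simp
  obtain \<tau> where \<tau>: "\<tau> \<in> R" "unitarily_equivalent \<tau> (rep_sum \<pi> \<rho>)"
    using sums \<pi> \<rho> by (auto simp: closed_under_direct_sums_def)
  interpret \<tau>: twisted_rep \<sigma> \<tau> using rep \<tau> by simp
  let ?S = "hilbert_sum (hspace \<pi>) (hspace \<rho>)"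
  obtain U where U: "U ` carrier (hspace \<tau>) = carrier ?S"
    "\<And>u v. u \<in> carrier (hspace \<tau>) \<Longrightarrow> v \<in> carrier (hspace \<tau>) \<Longrightarrow> hinner ?S (U u) (U v) = hinner (hspace \<tau>) u v"
    "\<And>x v. v \<in> carrier (hspace \<tau>) \<Longrightarrow> U (act \<tau> x v) = act (rep_sum \<pi> \<rho>) x (U v)"
    using \<tau>(2) unfolding unitarily_equivalent_def unitary_map_def rep_sum_def by auto
  have "(\<psi>, \<psi>') \<in> U ` carrier (hspace \<tau>)" "(\<phi>, \<phi>') \<in> U ` carrier (hspace \<tau>)"
    using \<pi> \<rho> by (simp_all add: U(1))
  then obtain p q where p: "p \<in> carrier (hspace \<tau>)" "U p = (\<psi>, \<psi>')" and q: "q \<in> carrier (hspace \<tau>)" "U q = (\<phi>, \<phi>')"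
    by (metis imageE)
  have "f x + g x = coeff_fun \<tau> p q x" for x
    using U(2)[OF p(1) \<tau>.act_closed[OF q(1)], of x]
    by (simp add: U(3) p q rep_sum_def \<pi>(4) \<rho>(4) coeff_fun_def)
  then have "(\<lambda>x. f x + g x) = coeff_fun \<tau> p q" by blast
  then show ?thesis using B_I \<tau>(1) p(1) q(1) by metis
qed

lemma B_diff: "f \<in> B \<Longrightarrow> g \<in> B \<Longrightarrow> (\<lambda>x. f x - g x) \<in> B"
  using B_add[OF _ B_smult[of g "-1"], of f] by simp

text \<open>Replaces the completed algebra by finitely supported functions: an element of the
  completion is a limit of such functions, and constant sequences show that each of them
  occurs.\<close>

lemma B_norm_eq:
  assumes f: "f \<in> B"
  shows "B_norm \<sigma> R f = N f"
proof -
  obtain c where c: "dual_bounded \<sigma> f c" using B_bounded[OF f] ..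
  define X where "X = {cmod (hinner (hspace \<pi>) \<psi> (group_cstar_op \<pi> A \<phi>)) | \<pi> \<psi> \<phi> A.
     \<pi> \<in> R \<and> \<psi> \<in> carrier (hspace \<pi>) \<and> \<phi> \<in> carrier (hspace \<pi>) \<and> f = coeff_fun \<pi> \<psi> \<phi> \<and>
     A \<in> twisted_group_cstar \<sigma> \<and> group_cstar_norm \<sigma> A \<le> 1}"
  have up: "r \<le> N f" if rX: "r \<in> X" for r
  proof -
    obtain \<pi> \<psi> \<phi> A where \<pi>: "\<pi> \<in> R" "\<psi> \<in> carrier (hspace \<pi>)" "\<phi> \<in> carrier (hspace \<pi>)" "f = coeff_fun \<pi> \<psi> \<phi>"
      and A: "A \<in> twisted_group_cstar \<sigma>" "group_cstar_norm \<sigma> A \<le> 1"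
      and r: "r = cmod (hinner (hspace \<pi>) \<psi> (group_cstar_op \<pi> A \<phi>))"
      using rX unfolding X_def by blast
    interpret \<pi>: twisted_rep \<sigma> \<pi> using rep \<pi> by simp
    obtain s where s: "s \<in> A" "s \<in> alg_Cauchy \<sigma>" using \<pi>.twisted_group_cstarD[OF A(1)] by metis
    have "r \<le> N f * group_cstar_norm \<sigma> A"
    proof (rule LIMSEQ_le)
      show "(\<lambda>n. cmod (pairing (s n) f)) \<longlonglongrightarrow> r"
        unfolding r \<pi>(4) by (intro tendsto_norm \<pi>.group_cstar_op_limit A s \<pi>)
      show "(\<lambda>n. N f * universal_norm \<sigma> (s n)) \<longlonglongrightarrow> N f * group_cstar_norm \<sigma> A"
        by (intro tendsto_mult_left \<pi>.group_cstar_norm_limit A s)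
    qed (use dual_boundedD[OF \<pi>.dual_bounded_dual_norm[OF c] \<pi>.alg_CauchyD(1)[OF s(2)]] in auto)
    also have "\<dots> \<le> N f * 1"
      using A(2) \<pi>.dual_norm_nonneg[OF c] by (intro mult_left_mono) auto
    finally show ?thesis by simp
  qed
  have mem: "cmod (pairing a f) \<in> X" if a: "finsupp a" "universal_norm \<sigma> a \<le> 1" for a
  proof -
    obtain \<pi> \<psi> \<phi> where \<pi>: "\<pi> \<in> R" "\<psi> \<in> carrier (hspace \<pi>)" "\<phi> \<in> carrier (hspace \<pi>)" "f = coeff_fun \<pi> \<psi> \<phi>"
      using B_cases[OF f] .
    interpret \<pi>: twisted_rep \<sigma> \<pi> using rep \<pi> by simp
    obtain A where A: "A \<in> twisted_group_cstar \<sigma>" "(\<lambda>_. a) \<in> A" using \<pi>.constant_class[OF a(1)] .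
    have "hinner (hspace \<pi>) \<psi> (group_cstar_op \<pi> A \<phi>) = pairing a f"
      using \<pi>.group_cstar_op_limit[OF A \<pi>(2,3)] by (simp add: \<pi>(4) LIMSEQ_const_iff)
    moreover have "group_cstar_norm \<sigma> A = universal_norm \<sigma> a"
      using \<pi>.group_cstar_norm_limit[OF A] by (simp add: LIMSEQ_const_iff)
    ultimately show ?thesis unfolding X_def using \<pi> A a by force
  qed
  have "Sup X \<le> N f"
    using mem[OF finsupp_zero] base.universal_norm_zero up by (intro cSup_least) auto
  moreover have "N f \<le> Sup X"
    unfolding dual_norm_def
  proof (rule cSup_least)
    show "{cmod (pairing a f) |a. finsupp a \<and> universal_norm \<sigma> a \<le> 1} \<noteq> {}"
      using finsupp_zero base.universal_norm_zero by (auto intro!: exI[of _ "\<lambda>_. 0"])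
    show "r \<le> Sup X" if "r \<in> {cmod (pairing a f) |a. finsupp a \<and> universal_norm \<sigma> a \<le> 1}" for r
      using that mem up by (intro cSup_upper) (auto intro!: bdd_aboveI[of X "N f"])
  qed
  ultimately show ?thesis by (simp add: B_norm_def X_def)
qed

lemma J_approx_close:
  assumes F: "J_approx \<sigma> R F f" and e: "0 < e"
  shows "\<exists>K. \<forall>n\<ge>K. dual_bounded \<sigma> (\<lambda>x. F n x - f x) e"
proof -
  have B: "F n \<in> B" for n using F by (simp add: J_approx_def)
  have "\<exists>K. \<forall>m\<ge>K. \<forall>n\<ge>K. N (\<lambda>x. F m x - F n x) < e"
    using F e unfolding J_approx_def dist_Cauchy_def B_norm_eq[OF B_diff[OF B B]] by blast
  then obtain K where K: "\<And>m n. m \<ge> K \<Longrightarrow> n \<ge> K \<Longrightarrow> N (\<lambda>x. F m x - F n x) < e" by blast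
  have close: "dual_bounded \<sigma> (\<lambda>x. F m x - F n x) e" if "m \<ge> K" "n \<ge> K" for m n
    using B_bounded[OF B_diff[OF B B], of m n] base.dual_bounded_dual_norm
      base.dual_bounded_mono[OF _ less_imp_le[OF K[OF that]]] by blast
  show ?thesis
  proof (intro exI[of _ K] allI impI)
    fix n assume n: "n \<ge> K"
    show "dual_bounded \<sigma> (\<lambda>x. F n x - f x) e"
    proof (rule base.dual_bounded_limit[of K "\<lambda>m x. F n x - F m x"])
      show "(\<lambda>m. F n x - F m x) \<longlonglongrightarrow> F n x - f x" for x
        using F unfolding J_approx_def by (intro tendsto_diff tendsto_const) blast
    qed (rule close[OF n])
  qed
qed

lemma J_D: "f \<in> J \<Longrightarrow> 0 < e \<Longrightarrow> \<exists>g\<in>B. dual_bounded \<sigma> (\<lambda>x. f x - g x) e"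
proof -
  assume "f \<in> J" and e: "0 < e"
  then obtain F where F: "J_approx \<sigma> R F f" by (auto simp: J_space_def)
  then obtain K where "dual_bounded \<sigma> (\<lambda>x. F K x - f x) e" using J_approx_close[OF F e] by blast
  then show ?thesis
    using base.dual_bounded_smult[of "\<lambda>x. F K x - f x" e "-1"] F by (auto simp: J_approx_def)
qed

text \<open>Together with \<open>J_D\<close> this characterises the completion by approximability
  from \<open>B\<close>, and Cauchy sequences can be avoided. Pointwise convergence is automatic
  since the dual norm dominates every value.\<close>

lemma J_I:
  assumes close: "\<And>e. 0 < e \<Longrightarrow> \<exists>g\<in>B. dual_bounded \<sigma> (\<lambda>x. f x - g x) e"
  shows "f \<in> J"
proof -
  have "\<exists>g\<in>B. dual_bounded \<sigma> (\<lambda>x. f x - g x) (inverse (real (Suc n)))" for n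
    by (rule close) simp
  then obtain F where B: "\<And>n. F n \<in> B"
    and F: "\<And>n. dual_bounded \<sigma> (\<lambda>x. f x - F n x) (inverse (real (Suc n)))" by metis
  have diff: "N (\<lambda>x. F m x - F n x) \<le> inverse (real (Suc n)) + inverse (real (Suc m))" for m n
  proof (rule base.dual_norm_le)
    show "dual_bounded \<sigma> (\<lambda>x. F m x - F n x) (inverse (real (Suc n)) + inverse (real (Suc m)))"
      using base.dual_bounded_diff[OF F[of n] F[of m]] by simp
  qed simp
  have "dist_Cauchy (\<lambda>g h. B_norm \<sigma> R (\<lambda>x. g x - h x)) F"
    unfolding dist_Cauchy_def
  proof (intro allI impI)
    fix e :: real assume "0 < e"
    then obtain K where K: "inverse (real (Suc K)) < e / 2" using reals_Archimedean[of "e / 2"] by auto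
    have "B_norm \<sigma> R (\<lambda>x. F m x - F n x) < e" if "m \<ge> K" "n \<ge> K" for m n
    proof -
      have "inverse (real (Suc m)) \<le> inverse (real (Suc K))" "inverse (real (Suc n)) \<le> inverse (real (Suc K))"
        using that by (auto intro: le_imp_inverse_le)
      then have "N (\<lambda>x. F m x - F n x) < e" using diff[of m n] K by linarith
      then show ?thesis by (simp add: B_norm_eq B_diff B)
    qed
    then show "\<exists>N. \<forall>m\<ge>N. \<forall>n\<ge>N. B_norm \<sigma> R (\<lambda>x. F m x - F n x) < e" by blast
  qed
  moreover have "(\<lambda>n. F n x) \<longlonglongrightarrow> f x" for x
  proof (rule LIM_zero_cancel, rule null_comparison[OF LIMSEQ_inverse_real_of_nat])
    show "norm (F n x - f x) \<le> inverse (real (Suc n))" for n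
      using base.dual_bounded_pointwise[OF F[of n], of x] by (simp add: norm_minus_commute)
  qed
  ultimately have "J_approx \<sigma> R F f" using B by (simp add: J_approx_def)
  then show ?thesis by (auto simp: J_space_def)
qed

lemma B_J: "f \<in> B \<Longrightarrow> f \<in> J"
  by (rule J_I, rule bexI[of _ f]) (auto simp: dual_bounded_def pairing_def base.universal_norm_nonneg)

lemma J_bounded:
  assumes "f \<in> J"
  shows "dual_bounded \<sigma> f (N f)"
proof -
  obtain g where g: "g \<in> B" "dual_bounded \<sigma> (\<lambda>x. f x - g x) 1" using J_D[OF assms, of 1] by auto
  obtain c where "dual_bounded \<sigma> g c" using B_bounded[OF g(1)] ..
  from base.dual_bounded_add[OF g(2) this] have "dual_bounded \<sigma> f (1 + c)" by simp
  then show ?thesis by (rule base.dual_bounded_dual_norm)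
qed

lemma N_nonneg: "f \<in> J \<Longrightarrow> 0 \<le> N f"
  using J_bounded base.dual_norm_nonneg by blast

text \<open>Any approximating sequence converges to \<open>f\<close> in the dual norm, so its norms
  converge; membership in \<open>J\<close> provides a sequence that pins the limit down.\<close>

lemma J_norm_eq:
  assumes f: "f \<in> J"
  shows "J_norm \<sigma> R f = N f"
  unfolding J_norm_def
proof (rule the_equality)
  have lim: "(\<lambda>n. B_norm \<sigma> R (F n)) \<longlonglongrightarrow> N f" if F: "J_approx \<sigma> R F f" for F
  proof (rule LIMSEQ_I)
    fix e :: real assume e: "0 < e"
    have B: "F n \<in> B" for n using F by (simp add: J_approx_def)
    obtain K where K: "\<And>n. n \<ge> K \<Longrightarrow> dual_bounded \<sigma> (\<lambda>x. F n x - f x) (e / 2)"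
      using J_approx_close[OF F, of "e / 2"] e by auto
    have "norm (B_norm \<sigma> R (F n) - N f) < e" if "n \<ge> K" for n
      using base.dual_norm_diff_ge[OF J_bounded[OF B_J[OF B]] J_bounded[OF f] K[OF that]] e
      by (simp add: B_norm_eq B)
    then show "\<exists>K. \<forall>n\<ge>K. norm (B_norm \<sigma> R (F n) - N f) < e" by blast
  qed
  then show "\<forall>F. J_approx \<sigma> R F f \<longrightarrow> (\<lambda>n. B_norm \<sigma> R (F n)) \<longlonglongrightarrow> N f" by blast
  fix r assume "\<forall>F. J_approx \<sigma> R F f \<longrightarrow> (\<lambda>n. B_norm \<sigma> R (F n)) \<longlonglongrightarrow> r"
  then show "r = N f" using lim f LIMSEQ_unique by (fastforce simp: J_space_def)
qed

lemma J_add: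
  assumes "f \<in> J" "g \<in> J"
  shows "(\<lambda>x. f x + g x) \<in> J"
proof (rule J_I)
  fix e :: real assume "0 < e"
  then obtain f' g' where "f' \<in> B" "dual_bounded \<sigma> (\<lambda>x. f x - f' x) (e / 2)"
    "g' \<in> B" "dual_bounded \<sigma> (\<lambda>x. g x - g' x) (e / 2)"
    using J_D[OF assms(1), of "e / 2"] J_D[OF assms(2), of "e / 2"] by auto
  then show "\<exists>h\<in>B. dual_bounded \<sigma> (\<lambda>x. (f x + g x) - h x) e"
    using base.dual_bounded_add[of "\<lambda>x. f x - f' x" "e / 2" "\<lambda>x. g x - g' x" "e / 2"]
    by (intro bexI[of _ "\<lambda>x. f' x + g' x"]) (auto simp: B_add algebra_simps)
qed

lemma J_smult:
  assumes "f \<in> J"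
  shows "(\<lambda>x. c * f x) \<in> J"
proof (rule J_I)
  fix e :: real assume "0 < e"
  moreover have pos: "0 < cmod c + 1" using norm_ge_zero[of c] by linarith
  ultimately obtain g where g: "g \<in> B" "dual_bounded \<sigma> (\<lambda>x. f x - g x) (e / (cmod c + 1))"
    using J_D[OF assms, of "e / (cmod c + 1)"] by auto
  have "cmod c * (e / (cmod c + 1)) \<le> e" using pos \<open>0 < e\<close> by (simp add: field_simps)
  from base.dual_bounded_mono[OF base.dual_bounded_smult[OF g(2), of c] this]
  show "\<exists>h\<in>B. dual_bounded \<sigma> (\<lambda>x. c * f x - h x) e"
    using B_smult[OF g(1), of c] by (intro bexI[of _ "\<lambda>x. c * g x"]) (auto simp: algebra_simps)
qed

lemma J_diff: "f \<in> J \<Longrightarrow> g \<in> J \<Longrightarrow> (\<lambda>x. f x - g x) \<in> J"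
  using J_add[OF _ J_smult[of g "-1"], of f] by simp

lemma J_zero: "(\<lambda>_. 0) \<in> J"
proof -
  obtain \<pi> where "\<pi> \<in> R" using nonempty by auto
  then interpret \<pi>: twisted_rep \<sigma> \<pi> by (rule rep)
  have "coeff_fun \<pi> \<zero>\<^bsub>hspace \<pi>\<^esub> \<zero>\<^bsub>hspace \<pi>\<^esub> \<in> J"
    using B_J[OF B_I[OF \<open>\<pi> \<in> R\<close>]] by simp
  from J_smult[OF this, of 0] show ?thesis by simp
qed

lemma B_translate:
  assumes "f \<in> B"
  shows "(\<lambda>y. \<sigma> x y * f (x + y)) \<in> B"
proof -
  obtain \<pi> \<psi> \<phi> where \<pi>: "\<pi> \<in> R" "\<psi> \<in> carrier (hspace \<pi>)" "\<phi> \<in> carrier (hspace \<pi>)" "f = coeff_fun \<pi> \<psi> \<phi>"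
    using B_cases[OF assms] .
  interpret \<pi>: twisted_rep \<sigma> \<pi> using rep \<pi> by simp
  show ?thesis using \<pi> B_I by (simp add: \<pi>.coeff_translate)
qed

lemma dual_bounded_translate:
  assumes "dual_bounded \<sigma> f c" "0 \<le> c"
  shows "dual_bounded \<sigma> (\<lambda>y. \<sigma> x y * f (x + y)) c"
  using base.dual_bounded_translates[OF assms finsupp_single, of x]
    mult_left_mono[OF base.universal_norm_single assms(2), of x] base.dual_bounded_mono by auto

text \<open>Keeps the inner argument of the convolution inside \<open>J\<close>, outside of which
  extensional functionals are undefined.\<close>

lemma J_translate:
  assumes "f \<in> J"
  shows "(\<lambda>y. \<sigma> x y * f (x + y)) \<in> J"
proof (rule J_I)
  fix e :: real assume e: "0 < e"
  then obtain g where g: "g \<in> B" "dual_bounded \<sigma> (\<lambda>x. f x - g x) e" using J_D[OF assms e] by auto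
  then show "\<exists>h\<in>B. dual_bounded \<sigma> (\<lambda>y. \<sigma> x y * f (x + y) - h y) e"
    using dual_bounded_translate[OF g(2), of x] e B_translate[OF g(1), of x]
    by (intro bexI[of _ "\<lambda>y. \<sigma> x y * g (x + y)"]) (auto simp: algebra_simps)
qed

lemma B_star:
  assumes "f \<in> B"
  shows "(\<lambda>x. cnj (f (- x))) \<in> B"
proof -
  obtain \<pi> \<psi> \<phi> where \<pi>: "\<pi> \<in> R" "\<psi> \<in> carrier (hspace \<pi>)" "\<phi> \<in> carrier (hspace \<pi>)" "f = coeff_fun \<pi> \<psi> \<phi>"
    using B_cases[OF assms] .
  interpret \<pi>: twisted_rep \<sigma> \<pi> using rep \<pi> by simp
  show ?thesis using \<pi> B_I by (simp add: \<pi>.coeff_star)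
qed

lemma J_star:
  assumes "f \<in> J"
  shows "(\<lambda>x. cnj (f (- x))) \<in> J"
proof (rule J_I)
  fix e :: real assume e: "0 < e"
  then obtain g where g: "g \<in> B" "dual_bounded \<sigma> (\<lambda>x. f x - g x) e" using J_D[OF assms e] by auto
  then show "\<exists>h\<in>B. dual_bounded \<sigma> (\<lambda>x. cnj (f (- x)) - h x) e"
    using base.dual_bounded_star[OF g(2)] e B_star[OF g(1)]
    by (intro bexI[of _ "\<lambda>x. cnj (g (- x))"]) auto
qed

lemma N_star_le: "f \<in> J \<Longrightarrow> N (\<lambda>x. cnj (f (- x))) \<le> N f"
  by (intro base.dual_norm_le base.dual_bounded_star J_bounded N_nonneg)

end

section \<open>A density theorem\<close>

text \<open>The iteration of \<open>resolvent_iteration\<close> carried out in the group algebra,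
  with the unit \<open>single 0\<close> in place of the vector. Its images approximate
  \<open>(1 + a*a)^-1\<close> in all representations at once.\<close>

primrec resolvent_poly ::
    "('g::group_add \<Rightarrow> 'g \<Rightarrow> complex) \<Rightarrow> ('g \<Rightarrow> complex) \<Rightarrow> real \<Rightarrow> nat \<Rightarrow> 'g \<Rightarrow> complex" where
  "resolvent_poly \<sigma> a K 0 = (\<lambda>_. 0)"
| "resolvent_poly \<sigma> a K (Suc n) = (\<lambda>x. resolvent_poly \<sigma> a K n x + of_real (1 / K) * (single 0 x -
      (resolvent_poly \<sigma> a K n x + twisted_conv \<sigma> (alg_star a) (twisted_conv \<sigma> a (resolvent_poly \<sigma> a K n)) x)))"

lemma finsupp_resolvent_poly: "finsupp a \<Longrightarrow> finsupp (resolvent_poly \<sigma> a K n)"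
  by (induction n) (auto simp del: of_real_divide intro!: finsupp_intros)

context twisted_rep
begin

lemma resolvent_poly_bounds:
  assumes a: "finsupp a" and v: "v \<in> V" and K: "K = 1 + (unorm (alg_star a))\<^sup>2"
  defines "w \<equiv> \<lambda>n. alg_op \<pi> (resolvent_poly \<sigma> a K n) v"
  shows "nrm (v \<ominus>\<^bsub>H\<^esub> (w n \<oplus>\<^bsub>H\<^esub> alg_op \<pi> (alg_star a) (alg_op \<pi> a (w n)))) \<le> (1 - 1 / K) ^ n * nrm v"
    and "2 * nrm (alg_op \<pi> a (w n)) \<le> (1 + (1 - 1 / K) ^ n) * nrm v"
proof -
  have w0: "w 0 = \<zero>\<^bsub>H\<^esub>" using v by (simp add: w_def alg_op_zero)
  have wS: "w (Suc n) = w n \<oplus>\<^bsub>H\<^esub> of_real (1 / K) \<odot>\<^bsub>H\<^esub>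
      (v \<ominus>\<^bsub>H\<^esub> (w n \<oplus>\<^bsub>H\<^esub> alg_op \<pi> (alg_star a) (alg_op \<pi> a (w n))))" for n
    using v by (simp add: w_def alg_op_add alg_op_smult alg_op_diff alg_op_conv alg_op_single act_zero
        finsupp_intros finsupp_resolvent_poly a alg_op_closed del: of_real_divide)
  note it = resolvent_iteration[OF adj_alg_op[OF a] v alg_op_bound[OF finsupp_star[OF a]]
      universal_norm_nonneg[OF finsupp_star[OF a]] eq_refl[OF K[symmetric]] w0 wS]
  show "nrm (v \<ominus>\<^bsub>H\<^esub> (w n \<oplus>\<^bsub>H\<^esub> alg_op \<pi> (alg_star a) (alg_op \<pi> a (w n)))) \<le> (1 - 1 / K) ^ n * nrm v"
    by (rule it(2))
  show "2 * nrm (alg_op \<pi> a (w n)) \<le> (1 + (1 - 1 / K) ^ n) * nrm v"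
    by (rule it(3))
qed

text \<open>The constant \<open>K\<close> is built from the universal norm and hence serves every
  representation. As \<open>n\<close> grows, the bound tends to 1, however large \<open>a\<close>
  is.\<close>

lemma universal_norm_resolvent_poly:
  assumes a: "finsupp a" and K: "K = 1 + (unorm (alg_star a))\<^sup>2"
  shows "unorm (\<lambda>x. 2 * twisted_conv \<sigma> a (resolvent_poly \<sigma> a K n) x) \<le> 1 + (1 - 1 / K) ^ n"
proof (rule universal_norm_leI)
  note q = finsupp_resolvent_poly[OF a]
  fix \<rho> :: "('g, 'g \<Rightarrow> complex) rep" and v
  assume "twisted_rep \<sigma> \<rho>" and v: "v \<in> carrier (hspace \<rho>)"
  then interpret \<rho>: twisted_rep \<sigma> \<rho> by simp
  show "hnorm (hspace \<rho>) (alg_op \<rho> (\<lambda>x. 2 * twisted_conv \<sigma> a (resolvent_poly \<sigma> a K n) x) v)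
      \<le> (1 + (1 - 1 / K) ^ n) * hnorm (hspace \<rho>) v"
    using \<rho>.resolvent_poly_bounds(2)[OF a v K, of n] v
    by (simp add: \<rho>.alg_op_smult \<rho>.alg_op_conv finsupp_conv a q \<rho>.alg_op_closed \<rho>.nrm_smult)
next
  have "1 \<le> K" by (simp add: K)
  then have "0 \<le> 1 - 1 / K" by simp
  then show "0 \<le> 1 + (1 - 1 / K) ^ n" by simp
qed

text \<open>\<open>S\<close> respects linear relations between two coefficient functions. This is the part of
  membership in the bicommutant that is needed below; it holds for operators defined by
  functionals on coefficient functions because a functional vanishes at \<open>0\<close>.\<close>

definition respects_coeffs :: "('v \<Rightarrow> 'v) \<Rightarrow> bool" where
  "respects_coeffs S \<longleftrightarrow> (\<forall>w\<in>V. \<forall>v\<in>V. \<forall>v'\<in>V. \<forall>w'\<in>V.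
     (\<forall>x. ip w (act \<pi> x v) + ip v' (act \<pi> x w') = 0) \<longrightarrow> ip w (S v) + ip v' (S w') = 0)"

lemma respects_coeffsD:
  "respects_coeffs S \<Longrightarrow> w \<in> V \<Longrightarrow> v \<in> V \<Longrightarrow> v' \<in> V \<Longrightarrow> w' \<in> V
    \<Longrightarrow> (\<And>x. ip w (act \<pi> x v) + ip v' (act \<pi> x w') = 0) \<Longrightarrow> ip w (S v) + ip v' (S w') = 0"
  unfolding respects_coeffs_def by blast

lemma respects_coeffsI:
  "(\<And>w v v' w'. w \<in> V \<Longrightarrow> v \<in> V \<Longrightarrow> v' \<in> V \<Longrightarrow> w' \<in> V
    \<Longrightarrow> (\<And>x. ip w (act \<pi> x v) + ip v' (act \<pi> x w') = 0) \<Longrightarrow> ip w (S v) + ip v' (S w') = 0)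
    \<Longrightarrow> respects_coeffs S"
  unfolding respects_coeffs_def by blast

lemma respects_coeffs_id: "respects_coeffs (\<lambda>v. v)"
proof (rule respects_coeffsI)
  fix w v v' w' assume V: "w \<in> V" "v \<in> V" "v' \<in> V" "w' \<in> V"
    and "\<And>x. ip w (act \<pi> x v) + ip v' (act \<pi> x w') = 0"
  from this(5)[of 0] show "ip w v + ip v' w' = 0" using V by (simp add: act_zero)
qed

lemma respects_coeffs_add:
  assumes "respects_coeffs S" "respects_coeffs T" "S \<in> V \<rightarrow> V" "T \<in> V \<rightarrow> V"
  shows "respects_coeffs (\<lambda>v. S v \<oplus>\<^bsub>H\<^esub> T v)"
proof (rule respects_coeffsI)
  fix w v v' w' assume V: "w \<in> V" "v \<in> V" "v' \<in> V" "w' \<in> V"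
    and *: "\<And>x. ip w (act \<pi> x v) + ip v' (act \<pi> x w') = 0"
  have "S v \<in> V" "T v \<in> V" "S w' \<in> V" "T w' \<in> V" using assms V by auto
  then have "ip w (S v \<oplus>\<^bsub>H\<^esub> T v) + ip v' (S w' \<oplus>\<^bsub>H\<^esub> T w')
      = (ip w (S v) + ip v' (S w')) + (ip w (T v) + ip v' (T w'))"
    using V by (simp add: ip_add)
  then show "ip w (S v \<oplus>\<^bsub>H\<^esub> T v) + ip v' (S w' \<oplus>\<^bsub>H\<^esub> T w') = 0"
    using respects_coeffsD[OF assms(1) V *] respects_coeffsD[OF assms(2) V *] by simp
qed

lemma respects_coeffs_smult:
  assumes "respects_coeffs S" "S \<in> V \<rightarrow> V"
  shows "respects_coeffs (\<lambda>v. c \<odot>\<^bsub>H\<^esub> S v)"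
proof (rule respects_coeffsI)
  fix w v v' w' assume V: "w \<in> V" "v \<in> V" "v' \<in> V" "w' \<in> V"
    and *: "\<And>x. ip w (act \<pi> x v) + ip v' (act \<pi> x w') = 0"
  have "S v \<in> V" "S w' \<in> V" using assms V by auto
  then show "ip w (c \<odot>\<^bsub>H\<^esub> S v) + ip v' (c \<odot>\<^bsub>H\<^esub> S w') = 0"
    using V respects_coeffsD[OF assms(1) V *] by (simp add: ip_smult flip: distrib_left)
qed

text \<open>A relation between coefficient functions stays valid under twisted translation. Applying
  \<open>T\<close> to each translate gives the relation at all \<open>x\<close> that
  \<open>S\<close> requires.\<close>

lemma respects_coeffs_comp:
  assumes "respects_coeffs S" "respects_coeffs T" "T \<in> V \<rightarrow> V"
  shows "respects_coeffs (\<lambda>v. S (T v))"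
proof (rule respects_coeffsI)
  fix w v v' w' assume V: "w \<in> V" "v \<in> V" "v' \<in> V" "w' \<in> V"
    and *: "\<And>x. ip w (act \<pi> x v) + ip v' (act \<pi> x w') = 0"
  have T: "T v \<in> V" "T w' \<in> V" using assms V by auto
  have "ip w (act \<pi> x (T v)) + ip v' (act \<pi> x (T w')) = 0" for x
  proof -
    have "ip (act \<pi> (- x) w) (act \<pi> y v) + ip (act \<pi> (- x) v') (act \<pi> y w') = 0" for y
      using V *[of "x + y"] by (simp add: adj_ip[OF adj_act] act_act ip_smult flip: distrib_left)
    from respects_coeffsD[OF assms(2) _ V(2) _ V(4) this] show ?thesis
      using V T by (simp add: adj_ip[OF adj_act])
  qed
  from respects_coeffsD[OF assms(1) V(1) T(1) V(3) T(2) this]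
  show "ip w (S (T v)) + ip v' (S (T w')) = 0" .
qed

text \<open>Complex conjugation exchanges left and right vectors and replaces \<open>x\<close> by
  its inverse, so the hypothesis is symmetric.\<close>

lemma respects_coeffs_adj:
  assumes S: "respects_coeffs S" and adj: "adj S S'"
  shows "respects_coeffs S'"
proof (rule respects_coeffsI)
  fix w v v' w' assume V: "w \<in> V" "v \<in> V" "v' \<in> V" "w' \<in> V"
    and *: "\<And>x. ip w (act \<pi> x v) + ip v' (act \<pi> x w') = 0"
  have "ip v (act \<pi> x w) + ip w' (act \<pi> x v') = cnj (ip w (act \<pi> (- x) v) + ip v' (act \<pi> (- x) w'))" for x
    using V ip_commute[of "act \<pi> x w" v] ip_commute[of "act \<pi> x v'" w'] by (simp add: adj_ip[OF adj_act])
  then have "ip v (S w) + ip w' (S v') = 0"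
    using * by (intro respects_coeffsD[OF S] V) simp
  moreover have "ip w (S' v) + ip v' (S' w') = cnj (ip v (S w) + ip w' (S v'))"
    using V ip_commute[of v "S w"] ip_commute[of w' "S v'"] by (simp add: adj_ip[OF adj] adj_closed[OF adj])
  ultimately show "ip w (S' v) + ip v' (S' w') = 0" by simp
qed

lemma adj_approx:
  assumes S: "respects_coeffs S" and adj: "adj S S'" and V: "\<chi> \<in> V" "\<eta> \<in> V" and e: "0 < e"
  obtains a where "finsupp a" "nrm (S \<chi> \<ominus>\<^bsub>H\<^esub> alg_op \<pi> a \<chi>) \<le> e"
    "nrm (S' \<eta> \<ominus>\<^bsub>H\<^esub> alg_op \<pi> (alg_star a) \<eta>) \<le> e"
proof -
  let ?HH = "hilbert_sum H H"
  interpret HH: hilb ?HH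
    by unfold_locales (rule hilbert_space_hilbert_sum[OF hilbert hilbert])
  have mod: "module complex_ring H" by unfold_locales
  note cl = adj_closed[OF adj]
  define k where "k a = (alg_op \<pi> a \<chi>, alg_op \<pi> (alg_star a) \<eta>)" for a
  define K where "K = k ` {a. finsupp a}"
  define s where "s = (S \<chi>, S' \<eta>)"
  have k_add: "k a \<oplus>\<^bsub>?HH\<^esub> k b = k (\<lambda>x. a x + b x)" if "finsupp a" "finsupp b" for a b
    using that V alg_op_add[OF finsupp_star[OF that(1)] finsupp_star[OF that(2)]]
    by (simp add: k_def alg_op_add alg_star_def)
  have k_smult: "of_real r \<odot>\<^bsub>?HH\<^esub> k a = k (\<lambda>x. of_real r * a x)" if "finsupp a" for a and r :: real
    using that V alg_op_smult[OF finsupp_star[OF that], of \<eta> "of_real r"]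
    by (simp add: k_def alg_op_smult alg_star_def)
  have k_zero: "k (\<lambda>_. 0) = \<zero>\<^bsub>?HH\<^esub>"
    using V by (simp add: k_def alg_star_def alg_op_zero)
  have kV: "k a \<in> carrier ?HH" if "finsupp a" for a
    using that V by (simp add: k_def alg_op_closed finsupp_star)
  have sV: "s \<in> carrier ?HH" using V cl by (simp add: s_def)
  have "\<exists>a. finsupp a \<and> hnorm ?HH (s \<ominus>\<^bsub>?HH\<^esub> k a) < e"
  proof (rule ccontr)
    assume "\<not> ?thesis"
    then have far: "e \<le> hnorm ?HH (s \<ominus>\<^bsub>?HH\<^esub> k a)" if "finsupp a" for a
      using that by (meson not_less)
    obtain w where w: "w \<in> carrier ?HH" "\<And>z. z \<in> K \<Longrightarrow> Re (hinner ?HH w z) = 0" "Re (hinner ?HH w s) > 0"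
    proof (rule HH.orthogonal_witness[of K s e])
      show "\<zero>\<^bsub>?HH\<^esub> \<in> K" unfolding K_def k_zero[symmetric] by (intro imageI) (simp add: finsupp_zero)
      show "u \<oplus>\<^bsub>?HH\<^esub> v \<in> K" if "u \<in> K" "v \<in> K" for u v
        using that by (auto simp: K_def k_add intro!: imageI finsupp_add simp del: hilbert_sum_simps)
      show "of_real r \<odot>\<^bsub>?HH\<^esub> v \<in> K" if "v \<in> K" for v and r :: real
        using that by (auto simp: K_def k_smult intro!: imageI finsupp_smult simp del: hilbert_sum_simps)
    qed (use kV sV e far in \<open>auto simp: K_def simp del: hilbert_sum_simps\<close>)
    obtain p q where pq: "w = (p, q)" "p \<in> V" "q \<in> V" using w(1) by auto
    \<comment> \<open>Conjugating the second summand makes it complex linear in \<open>a\<close> and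
      leaves the real part unchanged.\<close>
    have Re0: "Re (ip p (alg_op \<pi> a \<chi>) + ip \<eta> (alg_op \<pi> a q)) = 0" if a: "finsupp a" for a
    proof -
      have "ip \<eta> (alg_op \<pi> a q) = cnj (ip q (alg_op \<pi> (alg_star a) \<eta>))"
        using a V pq ip_commute[of "alg_op \<pi> a q" \<eta>]
        by (simp add: adj_ip[OF adj_alg_op] alg_op_closed)
      then show ?thesis
        using w(2)[of "k a"] a by (simp add: K_def k_def pq(1))
    qed
    \<comment> \<open>The elements \<open>single x\<close> and \<open>\<i>\<close> times
      \<open>single x\<close> yield the real and the imaginary part.\<close>
    have "ip p (act \<pi> x \<chi>) + ip \<eta> (act \<pi> x q) = 0" for x
      using Re0[OF finsupp_single, of x] Re0[OF finsupp_smult[OF finsupp_single, of \<i> x]] V pq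
      by (simp add: alg_op_smult finsupp_single alg_op_single ip_smult complex_eq_iff)
    then have "ip p (S \<chi>) + ip \<eta> (S q) = 0"
      by (intro respects_coeffsD[OF S] V pq)
    moreover have "ip \<eta> (S q) = cnj (ip q (S' \<eta>))"
      using V pq ip_commute[of "S q" \<eta>] by (simp add: adj_ip[OF adj] cl)
    ultimately have "Re (hinner ?HH w s) = 0"
      by (simp add: pq(1) s_def complex_eq_iff)
    then show False using w(3) by simp
  qed
  then obtain a where a: "finsupp a" "hnorm ?HH (s \<ominus>\<^bsub>?HH\<^esub> k a) < e" by blast
  let ?u = "S \<chi> \<ominus>\<^bsub>H\<^esub> alg_op \<pi> a \<chi>" and ?v = "S' \<eta> \<ominus>\<^bsub>H\<^esub> alg_op \<pi> (alg_star a) \<eta>"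
  have uv: "?u \<in> V" "?v \<in> V" using a V cl by (simp_all add: alg_op_closed finsupp_star)
  have "s \<ominus>\<^bsub>?HH\<^esub> k a = (?u, ?v)"
    unfolding s_def k_def using a V cl by (intro hilbert_sum_minus mod) (auto simp: alg_op_closed finsupp_star)
  moreover have "nrm ?u \<le> hnorm ?HH (?u, ?v)" "nrm ?v \<le> hnorm ?HH (?u, ?v)"
    using uv by (simp_all add: hnorm_def ip_self_nonneg)
  ultimately show ?thesis using that[OF a(1)] a(2) by simp
qed

text \<open>The polynomials \<open>b\<close> in \<open>a\<close> and its adjoint approximate \<open>2a(1 + a\<^sup>*a)\<inverse>\<close>, whose norm is at most 1 in
  every representation whatever \<open>a\<close> is; this controls the universal norm and not just the norm in \<open>\<pi>\<close>.\<close>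

lemma strict_contraction_functional_bound:
  assumes T: "respects_coeffs T" "adj T T'" and t: "0 \<le> t" "t < 1"
    and bT: "\<And>v. v \<in> V \<Longrightarrow> nrm (T v) \<le> t * nrm v" and V: "\<psi> \<in> V" "\<phi> \<in> V"
  shows "cmod (ip \<psi> (T \<phi>)) \<le> dual_norm \<sigma> (coeff_fun \<pi> \<psi> \<phi>)"
proof -
  let ?N = "dual_norm \<sigma> (coeff_fun \<pi> \<psi> \<phi>)"
  note Tcl = adj_closed[OF T(2)]
  have main: "cmod (ip \<psi> (T \<phi>)) \<le> ?N + e * (?N + 12 * nrm \<psi>)" if e: "0 < e" for e
  proof -
    define P where "P S S' \<longleftrightarrow> respects_coeffs S \<and> adj S S'" for S S'
    \<comment> \<open>The accuracy for \<open>S\<close> is chosen so that, after multiplication with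
      the norm of \<open>\<chi>\<close>, which is at most \<open>nrm \<phi> / (1 - t)\<close>, an
      error of at most \<open>e\<close> remains.\<close>
    have e1: "0 < e * (1 - t) / (nrm \<phi> + 1)"
      using e t nrm_nonneg[OF V(2)] by (intro divide_pos_pos mult_pos_pos) auto
    obtain S S' where P: "P S S'" and bS: "\<And>v. v \<in> V \<Longrightarrow> nrm (S v) \<le> t * nrm v" "\<And>v. v \<in> V \<Longrightarrow> nrm (S' v) \<le> t * nrm v"
      and TS: "\<And>v. v \<in> V \<Longrightarrow> nrm (T (v \<oplus>\<^bsub>H\<^esub> S' (S v)) \<ominus>\<^bsub>H\<^esub> 2 \<odot>\<^bsub>H\<^esub> S v) \<le> e * (1 - t) / (nrm \<phi> + 1) * nrm v"
    proof (rule cayley_root_approx[OF T(2) t bT _ _ _ e1, of P])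
      show "P (\<lambda>_. \<zero>\<^bsub>H\<^esub>) (\<lambda>_. \<zero>\<^bsub>H\<^esub>)"
        by (auto simp: P_def adj_def ip_zero ip_zero_left intro!: respects_coeffsI)
      show "P (\<lambda>v. of_real (1/2) \<odot>\<^bsub>H\<^esub> T (v \<oplus>\<^bsub>H\<^esub> S' (S v)))
          (\<lambda>v. of_real (1/2) \<odot>\<^bsub>H\<^esub> (T' v \<oplus>\<^bsub>H\<^esub> S' (S (T' v))))" if "P S S'" for S S'
      proof -
        have S: "respects_coeffs S" "respects_coeffs S'" "adj S S'"
          using that respects_coeffs_adj by (auto simp: P_def)
        note Scl = adj_closed[OF S(3)]
        have "respects_coeffs (\<lambda>v. of_real (1/2) \<odot>\<^bsub>H\<^esub> T (v \<oplus>\<^bsub>H\<^esub> S' (S v)))"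
          by (intro respects_coeffs_smult respects_coeffs_comp[OF T(1)] respects_coeffs_add
              respects_coeffs_id respects_coeffs_comp[OF S(2,1)]) (auto simp: Scl Tcl)
        moreover have "adj (\<lambda>v. of_real (1/2) \<odot>\<^bsub>H\<^esub> T (v \<oplus>\<^bsub>H\<^esub> S' (S v)))
            (\<lambda>v. of_real (1/2) \<odot>\<^bsub>H\<^esub> (T' v \<oplus>\<^bsub>H\<^esub> S' (S (T' v))))"
          by (auto simp: adj_def Scl Tcl ip_smult ip_smult_left ip_add ip_add_left adj_ip[OF T(2)]
              adj_ip[OF S(3), symmetric] adj_ip'[OF S(3), symmetric])
        ultimately show ?thesis by (simp add: P_def)
      qed
    qed (auto simp: P_def)
    have S: "respects_coeffs S" "adj S S'" using P by (auto simp: P_def)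
    note Scl = adj_closed[OF S(2)]
    obtain \<chi> where \<chi>: "\<chi> \<in> V" and \<chi>1: "nrm (\<phi> \<ominus>\<^bsub>H\<^esub> (\<chi> \<oplus>\<^bsub>H\<^esub> S' (S \<chi>))) \<le> e" and \<chi>2: "nrm \<chi> \<le> nrm \<phi> / (1 - t)"
      using resolvent_approx[OF S(2) t bS V(2) e] by blast
    define \<eta> where "\<eta> = S \<chi>"
    define \<zeta> where "\<zeta> = S' \<eta>"
    have VV: "\<eta> \<in> V" "\<zeta> \<in> V" using \<chi> by (simp_all add: \<eta>_def \<zeta>_def Scl)
    have T\<phi>: "nrm (T \<phi> \<ominus>\<^bsub>H\<^esub> 2 \<odot>\<^bsub>H\<^esub> \<eta>) \<le> 2 * e"
    proof -
      have "nrm (T \<phi> \<ominus>\<^bsub>H\<^esub> T (\<chi> \<oplus>\<^bsub>H\<^esub> \<zeta>)) = nrm (T (\<phi> \<ominus>\<^bsub>H\<^esub> (\<chi> \<oplus>\<^bsub>H\<^esub> \<zeta>)))"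
        using V \<chi> VV by (simp add: adj_minus[OF T(2)])
      also have "\<dots> \<le> t * nrm (\<phi> \<ominus>\<^bsub>H\<^esub> (\<chi> \<oplus>\<^bsub>H\<^esub> \<zeta>))"
        using V \<chi> VV by (intro bT) auto
      also have "\<dots> \<le> 1 * e"
        using \<chi>1 t V \<chi> VV unfolding \<zeta>_def \<eta>_def by (intro mult_mono) auto
      finally have 1: "nrm (T \<phi> \<ominus>\<^bsub>H\<^esub> T (\<chi> \<oplus>\<^bsub>H\<^esub> \<zeta>)) \<le> e" by simp
      have "nrm (T (\<chi> \<oplus>\<^bsub>H\<^esub> \<zeta>) \<ominus>\<^bsub>H\<^esub> 2 \<odot>\<^bsub>H\<^esub> \<eta>) \<le> e * (1 - t) / (nrm \<phi> + 1) * nrm \<chi>"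
        unfolding \<zeta>_def \<eta>_def by (rule TS[OF \<chi>])
      also have "\<dots> \<le> e * (1 - t) / (nrm \<phi> + 1) * (nrm \<phi> / (1 - t))"
        using \<chi>2 e1 by (intro mult_left_mono) auto
      also have "\<dots> = e * (nrm \<phi> / (nrm \<phi> + 1))" using t by simp
      also have "\<dots> \<le> e * 1" using e nrm_nonneg[OF V(2)] by (intro mult_left_mono) (auto simp: divide_le_eq)
      finally have 2: "nrm (T (\<chi> \<oplus>\<^bsub>H\<^esub> \<zeta>) \<ominus>\<^bsub>H\<^esub> 2 \<odot>\<^bsub>H\<^esub> \<eta>) \<le> e" by simp
      show ?thesis
        using nrm_minus_triangle[of "T \<phi>" "T (\<chi> \<oplus>\<^bsub>H\<^esub> \<zeta>)" "2 \<odot>\<^bsub>H\<^esub> \<eta>"] 1 2 V \<chi> VV by (simp add: Tcl)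
    qed
    obtain a where a: "finsupp a" "nrm (\<eta> \<ominus>\<^bsub>H\<^esub> alg_op \<pi> a \<chi>) \<le> e"
        "nrm (\<zeta> \<ominus>\<^bsub>H\<^esub> alg_op \<pi> (alg_star a) \<eta>) \<le> e"
      using adj_approx[OF S \<chi> VV(1) e] unfolding \<eta>_def \<zeta>_def by blast
    define l where "l = unorm (alg_star a)"
    define K where "K = 1 + l\<^sup>2"
    have l: "0 \<le> l" using universal_norm_nonneg[OF finsupp_star[OF a(1)]] by (simp add: l_def)
    define K where "K = 1 + (unorm (alg_star a))\<^sup>2"
    define \<delta> where "\<delta> = 1 - 1 / K"
    have K1: "1 \<le> K" by (simp add: K_def)
    then have \<delta>: "0 \<le> \<delta>" "\<delta> < 1" by (simp_all add: \<delta>_def)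
    have "(\<lambda>n. \<delta> ^ n * (nrm \<phi> + 1)) \<longlonglongrightarrow> 0"
      using tendsto_mult_right[OF LIMSEQ_realpow_zero[OF \<delta>], of "nrm \<phi> + 1"] by simp
    \<comment> \<open>The summand 1 lets a single \<open>n\<close> make both
      \<open>\<delta> ^ n * nrm \<phi>\<close> and \<open>\<delta> ^ n\<close> small.\<close>
    then obtain n where n: "\<delta> ^ n * (nrm \<phi> + 1) < e"
      using e by (metis (no_types, lifting) eventually_sequentially order_refl order_tendstoD(2))
    have \<delta>n: "\<delta> ^ n * nrm \<phi> \<le> e" "\<delta> ^ n \<le> e"
      using n zero_le_power[OF \<delta>(1), of n] mult_nonneg_nonneg[OF zero_le_power[OF \<delta>(1), of n] nrm_nonneg[OF V(2)]]
      by (simp_all add: distrib_left)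
    define q where "q = resolvent_poly \<sigma> a K n"
    define b where "b = (\<lambda>x. 2 * twisted_conv \<sigma> a q x)"
    define w where "w = alg_op \<pi> q \<phi>"
    have q: "finsupp q" using a(1) by (simp add: q_def finsupp_resolvent_poly)
    then have b: "finsupp b" using a(1) by (simp add: b_def finsupp_intros)
    have wV: "w \<in> V" using q V by (simp add: w_def alg_op_closed)
    have ub: "unorm b \<le> 1 + e"
      using universal_norm_resolvent_poly[OF a(1) K_def, of n] \<delta>n(2) by (simp add: b_def q_def \<delta>_def)
    have "nrm (\<phi> \<ominus>\<^bsub>H\<^esub> (w \<oplus>\<^bsub>H\<^esub> alg_op \<pi> (alg_star a) (alg_op \<pi> a w))) \<le> e"
      using resolvent_poly_bounds(1)[OF a(1) V(2) K_def, of n] \<delta>n(1) by (simp add: w_def q_def \<delta>_def)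
    then have w5: "nrm (\<eta> \<ominus>\<^bsub>H\<^esub> alg_op \<pi> a w) \<le> 5 * e"
      using \<chi>1 a(2,3) V(2) \<chi> VV wV unfolding \<eta>_def[symmetric] \<zeta>_def[symmetric]
      by (intro resolvent_perturbation[OF adj_alg_op[OF a(1)]])
    have bw: "alg_op \<pi> b \<phi> = 2 \<odot>\<^bsub>H\<^esub> alg_op \<pi> a w"
      using a(1) q V by (simp add: b_def w_def alg_op_smult alg_op_conv finsupp_conv)
    have awV: "alg_op \<pi> a w \<in> V" using a(1) wV by (simp add: alg_op_closed)
    have "2 \<odot>\<^bsub>H\<^esub> \<eta> \<ominus>\<^bsub>H\<^esub> alg_op \<pi> b \<phi> = 2 \<odot>\<^bsub>H\<^esub> (\<eta> \<ominus>\<^bsub>H\<^esub> alg_op \<pi> a w)"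
      unfolding bw by (rule ip_eqI) (use VV awV in \<open>auto simp: ip_simps algebra_simps\<close>)
    then have "nrm (2 \<odot>\<^bsub>H\<^esub> \<eta> \<ominus>\<^bsub>H\<^esub> alg_op \<pi> b \<phi>) \<le> 10 * e"
      using w5 VV awV by (simp add: nrm_smult)
    \<comment> \<open>The 12 is 2 from replacing \<open>T \<phi>\<close> by twice
      \<open>\<eta>\<close>, plus 10 from the perturbation estimate doubled.\<close>
    then have close: "nrm (T \<phi> \<ominus>\<^bsub>H\<^esub> alg_op \<pi> b \<phi>) \<le> 12 * e"
      using nrm_minus_triangle[of "T \<phi>" "2 \<odot>\<^bsub>H\<^esub> \<eta>" "alg_op \<pi> b \<phi>"] T\<phi> V VV b
      by (simp add: Tcl alg_op_closed)
    have "cmod (ip \<psi> (T \<phi>)) \<le> cmod (ip \<psi> (alg_op \<pi> b \<phi>)) + cmod (ip \<psi> (T \<phi> \<ominus>\<^bsub>H\<^esub> alg_op \<pi> b \<phi>))"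
      using norm_triangle_ineq[of "ip \<psi> (alg_op \<pi> b \<phi>)" "ip \<psi> (T \<phi> \<ominus>\<^bsub>H\<^esub> alg_op \<pi> b \<phi>)"] V b
      by (simp add: ip_minus Tcl alg_op_closed)
    also have "cmod (ip \<psi> (alg_op \<pi> b \<phi>)) \<le> ?N * (1 + e)"
      unfolding ip_alg_op[OF b V(2,1)]
      using dual_boundedD[OF dual_bounded_dual_norm[OF dual_bounded_coeff[OF V]] b]
        mult_left_mono[OF ub dual_norm_nonneg[OF dual_bounded_coeff[OF V]]] by linarith
    also have "cmod (ip \<psi> (T \<phi> \<ominus>\<^bsub>H\<^esub> alg_op \<pi> b \<phi>)) \<le> nrm \<psi> * (12 * e)"
      using Cauchy_Schwarz[of \<psi> "T \<phi> \<ominus>\<^bsub>H\<^esub> alg_op \<pi> b \<phi>"] mult_left_mono[OF close, of "nrm \<psi>"] V b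
      by (simp add: Tcl alg_op_closed)
    finally show ?thesis by (simp add: algebra_simps)
  qed
  show ?thesis
  proof (rule field_le_epsilon)
    fix r :: real assume r: "0 < r"
    let ?C = "?N + 12 * nrm \<psi>"
    have C: "0 \<le> ?C" using dual_norm_nonneg[OF dual_bounded_coeff[OF V]] V by simp
    have "r / (?C + 1) * ?C \<le> r"
      using r C by (simp add: divide_le_eq mult_left_mono)
    then show "cmod (ip \<psi> (T \<phi>)) \<le> ?N + r"
      using main[of "r / (?C + 1)"] r C by simp
  qed
qed

text \<open>Dividing by any \<open>r > c\<close> produces a strict contraction; then
  \<open>r\<close> tends to \<open>c\<close>.\<close>

lemma functional_bound:
  assumes T: "respects_coeffs T" "adj T T'" and c: "0 \<le> c"
    and bT: "\<And>v. v \<in> V \<Longrightarrow> nrm (T v) \<le> c * nrm v" and V: "\<psi> \<in> V" "\<phi> \<in> V"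
  shows "cmod (ip \<psi> (T \<phi>)) \<le> c * dual_norm \<sigma> (coeff_fun \<pi> \<psi> \<phi>)"
proof -
  let ?N = "dual_norm \<sigma> (coeff_fun \<pi> \<psi> \<phi>)"
  have le: "cmod (ip \<psi> (T \<phi>)) \<le> r * ?N" if r: "c < r" for r
  proof -
    have r0: "0 < r" using r c by simp
    let ?k = "complex_of_real (1 / r)"
    have "cmod (ip \<psi> (?k \<odot>\<^bsub>H\<^esub> T \<phi>)) \<le> ?N"
    proof (rule strict_contraction_functional_bound[where t = "c / r"])
      show "respects_coeffs (\<lambda>v. ?k \<odot>\<^bsub>H\<^esub> T v)"
        using T by (intro respects_coeffs_smult) (auto simp: adj_def)
      show "adj (\<lambda>v. ?k \<odot>\<^bsub>H\<^esub> T v) (\<lambda>v. ?k \<odot>\<^bsub>H\<^esub> T' v)"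
        by (auto simp: adj_def adj_closed[OF T(2)] ip_smult ip_smult_left adj_ip[OF T(2)])
      show "nrm (?k \<odot>\<^bsub>H\<^esub> T v) \<le> c / r * nrm v" if "v \<in> V" for v
        using bT[OF that] that r0 by (simp add: nrm_smult adj_closed[OF T(2)] norm_divide divide_right_mono)
    qed (use r r0 c V in auto)
    then show ?thesis
      using r0 V by (simp add: ip_smult adj_closed[OF T(2)] norm_mult norm_divide field_simps)
  qed
  show ?thesis
  proof (rule field_le_epsilon)
    fix e :: real assume e: "0 < e"
    have N: "0 \<le> ?N" using dual_norm_nonneg[OF dual_bounded_coeff[OF V]] .
    have "e / (?N + 1) * ?N \<le> e" using e N by (simp add: divide_le_eq mult_left_mono)
    moreover have "0 < e / (?N + 1)" using e N by simp
    ultimately show "cmod (ip \<psi> (T \<phi>)) \<le> c * ?N + e"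
      using le[of "c + e / (?N + 1)"] by (simp add: distrib_right)
  qed
qed

end

section \<open>The dual algebra\<close>

text \<open>The algebraic laws and the norm laws are inherited by restriction, and completeness
  follows from closedness under limits in \<open>D\<close>.\<close>

lemma cstar_subalgebra:
  assumes D: "is_cstar_algebra D" and sub: "S \<subseteq> carrier D"
    and closed: "\<zero>\<^bsub>D\<^esub> \<in> S" "\<And>a b. a \<in> S \<Longrightarrow> b \<in> S \<Longrightarrow> a \<oplus>\<^bsub>D\<^esub> b \<in> S"
      "\<And>a b. a \<in> S \<Longrightarrow> b \<in> S \<Longrightarrow> a \<otimes>\<^bsub>D\<^esub> b \<in> S" "\<And>c a. a \<in> S \<Longrightarrow> c \<odot>\<^bsub>D\<^esub> a \<in> S"
      "\<And>a. a \<in> S \<Longrightarrow> astar D a \<in> S"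
    and limits: "\<And>s a. a \<in> carrier D \<Longrightarrow> (\<And>n. s n \<in> S) \<Longrightarrow> (\<lambda>n. anorm D (s n \<ominus>\<^bsub>D\<^esub> a)) \<longlonglongrightarrow> 0 \<Longrightarrow> a \<in> S"
  shows "is_cstar_algebra (D\<lparr>carrier := S\<rparr>)"
proof -
  let ?S = "D\<lparr>carrier := S\<rparr>"
  have SD: "a \<in> S \<Longrightarrow> a \<in> carrier D" for a using sub by auto
  have alg: "is_star_algebra D" and nrm: "has_cstar_norm D" and compl: "complete_for D (anorm D)"
    using D by (simp_all add: is_cstar_algebra_def)
  have modD: "module complex_ring D" using alg by (simp add: is_star_algebra_def)
  interpret D: module complex_ring D by fact
  have neg: "v \<oplus>\<^bsub>D\<^esub> (-1) \<odot>\<^bsub>D\<^esub> v = \<zero>\<^bsub>D\<^esub>" if "v \<in> S" for v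
    using complex_module_minus[OF modD SD SD, of v v] that SD[OF that] by (simp add: a_minus_def D.M.r_neg)
  have modS: "module complex_ring ?S"
    by (rule module_complex_ringI)
      (use closed SD neg in \<open>auto simp: D.M.a_assoc D.smult_l_distr[simplified] D.smult_r_distr[simplified]
        D.smult_assoc1[simplified] D.smult_one[simplified] intro: D.M.a_comm\<close>)
  \<comment> \<open>The additive inverse is chosen inside the carrier, so agreement of the two
    subtractions is a fact to be proved.\<close>
  have minus: "u \<ominus>\<^bsub>?S\<^esub> v = u \<ominus>\<^bsub>D\<^esub> v" if "u \<in> S" "v \<in> S" for u v
    using complex_module_minus[OF modS, of u v] complex_module_minus[OF modD, of u v] that SD by simp
  have "complete_for ?S (anorm ?S)"
    unfolding complete_for_def dist_Cauchy_def
  proof (intro allI impI, elim conjE)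
    fix s :: "nat \<Rightarrow> _" assume "\<forall>n. s n \<in> carrier ?S"
      and C: "\<forall>e>0. \<exists>N. \<forall>m\<ge>N. \<forall>n\<ge>N. anorm ?S (s m \<ominus>\<^bsub>?S\<^esub> s n) < e"
    then have s: "s n \<in> S" for n by simp
    have "dist_Cauchy (\<lambda>u v. anorm D (u \<ominus>\<^bsub>D\<^esub> v)) s"
      using C by (simp add: dist_Cauchy_def minus s)
    with spec[OF compl[unfolded complete_for_def], of s] SD[OF s]
    have "\<exists>a\<in>carrier D. (\<lambda>n. anorm D (s n \<ominus>\<^bsub>D\<^esub> a)) \<longlonglongrightarrow> 0" by simp
    then obtain a where a: "a \<in> carrier D" "(\<lambda>n. anorm D (s n \<ominus>\<^bsub>D\<^esub> a)) \<longlonglongrightarrow> 0" ..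
    have "a \<in> S" using limits[OF a(1) s a(2)] .
    then show "\<exists>x\<in>carrier ?S. (\<lambda>n. anorm ?S (s n \<ominus>\<^bsub>?S\<^esub> x)) \<longlonglongrightarrow> 0"
      using a(2) by (intro bexI[of _ a]) (simp_all add: minus s)
  qed
  moreover have "is_star_algebra ?S"
    using alg modS closed SD by (simp add: is_star_algebra_def)
  moreover have "has_cstar_norm ?S"
    using nrm SD by (simp add: has_cstar_norm_def)
  ultimately show ?thesis by (simp add: is_cstar_algebra_def)
qed

lemma J_dual_simps [simp]:
  "carrier (J_dual \<sigma> R) = J_dual_set \<sigma> R"
  "\<zero>\<^bsub>J_dual \<sigma> R\<^esub> = (\<lambda>f\<in>J_space \<sigma> R. 0)"
  "\<xi> \<oplus>\<^bsub>J_dual \<sigma> R\<^esub> \<omega> = (\<lambda>f\<in>J_space \<sigma> R. \<xi> f + \<omega> f)"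
  "c \<odot>\<^bsub>J_dual \<sigma> R\<^esub> \<omega> = (\<lambda>f\<in>J_space \<sigma> R. c * \<omega> f)"
  "\<xi> \<otimes>\<^bsub>J_dual \<sigma> R\<^esub> \<omega> = (\<lambda>f\<in>J_space \<sigma> R. \<xi> (\<lambda>x. \<omega> (\<lambda>y. \<sigma> x y * f (x + y))))"
  "astar (J_dual \<sigma> R) \<omega> = (\<lambda>f\<in>J_space \<sigma> R. cnj (\<omega> (\<lambda>x. cnj (f (- x)))))"
  by (simp_all add: J_dual_def)

section \<open>Functionals and their norm\<close>

context rep_family
begin

abbreviation D where "D \<equiv> J_dual \<sigma> R"
abbreviation DS where "DS \<equiv> J_dual_set \<sigma> R"
abbreviation dnorm where "dnorm \<equiv> anorm (J_dual \<sigma> R)"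

lemma
  assumes "A \<in> DS"
  shows DS_ext: "A \<in> extensional J"
    and DS_add: "f \<in> J \<Longrightarrow> g \<in> J \<Longrightarrow> A (\<lambda>x. f x + g x) = A f + A g"
    and DS_smult: "f \<in> J \<Longrightarrow> A (\<lambda>x. c * f x) = c * A f"
    and DS_bound: "\<exists>C\<ge>0. \<forall>f\<in>J. cmod (A f) \<le> C * N f"
proof -
  show "A \<in> extensional J" "f \<in> J \<Longrightarrow> g \<in> J \<Longrightarrow> A (\<lambda>x. f x + g x) = A f + A g"
    "f \<in> J \<Longrightarrow> A (\<lambda>x. c * f x) = c * A f"
    using assms by (auto simp: J_dual_set_def)
  have "\<exists>C. \<forall>f\<in>J. cmod (A f) \<le> C * N f"
    using assms by (auto simp: J_dual_set_def J_norm_eq)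
  then obtain C where C: "\<And>f. f \<in> J \<Longrightarrow> cmod (A f) \<le> C * N f" by blast
  have "cmod (A f) \<le> \<bar>C\<bar> * N f" if "f \<in> J" for f
    using C[OF that] mult_right_mono[OF abs_ge_self N_nonneg[OF that], of C] by linarith
  then show "\<exists>C\<ge>0. \<forall>f\<in>J. cmod (A f) \<le> C * N f" by (intro exI[of _ "\<bar>C\<bar>"]) auto
qed

lemma DS_I:
  assumes "A \<in> extensional J"
    "\<And>f g. f \<in> J \<Longrightarrow> g \<in> J \<Longrightarrow> A (\<lambda>x. f x + g x) = A f + A g"
    "\<And>c f. f \<in> J \<Longrightarrow> A (\<lambda>x. c * f x) = c * A f"
    "\<And>f. f \<in> J \<Longrightarrow> cmod (A f) \<le> C * N f"
  shows "A \<in> DS"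
  using assms by (auto simp: J_dual_set_def J_norm_eq intro!: exI[of _ C])

lemma DS_diff: "A \<in> DS \<Longrightarrow> f \<in> J \<Longrightarrow> g \<in> J \<Longrightarrow> A (\<lambda>x. f x - g x) = A f - A g"
  using DS_add[of A f "\<lambda>x. -1 * g x"] J_smult[of g "-1"] DS_smult[of A g "-1"] by simp

lemma DS_zero: "A \<in> DS \<Longrightarrow> A (\<lambda>_. 0) = 0"
  using DS_smult[of A "\<lambda>_. 0" 0] J_zero by simp

lemma dnorm_def: "dnorm A = Sup {cmod (A f) | f. f \<in> J \<and> N f \<le> 1}"
proof -
  have "{cmod (A f) | f. f \<in> J \<and> J_norm \<sigma> R f \<le> 1} = {cmod (A f) | f. f \<in> J \<and> N f \<le> 1}"
    using J_norm_eq by force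
  then show ?thesis by (simp add: J_dual_def)
qed

lemma N_zero: "N (\<lambda>_. 0) = 0"
proof -
  have "dual_bounded \<sigma> (\<lambda>_::'g. 0) 0" by (simp add: dual_bounded_def pairing_def)
  then show ?thesis using base.dual_norm_le[of "\<lambda>_. 0" 0] N_nonneg[OF J_zero] by simp
qed

lemma dnorm_le:
  assumes "\<And>f. f \<in> J \<Longrightarrow> cmod (A f) \<le> c * N f" "0 \<le> c"
  shows "dnorm A \<le> c"
  unfolding dnorm_def
proof (rule cSup_least)
  show "{cmod (A f) | f. f \<in> J \<and> N f \<le> 1} \<noteq> {}"
    using J_zero N_zero by (auto intro!: exI[of _ "\<lambda>_. 0"])
  fix r assume "r \<in> {cmod (A f) | f. f \<in> J \<and> N f \<le> 1}"
  then obtain f where f: "r = cmod (A f)" "f \<in> J" "N f \<le> 1" by auto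
  then show "r \<le> c" using assms(1)[OF f(2)] mult_left_mono[OF f(3) assms(2)] by simp
qed

lemma
  assumes A: "A \<in> DS"
  shows dnorm_upper: "f \<in> J \<Longrightarrow> cmod (A f) \<le> dnorm A * N f" and dnorm_nonneg: "0 \<le> dnorm A"
proof -
  obtain C where C: "0 \<le> C" "\<And>f. f \<in> J \<Longrightarrow> cmod (A f) \<le> C * N f" using DS_bound[OF A] by auto
  have bdd: "bdd_above {cmod (A f) | f. f \<in> J \<and> N f \<le> 1}"
  proof (rule bdd_aboveI[of _ C])
    fix r assume "r \<in> {cmod (A f) | f. f \<in> J \<and> N f \<le> 1}"
    then obtain f where f: "r = cmod (A f)" "f \<in> J" "N f \<le> 1" by auto
    then show "r \<le> C" using C(2)[OF f(2)] mult_left_mono[OF f(3) C(1)] by simp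
  qed
  have up: "cmod (A f) \<le> dnorm A" if "f \<in> J" "N f \<le> 1" for f
    unfolding dnorm_def using that bdd by (intro cSup_upper) auto
  show "0 \<le> dnorm A" using up[OF J_zero] N_zero DS_zero[OF A] by simp
  assume f: "f \<in> J"
  show "cmod (A f) \<le> dnorm A * N f"
  proof (cases "N f = 0")
    case True
    then show ?thesis using C(2)[OF f] by simp
  next
    case False
    then have pos: "0 < N f" using N_nonneg[OF f] by simp
    define k where "k = complex_of_real (1 / N f)"
    have k: "cmod k = 1 / N f" using pos by (simp add: k_def norm_divide)
    have "N (\<lambda>x. k * f x) \<le> cmod k * N f"
      using N_nonneg[OF f] by (intro base.dual_norm_le base.dual_bounded_smult J_bounded f) auto
    then have "cmod (A (\<lambda>x. k * f x)) \<le> dnorm A"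
      using pos by (intro up J_smult f) (simp add: k)
    then show ?thesis using pos by (simp add: DS_smult[OF A f] norm_mult k field_simps)
  qed
qed

text \<open>Reduces norm bounds to genuine coefficient functions by density. Continuity with respect
  to \<open>dnorm A\<close> controls the remainder.\<close>

lemma bound_from_B:
  assumes A: "A \<in> DS" and c: "0 \<le> c" and B: "\<And>f. f \<in> B \<Longrightarrow> cmod (A f) \<le> c * N f" and f: "f \<in> J"
  shows "cmod (A f) \<le> c * N f"
proof (rule field_le_epsilon)
  fix e :: real assume e: "0 < e"
  \<comment> \<open>The total error is \<open>(c + dnorm A) * d\<close>; the added 1 keeps the
    denominator positive.\<close>
  define d where "d = e / (c + dnorm A + 1)"
  have pos: "0 < c + dnorm A + 1" using c dnorm_nonneg[OF A] by simp
  have d: "0 < d" using e pos by (simp add: d_def)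
  obtain g where g: "g \<in> B" "dual_bounded \<sigma> (\<lambda>x. f x - g x) d" using J_D[OF f d] by auto
  note gJ = B_J[OF g(1)]
  have "N (\<lambda>x. f x - g x) \<le> d" using g(2) d by (intro base.dual_norm_le) auto
  then have "dnorm A * N (\<lambda>x. f x - g x) \<le> dnorm A * d"
    using dnorm_nonneg[OF A] by (intro mult_left_mono)
  then have 1: "cmod (A f - A g) \<le> dnorm A * d"
    using dnorm_upper[OF A J_diff[OF f gJ]] by (simp add: DS_diff[OF A f gJ])
  have "N g \<le> N f + d"
    using base.dual_norm_diff_ge[OF J_bounded[OF f] J_bounded[OF gJ] g(2)] d by simp
  then have 2: "cmod (A g) \<le> c * (N f + d)"
    using B[OF g(1)] mult_left_mono[OF _ c, of "N g" "N f + d"] by simp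
  have "cmod (A f) \<le> c * N f + (c + dnorm A) * d"
    using norm_triangle_sub[of "A f" "A g"] 1 2 by (simp add: algebra_simps)
  also have "(c + dnorm A) * d \<le> e" using e pos by (simp add: d_def divide_le_eq mult.commute)
  finally show "cmod (A f) \<le> c * N f + e" by simp
qed

lemma DS_ext_eqI:
  "A \<in> DS \<Longrightarrow> A' \<in> DS \<Longrightarrow> (\<And>f. f \<in> J \<Longrightarrow> A f = A' f) \<Longrightarrow> A = A'"
  by (meson DS_ext extensionalityI)

lemma DS_zero_mem: "(\<lambda>f\<in>J. 0) \<in> DS"
  by (rule DS_I[of _ 0]) (auto simp: J_add J_smult)

lemma DS_add_mem:
  assumes "A \<in> DS" "A' \<in> DS"
  shows "(\<lambda>f\<in>J. A f + A' f) \<in> DS"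
proof (rule DS_I[of _ "dnorm A + dnorm A'"])
  show "cmod ((\<lambda>f\<in>J. A f + A' f) f) \<le> (dnorm A + dnorm A') * N f" if "f \<in> J" for f
    using norm_triangle_mono[OF dnorm_upper[OF assms(1) that] dnorm_upper[OF assms(2) that]] that
    by (simp add: distrib_right)
qed (use assms in \<open>auto simp: J_add J_smult DS_add DS_smult algebra_simps\<close>)

lemma DS_smult_mem:
  assumes "A \<in> DS"
  shows "(\<lambda>f\<in>J. c * A f) \<in> DS"
proof (rule DS_I[of _ "cmod c * dnorm A"])
  show "cmod ((\<lambda>f\<in>J. c * A f) f) \<le> cmod c * dnorm A * N f" if "f \<in> J" for f
    using mult_left_mono[OF dnorm_upper[OF assms(1) that], of "cmod c"] that
    by (simp add: norm_mult mult.assoc)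
qed (use assms in \<open>auto simp: J_add J_smult DS_add DS_smult algebra_simps\<close>)

lemma DS_star_mem:
  assumes "A \<in> DS"
  shows "(\<lambda>f\<in>J. cnj (A (\<lambda>x. cnj (f (- x))))) \<in> DS"
    and "f \<in> J \<Longrightarrow> cmod (A (\<lambda>x. cnj (f (- x)))) \<le> dnorm A * N f"
proof -
  show b: "cmod (A (\<lambda>x. cnj (f (- x)))) \<le> dnorm A * N f" if "f \<in> J" for f
    using dnorm_upper[OF assms J_star[OF that]] mult_left_mono[OF N_star_le[OF that] dnorm_nonneg[OF assms]]
    by linarith
  show "(\<lambda>f\<in>J. cnj (A (\<lambda>x. cnj (f (- x))))) \<in> DS"
    by (rule DS_I[of _ "dnorm A"])
      (use assms b in \<open>auto simp: J_add J_smult DS_add[OF assms J_star J_star] DS_smult[OF assms J_star]\<close>)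
qed

lemma DS_sum:
  assumes A: "A \<in> DS" and h: "\<And>x. x \<in> S \<Longrightarrow> h x \<in> J" and S: "finite S"
  shows "(\<lambda>y. \<Sum>x\<in>S. a x * h x y) \<in> J \<and> A (\<lambda>y. \<Sum>x\<in>S. a x * h x y) = (\<Sum>x\<in>S. a x * A (h x))"
  using S h
proof (induction S rule: finite_induct)
  case empty
  then show ?case using J_zero DS_zero[OF A] by simp
next
  case (insert x S)
  then show ?case
    using DS_add[OF A J_smult[of "h x" "a x"]] J_add[OF J_smult[of "h x" "a x"]] DS_smult[OF A, of "h x" "a x"]
    by simp
qed

text \<open>The inner function of the convolution, which then reads
  \<open>A (slice A' f)\<close>.\<close>

definition slice :: "(('g \<Rightarrow> complex) \<Rightarrow> complex) \<Rightarrow> ('g \<Rightarrow> complex) \<Rightarrow> 'g \<Rightarrow> complex" where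
  "slice A f = (\<lambda>x. A (\<lambda>y. \<sigma> x y * f (x + y)))"

text \<open>The finite sum of a pairing can be pulled through \<open>A\<close> by linearity, leaving
  \<open>A\<close> at a combination of translates whose dual norm is already bounded.\<close>

lemma slice_bounded:
  assumes A: "A \<in> DS" and f: "f \<in> J"
  shows "dual_bounded \<sigma> (slice A f) (dnorm A * N f)"
  unfolding dual_bounded_def
proof (intro allI impI)
  fix a :: "'g \<Rightarrow> complex" assume a: "finsupp a"
  let ?h = "\<lambda>y. pairing a (\<lambda>x. \<sigma> x y * f (x + y))"
  have *: "?h \<in> J \<and> A ?h = pairing a (slice A f)"
    using DS_sum[OF A, of "{x. a x \<noteq> 0}" "\<lambda>x y. \<sigma> x y * f (x + y)" a] J_translate[OF f] a
    by (simp add: pairing_def slice_def finsupp_def)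
  have "N ?h \<le> N f * universal_norm \<sigma> a"
    using a by (intro base.dual_norm_le base.dual_bounded_translates J_bounded f N_nonneg mult_nonneg_nonneg
        base.universal_norm_nonneg)
  then have "dnorm A * N ?h \<le> dnorm A * (N f * universal_norm \<sigma> a)"
    using dnorm_nonneg[OF A] by (intro mult_left_mono)
  then show "cmod (pairing a (slice A f)) \<le> dnorm A * N f * universal_norm \<sigma> a"
    using dnorm_upper[OF A, of ?h] * by (simp add: mult.assoc)
qed

lemma slice_add: "A \<in> DS \<Longrightarrow> f \<in> J \<Longrightarrow> g \<in> J \<Longrightarrow> slice A (\<lambda>x. f x + g x) = (\<lambda>x. slice A f x + slice A g x)"
  using DS_add[OF _ J_translate J_translate] by (simp add: slice_def distrib_left)

lemma slice_smult: "A \<in> DS \<Longrightarrow> f \<in> J \<Longrightarrow> slice A (\<lambda>x. c * f x) = (\<lambda>x. c * slice A f x)"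
  using DS_smult[OF _ J_translate, of A f c] by (simp add: slice_def mult.left_commute)

lemma slice_diff: "A \<in> DS \<Longrightarrow> f \<in> J \<Longrightarrow> g \<in> J \<Longrightarrow> slice A (\<lambda>x. f x - g x) = (\<lambda>x. slice A f x - slice A g x)"
  using slice_add[of A f "\<lambda>x. -1 * g x"] slice_smult[of A g "-1"] J_smult[of g "-1"] by simp

lemma DS_coeff_bound:
  assumes A: "A \<in> DS" and \<pi>: "\<pi> \<in> R" and V: "\<psi> \<in> carrier (hspace \<pi>)" "\<phi> \<in> carrier (hspace \<pi>)"
  shows "cmod (A (coeff_fun \<pi> \<psi> \<phi>)) \<le> dnorm A * (hnorm (hspace \<pi>) \<psi> * hnorm (hspace \<pi>) \<phi>)"
proof -
  interpret \<pi>: twisted_rep \<sigma> \<pi> using rep[OF \<pi>] .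
  have "N (coeff_fun \<pi> \<psi> \<phi>) \<le> \<pi>.nrm \<psi> * \<pi>.nrm \<phi>"
    using V by (intro \<pi>.dual_norm_le \<pi>.dual_bounded_coeff) auto
  from mult_left_mono[OF this dnorm_nonneg[OF A]] show ?thesis
    using dnorm_upper[OF A B_J[OF B_I[OF \<pi> V]]] by simp
qed

text \<open>For fixed \<open>\<phi>\<close> the number
  \<open>A (coeff_fun \<pi> \<psi> \<phi>)\<close> is bounded and conjugate linear in
  \<open>\<psi>\<close>. Its conjugate has a Riesz vector, which is the value of the operator at
  \<open>\<phi>\<close>.\<close>

lemma dual_op_ex1:
  assumes A: "A \<in> DS" and \<pi>: "\<pi> \<in> R"
  shows "\<exists>!T. T \<in> bounded_ops (hspace \<pi>) \<and> (\<forall>\<psi>\<in>carrier (hspace \<pi>). \<forall>\<phi>\<in>carrier (hspace \<pi>).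
        A (coeff_fun \<pi> \<psi> \<phi>) = hinner (hspace \<pi>) \<psi> (T \<phi>))"
proof -
  interpret \<pi>: twisted_rep \<sigma> \<pi> using rep[OF \<pi>] .
  note CJ = B_J[OF B_I[OF \<pi>]]
  have "\<exists>w. w \<in> \<pi>.V \<and> (\<forall>\<psi>\<in>\<pi>.V. A (coeff_fun \<pi> \<psi> \<phi>) = \<pi>.ip \<psi> w)" if \<phi>: "\<phi> \<in> \<pi>.V" for \<phi>
  proof -
    obtain w where w: "w \<in> \<pi>.V" "\<And>\<psi>. \<psi> \<in> \<pi>.V \<Longrightarrow> cnj (A (coeff_fun \<pi> \<psi> \<phi>)) = \<pi>.ip w \<psi>"
    proof (rule \<pi>.Riesz[of "\<lambda>\<psi>. cnj (A (coeff_fun \<pi> \<psi> \<phi>))" "dnorm A * \<pi>.nrm \<phi>"])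
      fix u v assume uv: "u \<in> \<pi>.V" "v \<in> \<pi>.V"
      have "coeff_fun \<pi> (u \<oplus>\<^bsub>hspace \<pi>\<^esub> v) \<phi> = (\<lambda>x. coeff_fun \<pi> u \<phi> x + coeff_fun \<pi> v \<phi> x)"
        using uv \<phi> by (simp add: coeff_fun_def \<pi>.ip_add_left)
      then show "cnj (A (coeff_fun \<pi> (u \<oplus>\<^bsub>hspace \<pi>\<^esub> v) \<phi>)) = cnj (A (coeff_fun \<pi> u \<phi>)) + cnj (A (coeff_fun \<pi> v \<phi>))"
        using DS_add[OF A CJ[OF uv(1) \<phi>] CJ[OF uv(2) \<phi>]] by simp
    next
      fix c v assume v: "v \<in> \<pi>.V"
      have "coeff_fun \<pi> (c \<odot>\<^bsub>hspace \<pi>\<^esub> v) \<phi> = (\<lambda>x. cnj c * coeff_fun \<pi> v \<phi> x)"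
        using v \<phi> by (simp add: coeff_fun_def \<pi>.ip_smult_left)
      then show "cnj (A (coeff_fun \<pi> (c \<odot>\<^bsub>hspace \<pi>\<^esub> v) \<phi>)) = c * cnj (A (coeff_fun \<pi> v \<phi>))"
        using DS_smult[OF A CJ[OF v \<phi>], of "cnj c"] by simp
    next
      fix v assume v: "v \<in> \<pi>.V"
      show "cmod (cnj (A (coeff_fun \<pi> v \<phi>))) \<le> dnorm A * \<pi>.nrm \<phi> * \<pi>.nrm v"
        using DS_coeff_bound[OF A \<pi> v \<phi>] by (simp add: ac_simps)
    qed blast
    have "A (coeff_fun \<pi> \<psi> \<phi>) = \<pi>.ip \<psi> w" if "\<psi> \<in> \<pi>.V" for \<psi>
      using w(2)[OF that] \<pi>.ip_commute[OF w(1) that] by (metis complex_cnj_cnj)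
    then show ?thesis using w(1) by blast
  qed
  then obtain T0 where T0: "\<And>\<phi>. \<phi> \<in> \<pi>.V \<Longrightarrow> T0 \<phi> \<in> \<pi>.V"
    "\<And>\<psi> \<phi>. \<psi> \<in> \<pi>.V \<Longrightarrow> \<phi> \<in> \<pi>.V \<Longrightarrow> A (coeff_fun \<pi> \<psi> \<phi>) = \<pi>.ip \<psi> (T0 \<phi>)"
    by metis
  have add: "T0 (u \<oplus>\<^bsub>hspace \<pi>\<^esub> v) = T0 u \<oplus>\<^bsub>hspace \<pi>\<^esub> T0 v" if uv: "u \<in> \<pi>.V" "v \<in> \<pi>.V" for u v
  proof (rule \<pi>.ip_eqI)
    fix w assume w: "w \<in> \<pi>.V"
    have "coeff_fun \<pi> w (u \<oplus>\<^bsub>hspace \<pi>\<^esub> v) = (\<lambda>x. coeff_fun \<pi> w u x + coeff_fun \<pi> w v x)"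
      using uv w by (simp add: coeff_fun_def \<pi>.adj_add[OF \<pi>.adj_act] \<pi>.ip_add)
    then show "\<pi>.ip w (T0 (u \<oplus>\<^bsub>hspace \<pi>\<^esub> v)) = \<pi>.ip w (T0 u \<oplus>\<^bsub>hspace \<pi>\<^esub> T0 v)"
      using DS_add[OF A CJ[OF w uv(1)] CJ[OF w uv(2)]] uv w T0(2)[OF w, symmetric] T0(1) by (simp add: \<pi>.ip_add)
  qed (use uv T0 in auto)
  have smult: "T0 (c \<odot>\<^bsub>hspace \<pi>\<^esub> v) = c \<odot>\<^bsub>hspace \<pi>\<^esub> T0 v" if v: "v \<in> \<pi>.V" for c v
  proof (rule \<pi>.ip_eqI)
    fix w assume w: "w \<in> \<pi>.V"
    have "coeff_fun \<pi> w (c \<odot>\<^bsub>hspace \<pi>\<^esub> v) = (\<lambda>x. c * coeff_fun \<pi> w v x)"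
      using v w by (simp add: coeff_fun_def \<pi>.adj_smult[OF \<pi>.adj_act] \<pi>.ip_smult)
    then show "\<pi>.ip w (T0 (c \<odot>\<^bsub>hspace \<pi>\<^esub> v)) = \<pi>.ip w (c \<odot>\<^bsub>hspace \<pi>\<^esub> T0 v)"
      using DS_smult[OF A CJ[OF w v]] v w T0(2)[OF w, symmetric] T0(1) by (simp add: \<pi>.ip_smult)
  qed (use v T0 in auto)
  have bound: "\<pi>.nrm (T0 v) \<le> dnorm A * \<pi>.nrm v" if v: "v \<in> \<pi>.V" for v
  proof (rule \<pi>.nrm_le_ipI)
    fix w assume w: "w \<in> \<pi>.V"
    show "cmod (\<pi>.ip w (T0 v)) \<le> dnorm A * \<pi>.nrm v * \<pi>.nrm w"
      using DS_coeff_bound[OF A \<pi> w v] by (simp add: T0(2)[OF w v] ac_simps)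
  qed (use v T0 dnorm_nonneg[OF A] in auto)
  show ?thesis
  proof (rule ex1I[of _ "restrict T0 \<pi>.V"])
    show "restrict T0 \<pi>.V \<in> bounded_ops (hspace \<pi>) \<and> (\<forall>\<psi>\<in>\<pi>.V. \<forall>\<phi>\<in>\<pi>.V.
        A (coeff_fun \<pi> \<psi> \<phi>) = \<pi>.ip \<psi> (restrict T0 \<pi>.V \<phi>))"
      using T0 add smult bound by (auto simp: bounded_ops_def linear_map_def intro!: exI[of _ "dnorm A"])
    fix T assume T: "T \<in> bounded_ops (hspace \<pi>) \<and> (\<forall>\<psi>\<in>\<pi>.V. \<forall>\<phi>\<in>\<pi>.V. A (coeff_fun \<pi> \<psi> \<phi>) = \<pi>.ip \<psi> (T \<phi>))"
    then have TV: "T \<in> extensional \<pi>.V" "\<And>v. v \<in> \<pi>.V \<Longrightarrow> T v \<in> \<pi>.V"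
      using \<pi>.bounded_opsD by auto
    show "T = restrict T0 \<pi>.V"
    proof (rule extensionalityI[OF TV(1) restrict_extensional])
      fix v assume v: "v \<in> \<pi>.V"
      show "T v = restrict T0 \<pi>.V v"
      proof (rule \<pi>.ip_eqI)
        show "\<pi>.ip w (T v) = \<pi>.ip w (restrict T0 \<pi>.V v)" if "w \<in> \<pi>.V" for w
          using T T0(2)[OF that v] v that by simp
      qed (use v TV T0 in auto)
    qed
  qed
qed

lemma
  assumes A: "A \<in> DS" and \<pi>: "\<pi> \<in> R"
  shows dual_op_weak: "\<psi> \<in> carrier (hspace \<pi>) \<Longrightarrow> \<phi> \<in> carrier (hspace \<pi>)
      \<Longrightarrow> A (coeff_fun \<pi> \<psi> \<phi>) = hinner (hspace \<pi>) \<psi> (dual_op \<pi> A \<phi>)"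
    and dual_op_closed: "\<phi> \<in> carrier (hspace \<pi>) \<Longrightarrow> dual_op \<pi> A \<phi> \<in> carrier (hspace \<pi>)"
  using theI'[OF dual_op_ex1[OF assms]] twisted_rep.bounded_opsD(1)[OF rep[OF \<pi>]]
  unfolding dual_op_def by blast+

lemma dual_op_eqI:
  assumes A: "A \<in> DS" and \<pi>: "\<pi> \<in> R" and \<phi>: "\<phi> \<in> carrier (hspace \<pi>)" and u: "u \<in> carrier (hspace \<pi>)"
    and eq: "\<And>\<psi>. \<psi> \<in> carrier (hspace \<pi>) \<Longrightarrow> A (coeff_fun \<pi> \<psi> \<phi>) = hinner (hspace \<pi>) \<psi> u"
  shows "dual_op \<pi> A \<phi> = u"
proof -
  interpret \<pi>: twisted_rep \<sigma> \<pi> using rep[OF \<pi>] .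
  show ?thesis
    by (rule \<pi>.ip_eqI) (use assms in \<open>auto simp: dual_op_closed simp flip: dual_op_weak\<close>)
qed

text \<open>Slicing applies \<open>\<pi>(A)\<close> to the right vector. This is the source of
  multiplicativity, and it keeps \<open>B\<close> invariant.\<close>

lemma slice_coeff:
  assumes A: "A \<in> DS" and \<pi>: "\<pi> \<in> R" and V: "\<psi> \<in> carrier (hspace \<pi>)" "\<phi> \<in> carrier (hspace \<pi>)"
  shows "slice A (coeff_fun \<pi> \<psi> \<phi>) = coeff_fun \<pi> \<psi> (dual_op \<pi> A \<phi>)"
proof -
  interpret \<pi>: twisted_rep \<sigma> \<pi> using rep[OF \<pi>] .
  have "slice A (coeff_fun \<pi> \<psi> \<phi>) x = coeff_fun \<pi> \<psi> (dual_op \<pi> A \<phi>) x" for x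
  proof -
    have "slice A (coeff_fun \<pi> \<psi> \<phi>) x = \<pi>.ip (act \<pi> (- x) \<psi>) (dual_op \<pi> A \<phi>)"
      using V by (simp add: slice_def \<pi>.coeff_translate dual_op_weak[OF A \<pi>])
    then show ?thesis
      using V by (simp add: coeff_fun_def \<pi>.adj_ip[OF \<pi>.adj_act] dual_op_closed[OF A \<pi>])
  qed
  then show ?thesis by blast
qed

text \<open>Slicing preserves \<open>B\<close> and is bounded for the dual norm, so it preserves the
  closure. This makes the convolution of functionals well defined.\<close>

lemma slice_J:
  assumes A: "A \<in> DS" and f: "f \<in> J"
  shows "slice A f \<in> J"
proof (rule J_I)
  fix e :: real assume e: "0 < e"
  define d where "d = e / (dnorm A + 1)"
  have pos: "0 < dnorm A + 1" using dnorm_nonneg[OF A] by simp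
  have d: "0 < d" using e pos by (simp add: d_def)
  obtain g where g: "g \<in> B" "dual_bounded \<sigma> (\<lambda>x. f x - g x) d" using J_D[OF f d] by auto
  note gJ = B_J[OF g(1)]
  have "N (\<lambda>x. f x - g x) \<le> d" using g(2) d by (intro base.dual_norm_le) auto
  then have "dnorm A * N (\<lambda>x. f x - g x) \<le> dnorm A * d"
    using dnorm_nonneg[OF A] by (intro mult_left_mono)
  also have "\<dots> \<le> e" using e pos by (simp add: d_def divide_le_eq mult.commute)
  finally have "dual_bounded \<sigma> (\<lambda>x. slice A f x - slice A g x) e"
    using base.dual_bounded_mono[OF slice_bounded[OF A J_diff[OF f gJ]]] by (simp add: slice_diff A f gJ)
  moreover have "slice A g \<in> B"
    using g(1) slice_coeff[OF A] B_I dual_op_closed[OF A] by (metis B_cases)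
  ultimately show "\<exists>h\<in>B. dual_bounded \<sigma> (\<lambda>x. slice A f x - h x) e" by blast
qed

lemma DS_mult_mem:
  assumes A: "A \<in> DS" and A': "A' \<in> DS"
  shows "(\<lambda>f\<in>J. A (slice A' f)) \<in> DS"
    and "f \<in> J \<Longrightarrow> cmod (A (slice A' f)) \<le> dnorm A * dnorm A' * N f"
proof -
  show b: "cmod (A (slice A' f)) \<le> dnorm A * dnorm A' * N f" if f: "f \<in> J" for f
  proof -
    have "N (slice A' f) \<le> dnorm A' * N f"
      using A' f by (intro base.dual_norm_le slice_bounded mult_nonneg_nonneg dnorm_nonneg N_nonneg)
    from mult_left_mono[OF this dnorm_nonneg[OF A]] show ?thesis
      using dnorm_upper[OF A slice_J[OF A' f]] by (simp add: mult.assoc)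
  qed
  show "(\<lambda>f\<in>J. A (slice A' f)) \<in> DS"
    by (rule DS_I[of _ "dnorm A * dnorm A'"])
      (use b A A' in \<open>auto simp: J_add J_smult slice_add slice_smult slice_J DS_add DS_smult\<close>)
qed

lemma D_mult: "A \<otimes>\<^bsub>D\<^esub> A' = (\<lambda>f\<in>J. A (slice A' f))"
  by (simp add: slice_def)

lemma D_closed:
  "\<zero>\<^bsub>D\<^esub> \<in> DS" "A \<in> DS \<Longrightarrow> A' \<in> DS \<Longrightarrow> A \<oplus>\<^bsub>D\<^esub> A' \<in> DS" "A \<in> DS \<Longrightarrow> c \<odot>\<^bsub>D\<^esub> A \<in> DS"
  "A \<in> DS \<Longrightarrow> A' \<in> DS \<Longrightarrow> A \<otimes>\<^bsub>D\<^esub> A' \<in> DS" "A \<in> DS \<Longrightarrow> astar D A \<in> DS"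
  unfolding D_mult by (simp_all add: DS_zero_mem DS_add_mem DS_smult_mem DS_mult_mem(1) DS_star_mem(1))

lemma dual_op_add:
  assumes "A \<in> DS" "A' \<in> DS" and \<pi>: "\<pi> \<in> R" and \<phi>: "\<phi> \<in> carrier (hspace \<pi>)"
  shows "dual_op \<pi> (A \<oplus>\<^bsub>D\<^esub> A') \<phi> = dual_op \<pi> A \<phi> \<oplus>\<^bsub>hspace \<pi>\<^esub> dual_op \<pi> A' \<phi>"
proof -
  interpret \<pi>: twisted_rep \<sigma> \<pi> using rep[OF \<pi>] .
  show ?thesis
    by (rule dual_op_eqI) (use assms in \<open>auto simp: DS_add_mem dual_op_closed dual_op_weak B_I B_J \<pi>.ip_add\<close>)
qed

lemma dual_op_smult:
  assumes "A \<in> DS" and \<pi>: "\<pi> \<in> R" and \<phi>: "\<phi> \<in> carrier (hspace \<pi>)"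
  shows "dual_op \<pi> (c \<odot>\<^bsub>D\<^esub> A) \<phi> = c \<odot>\<^bsub>hspace \<pi>\<^esub> dual_op \<pi> A \<phi>"
proof -
  interpret \<pi>: twisted_rep \<sigma> \<pi> using rep[OF \<pi>] .
  show ?thesis
    by (rule dual_op_eqI) (use assms in \<open>auto simp: DS_smult_mem dual_op_closed dual_op_weak B_I B_J \<pi>.ip_smult\<close>)
qed

lemma dual_op_mult:
  assumes "A \<in> DS" "A' \<in> DS" and \<pi>: "\<pi> \<in> R" and \<phi>: "\<phi> \<in> carrier (hspace \<pi>)"
  shows "dual_op \<pi> (A \<otimes>\<^bsub>D\<^esub> A') \<phi> = dual_op \<pi> A (dual_op \<pi> A' \<phi>)"
  unfolding D_mult
  by (rule dual_op_eqI) (use assms in \<open>auto simp: DS_mult_mem(1) dual_op_closed dual_op_weak B_I B_J slice_coeff\<close>)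

lemma adj_dual_op:
  assumes A: "A \<in> DS" and \<pi>: "\<pi> \<in> R"
  shows "hilb.adj (hspace \<pi>) (dual_op \<pi> A) (dual_op \<pi> (astar D A))"
proof -
  interpret \<pi>: twisted_rep \<sigma> \<pi> using rep[OF \<pi>] .
  have "\<pi>.ip (dual_op \<pi> A u) v = \<pi>.ip u (dual_op \<pi> (astar D A) v)" if "u \<in> \<pi>.V" "v \<in> \<pi>.V" for u v
    using that dual_op_weak[OF D_closed(5)[OF A] \<pi> that] dual_op_weak[OF A \<pi> that(2,1)]
      \<pi>.ip_commute[OF that(2) dual_op_closed[OF A \<pi> that(1)]]
    by (simp add: B_I B_J \<pi> \<pi>.coeff_star)
  then show ?thesis
    using dual_op_closed[OF A \<pi>] dual_op_closed[OF D_closed(5)[OF A] \<pi>] by (auto simp: \<pi>.adj_def)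
qed

lemma dual_op_bound:
  assumes A: "A \<in> DS" and \<pi>: "\<pi> \<in> R" and v: "v \<in> carrier (hspace \<pi>)"
  shows "hnorm (hspace \<pi>) (dual_op \<pi> A v) \<le> dnorm A * hnorm (hspace \<pi>) v"
proof -
  interpret \<pi>: twisted_rep \<sigma> \<pi> using rep[OF \<pi>] .
  show ?thesis
  proof (rule \<pi>.nrm_le_ipI)
    fix w assume w: "w \<in> \<pi>.V"
    show "cmod (\<pi>.ip w (dual_op \<pi> A v)) \<le> dnorm A * \<pi>.nrm v * \<pi>.nrm w"
      using DS_coeff_bound[OF A \<pi> w v] by (simp add: dual_op_weak[OF A \<pi> w v] ac_simps)
  qed (use v dual_op_closed[OF A \<pi>] dnorm_nonneg[OF A] in auto)
qed

text \<open>Every \<open>f\<close> in \<open>B\<close> is a coefficient of a single member of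
  \<open>R\<close>, so the density theorem is applied within that one representation. The relation
  it demands holds because \<open>A\<close> vanishes at the zero function.\<close>

lemma dnorm_le_dual_op:
  assumes A: "A \<in> DS" and c: "0 \<le> c"
    and b: "\<And>\<pi> v. \<pi> \<in> R \<Longrightarrow> v \<in> carrier (hspace \<pi>) \<Longrightarrow> hnorm (hspace \<pi>) (dual_op \<pi> A v) \<le> c * hnorm (hspace \<pi>) v"
  shows "dnorm A \<le> c"
proof (rule dnorm_le[OF bound_from_B[OF A c] c])
  fix f assume "f \<in> B"
  then obtain \<pi> \<psi> \<phi> where \<pi>: "\<pi> \<in> R" and V: "\<psi> \<in> carrier (hspace \<pi>)" "\<phi> \<in> carrier (hspace \<pi>)"
    and f: "f = coeff_fun \<pi> \<psi> \<phi>"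
    by (rule B_cases)
  interpret \<pi>: twisted_rep \<sigma> \<pi> using rep[OF \<pi>] .
  have "\<pi>.respects_coeffs (dual_op \<pi> A)"
  proof (rule \<pi>.respects_coeffsI)
    fix w v v' w' assume *: "w \<in> \<pi>.V" "v \<in> \<pi>.V" "v' \<in> \<pi>.V" "w' \<in> \<pi>.V"
      and "\<And>x. \<pi>.ip w (act \<pi> x v) + \<pi>.ip v' (act \<pi> x w') = 0"
    then have "(\<lambda>x. coeff_fun \<pi> w v x + coeff_fun \<pi> v' w' x) = (\<lambda>_. 0)" by (simp add: coeff_fun_def)
    then show "\<pi>.ip w (dual_op \<pi> A v) + \<pi>.ip v' (dual_op \<pi> A w') = 0"
      using DS_add[OF A B_J[OF B_I[OF \<pi> *(1,2)]] B_J[OF B_I[OF \<pi> *(3,4)]]] DS_zero[OF A] *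
      by (simp add: dual_op_weak[OF A \<pi>])
  qed
  from \<pi>.functional_bound[OF this adj_dual_op[OF A \<pi>] c b[OF \<pi>] V]
  show "cmod (A f) \<le> c * N f" by (simp add: f dual_op_weak[OF A \<pi> V])
qed

text \<open>Joint injectivity of the operators. Most of the multiplicative laws of the dual algebra
  are reduced to laws of operators by this rule.\<close>

lemma DS_eqI:
  assumes A: "A \<in> DS" "A' \<in> DS"
    and eq: "\<And>\<pi> v. \<pi> \<in> R \<Longrightarrow> v \<in> carrier (hspace \<pi>) \<Longrightarrow> dual_op \<pi> A v = dual_op \<pi> A' v"
  shows "A = A'"
proof (rule DS_ext_eqI[OF A])
  let ?E = "\<lambda>f\<in>J. A f + (\<lambda>f\<in>J. -1 * A' f) f"
  have E: "?E \<in> DS" by (intro DS_add_mem DS_smult_mem A)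
  fix f assume f: "f \<in> J"
  have "cmod (?E g) \<le> 0 * N g" if g: "g \<in> B" for g
  proof -
    obtain \<pi> \<psi> \<phi> where "\<pi> \<in> R" "\<psi> \<in> carrier (hspace \<pi>)" "\<phi> \<in> carrier (hspace \<pi>)" "g = coeff_fun \<pi> \<psi> \<phi>"
      using B_cases[OF g] .
    then have "A g = A' g" using eq by (simp add: dual_op_weak A)
    then show ?thesis using B_J[OF g] by simp
  qed
  from bound_from_B[OF E order_refl this f] show "A f = A' f" using f by simp
qed

lemma module_D: "module complex_ring D"
proof (rule module_complex_ringI)
  fix A :: "('g \<Rightarrow> complex) \<Rightarrow> complex" assume A: "A \<in> carrier D"
  show "\<zero>\<^bsub>D\<^esub> \<oplus>\<^bsub>D\<^esub> A = A" "1 \<odot>\<^bsub>D\<^esub> A = A"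
    using A D_closed by (auto intro!: DS_ext_eqI simp del: J_dual_simps(2-)) (auto simp: fun_eq_iff)
qed (use D_closed in \<open>auto simp: algebra_simps intro!: restrict_ext\<close>)

lemma D_minus: "A \<in> DS \<Longrightarrow> A' \<in> DS \<Longrightarrow> f \<in> J \<Longrightarrow> (A \<ominus>\<^bsub>D\<^esub> A') f = A f - A' f"
  using complex_module_minus[OF module_D, of A A'] by simp

lemma D_minus_mem: "A \<in> DS \<Longrightarrow> A' \<in> DS \<Longrightarrow> A \<ominus>\<^bsub>D\<^esub> A' \<in> DS"
  using complex_module_minus[OF module_D, of A A'] D_closed(2)[OF _ D_closed(3), of A A' "-1"] by simp

lemma dual_op_linear:
  assumes A: "A \<in> DS" and \<pi>: "\<pi> \<in> R"
  shows "u \<in> carrier (hspace \<pi>) \<Longrightarrow> v \<in> carrier (hspace \<pi>)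
      \<Longrightarrow> dual_op \<pi> A (u \<oplus>\<^bsub>hspace \<pi>\<^esub> v) = dual_op \<pi> A u \<oplus>\<^bsub>hspace \<pi>\<^esub> dual_op \<pi> A v"
    and "v \<in> carrier (hspace \<pi>) \<Longrightarrow> dual_op \<pi> A (c \<odot>\<^bsub>hspace \<pi>\<^esub> v) = c \<odot>\<^bsub>hspace \<pi>\<^esub> dual_op \<pi> A v"
proof -
  interpret \<pi>: twisted_rep \<sigma> \<pi> using rep[OF \<pi>] .
  show "u \<in> carrier (hspace \<pi>) \<Longrightarrow> v \<in> carrier (hspace \<pi>)
      \<Longrightarrow> dual_op \<pi> A (u \<oplus>\<^bsub>hspace \<pi>\<^esub> v) = dual_op \<pi> A u \<oplus>\<^bsub>hspace \<pi>\<^esub> dual_op \<pi> A v"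
    "v \<in> carrier (hspace \<pi>) \<Longrightarrow> dual_op \<pi> A (c \<odot>\<^bsub>hspace \<pi>\<^esub> v) = c \<odot>\<^bsub>hspace \<pi>\<^esub> dual_op \<pi> A v"
    using \<pi>.adj_add[OF adj_dual_op[OF A \<pi>]] \<pi>.adj_smult[OF adj_dual_op[OF A \<pi>]] by blast+
qed

lemma D_star_mult:
  assumes a: "a \<in> DS" and b: "b \<in> DS"
  shows "astar D (a \<otimes>\<^bsub>D\<^esub> b) = astar D b \<otimes>\<^bsub>D\<^esub> astar D a"
proof (rule DS_eqI)
  fix \<pi> v assume \<pi>: "\<pi> \<in> R" and v: "v \<in> carrier (hspace \<pi>)"
  interpret \<pi>: twisted_rep \<sigma> \<pi> using rep[OF \<pi>] .
  note ab = D_closed(4)[OF a b] and sa = D_closed(5)[OF a] and sb = D_closed(5)[OF b]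
  note cl = dual_op_closed[OF sa \<pi>] dual_op_closed[OF sb \<pi>] dual_op_closed[OF b \<pi>] dual_op_closed[OF D_closed(5)[OF ab] \<pi>]
  show "dual_op \<pi> (astar D (a \<otimes>\<^bsub>D\<^esub> b)) v = dual_op \<pi> (astar D b \<otimes>\<^bsub>D\<^esub> astar D a) v"
  proof (rule \<pi>.ip_eqI)
    fix w assume w: "w \<in> \<pi>.V"
    have "\<pi>.ip w (dual_op \<pi> (astar D (a \<otimes>\<^bsub>D\<^esub> b)) v) = \<pi>.ip (dual_op \<pi> a (dual_op \<pi> b w)) v"
      by (simp only: \<pi>.adj_ip[OF adj_dual_op[OF ab \<pi>] w v, symmetric] dual_op_mult[OF a b \<pi> w])
    also have "\<dots> = \<pi>.ip w (dual_op \<pi> (astar D b) (dual_op \<pi> (astar D a) v))"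
      by (simp only: \<pi>.adj_ip[OF adj_dual_op[OF a \<pi>] cl(3)[OF w] v] \<pi>.adj_ip[OF adj_dual_op[OF b \<pi>] w cl(1)[OF v]])
    finally show "\<pi>.ip w (dual_op \<pi> (astar D (a \<otimes>\<^bsub>D\<^esub> b)) v) = \<pi>.ip w (dual_op \<pi> (astar D b \<otimes>\<^bsub>D\<^esub> astar D a) v)"
      by (simp only: dual_op_mult[OF sb sa \<pi> v])
  qed (simp_all only: cl v dual_op_mult[OF sb sa \<pi> v])
qed (intro D_closed a b)+

text \<open>Associativity of the convolution becomes associativity of composition of operators.
  Statements on the involution alone follow from \<open>f \<mapsto> f*\<close> being an involution
  of \<open>J\<close>.\<close>

lemma is_star_algebra_D: "is_star_algebra D"
  unfolding is_star_algebra_def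
proof (intro conjI allI ballI module_D)
  fix a b c and z :: complex
  assume "a \<in> carrier D" "b \<in> carrier D"
  then have ab: "a \<in> DS" "b \<in> DS" by simp_all
  show "a \<otimes>\<^bsub>D\<^esub> b \<in> carrier D" unfolding J_dual_simps(1) by (intro D_closed ab)
  show "(z \<odot>\<^bsub>D\<^esub> a) \<otimes>\<^bsub>D\<^esub> b = z \<odot>\<^bsub>D\<^esub> (a \<otimes>\<^bsub>D\<^esub> b)"
    by (rule DS_eqI) (simp_all only: D_closed ab dual_op_mult dual_op_smult dual_op_closed)
  show "a \<otimes>\<^bsub>D\<^esub> (z \<odot>\<^bsub>D\<^esub> b) = z \<odot>\<^bsub>D\<^esub> (a \<otimes>\<^bsub>D\<^esub> b)"
    by (rule DS_eqI) (simp_all only: D_closed ab dual_op_mult dual_op_smult dual_op_closed dual_op_linear)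
  show "astar D (a \<oplus>\<^bsub>D\<^esub> b) = astar D a \<oplus>\<^bsub>D\<^esub> astar D b"
    by (rule DS_ext_eqI) (simp_all only: D_closed ab, simp add: J_star)
  show "astar D (a \<otimes>\<^bsub>D\<^esub> b) = astar D b \<otimes>\<^bsub>D\<^esub> astar D a" by (rule D_star_mult[OF ab])
  assume "c \<in> carrier D"
  then have c: "c \<in> DS" by simp
  show "(a \<otimes>\<^bsub>D\<^esub> b) \<otimes>\<^bsub>D\<^esub> c = a \<otimes>\<^bsub>D\<^esub> (b \<otimes>\<^bsub>D\<^esub> c)"
    by (rule DS_eqI) (simp_all only: D_closed ab c dual_op_mult dual_op_closed)
  show "(a \<oplus>\<^bsub>D\<^esub> b) \<otimes>\<^bsub>D\<^esub> c = a \<otimes>\<^bsub>D\<^esub> c \<oplus>\<^bsub>D\<^esub> b \<otimes>\<^bsub>D\<^esub> c"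
    by (rule DS_eqI) (simp_all only: D_closed ab c dual_op_mult dual_op_add dual_op_closed)
  show "a \<otimes>\<^bsub>D\<^esub> (b \<oplus>\<^bsub>D\<^esub> c) = a \<otimes>\<^bsub>D\<^esub> b \<oplus>\<^bsub>D\<^esub> a \<otimes>\<^bsub>D\<^esub> c"
    by (rule DS_eqI) (simp_all only: D_closed ab c dual_op_mult dual_op_add dual_op_closed dual_op_linear)
next
  fix a and z :: complex assume "a \<in> carrier D"
  then have a: "a \<in> DS" by simp
  show "astar D a \<in> carrier D" unfolding J_dual_simps(1) by (intro D_closed a)
  show "astar D (astar D a) = a"
    by (rule DS_ext_eqI) (simp_all only: D_closed a, simp add: J_star)
  show "astar D (z \<odot>\<^bsub>D\<^esub> a) = cnj z \<odot>\<^bsub>D\<^esub> astar D a"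
    by (rule DS_ext_eqI) (simp_all only: D_closed a, simp add: J_star)
qed

lemma dnorm_smult_le:
  assumes "a \<in> DS"
  shows "dnorm (z \<odot>\<^bsub>D\<^esub> a) \<le> cmod z * dnorm a"
proof (rule dnorm_le)
  show "cmod ((z \<odot>\<^bsub>D\<^esub> a) f) \<le> cmod z * dnorm a * N f" if "f \<in> J" for f
    using that mult_left_mono[OF dnorm_upper[OF assms that], of "cmod z"] by (simp add: norm_mult mult.assoc)
qed (simp add: dnorm_nonneg assms)

lemma dnorm_mult_le:
  assumes "a \<in> DS" "b \<in> DS"
  shows "dnorm (a \<otimes>\<^bsub>D\<^esub> b) \<le> dnorm a * dnorm b"
  unfolding D_mult by (rule dnorm_le) (use assms DS_mult_mem(2) in \<open>auto simp: dnorm_nonneg\<close>)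

lemma dnorm_star_le:
  assumes "a \<in> DS"
  shows "dnorm (astar D a) \<le> dnorm a"
  by (rule dnorm_le) (use assms DS_star_mem(2) in \<open>auto simp: dnorm_nonneg\<close>)

text \<open>One inequality is submultiplicativity with the isometry bound for the involution. The
  other needs the norm formula: it is obtained in each representation from
  \<open>(\<pi>(a)v, \<pi>(a)v) = (v, \<pi>(a*a)v)\<close>.\<close>

lemma dnorm_cstar_identity:
  assumes a: "a \<in> DS"
  shows "dnorm (astar D a \<otimes>\<^bsub>D\<^esub> a) = (dnorm a)\<^sup>2"
proof (rule antisym)
  note sa = D_closed(5)[OF a]
  let ?c = "dnorm (astar D a \<otimes>\<^bsub>D\<^esub> a)"
  have "?c \<le> dnorm (astar D a) * dnorm a" by (rule dnorm_mult_le[OF sa a])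
  also have "\<dots> \<le> dnorm a * dnorm a"
    by (intro mult_right_mono dnorm_star_le dnorm_nonneg a)
  finally show "?c \<le> (dnorm a)\<^sup>2" by (simp add: power2_eq_square)
  have c: "0 \<le> ?c" by (intro dnorm_nonneg D_closed a)
  have "dnorm a \<le> sqrt ?c"
  proof (rule dnorm_le_dual_op[OF a])
    fix \<pi> v assume \<pi>: "\<pi> \<in> R" and v: "v \<in> carrier (hspace \<pi>)"
    interpret \<pi>: twisted_rep \<sigma> \<pi> using rep[OF \<pi>] .
    have "(\<pi>.nrm (dual_op \<pi> a v))\<^sup>2 \<le> ?c * (\<pi>.nrm v)\<^sup>2"
    proof (rule \<pi>.adj_bound_sq[OF adj_dual_op[OF a \<pi>] c _ v])
      show "\<pi>.nrm (dual_op \<pi> (astar D a) (dual_op \<pi> a v)) \<le> ?c * \<pi>.nrm v" if v: "v \<in> \<pi>.V" for v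
        using dual_op_bound[OF D_closed(4)[OF sa a] \<pi> v] unfolding dual_op_mult[OF sa a \<pi> v] .
    qed
    then have "(\<pi>.nrm (dual_op \<pi> a v))\<^sup>2 \<le> (sqrt ?c * \<pi>.nrm v)\<^sup>2"
      using c by (simp add: power_mult_distrib del: J_dual_simps)
    then show "\<pi>.nrm (dual_op \<pi> a v) \<le> sqrt ?c * \<pi>.nrm v"
      by (rule power2_le_imp_le) (use c v in \<open>simp del: J_dual_simps\<close>)
  qed (use c in \<open>simp del: J_dual_simps\<close>)
  then have "(dnorm a)\<^sup>2 \<le> (sqrt ?c)\<^sup>2"
    using dnorm_nonneg[OF a] by (rule power_mono)
  then show "(dnorm a)\<^sup>2 \<le> ?c" using c by (simp del: J_dual_simps)
qed

lemma has_cstar_norm_D: "has_cstar_norm D"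
  unfolding has_cstar_norm_def
proof (intro conjI allI ballI)
  fix a z assume "a \<in> carrier D"
  then have a: "a \<in> DS" by simp
  show "0 \<le> dnorm a" by (rule dnorm_nonneg[OF a])
  show "dnorm a = 0 \<longleftrightarrow> a = \<zero>\<^bsub>D\<^esub>"
  proof
    assume "dnorm a = 0"
    then have "a f = 0" if "f \<in> J" for f using dnorm_upper[OF a that] by simp
    then show "a = \<zero>\<^bsub>D\<^esub>" by (intro DS_ext_eqI a D_closed) simp
  next
    assume "a = \<zero>\<^bsub>D\<^esub>"
    then have "dnorm a \<le> 0" by (intro dnorm_le) auto
    then show "dnorm a = 0" using dnorm_nonneg[OF a] by simp
  qed
  show "dnorm (astar D a \<otimes>\<^bsub>D\<^esub> a) = (dnorm a)\<^sup>2" by (rule dnorm_cstar_identity[OF a])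
  show "dnorm (z \<odot>\<^bsub>D\<^esub> a) = cmod z * dnorm a"
  proof (rule antisym[OF dnorm_smult_le[OF a]])
    have za: "z \<odot>\<^bsub>D\<^esub> a \<in> DS" by (rule D_closed(3)[OF a])
    show "cmod z * dnorm a \<le> dnorm (z \<odot>\<^bsub>D\<^esub> a)"
    proof (cases "z = 0")
      case True
      then show ?thesis using dnorm_nonneg[OF za] by simp
    next
      case False
      \<comment> \<open>Undoing the scalar turns the upper estimate into the lower one.\<close>
      have "(1 / z) \<odot>\<^bsub>D\<^esub> (z \<odot>\<^bsub>D\<^esub> a) = a"
        using False by (intro DS_ext_eqI D_closed a) simp
      then have "dnorm a \<le> cmod (1 / z) * dnorm (z \<odot>\<^bsub>D\<^esub> a)"
        using dnorm_smult_le[OF za, of "1 / z"] by metis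
      then show ?thesis using False by (simp add: norm_divide field_simps del: J_dual_simps)
    qed
  qed
next
  fix a b assume "a \<in> carrier D" "b \<in> carrier D"
  then have ab: "a \<in> DS" "b \<in> DS" by simp_all
  show "dnorm (a \<otimes>\<^bsub>D\<^esub> b) \<le> dnorm a * dnorm b" by (rule dnorm_mult_le[OF ab])
  show "dnorm (a \<oplus>\<^bsub>D\<^esub> b) \<le> dnorm a + dnorm b"
  proof (rule dnorm_le)
    show "cmod ((a \<oplus>\<^bsub>D\<^esub> b) f) \<le> (dnorm a + dnorm b) * N f" if "f \<in> J" for f
      using norm_triangle_mono[OF dnorm_upper[OF ab(1) that] dnorm_upper[OF ab(2) that]] that
      by (simp add: distrib_right)
  qed (simp add: dnorm_nonneg ab)
qed

text \<open>The usual completeness of a dual space: values converge at each point of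
  \<open>J\<close>, and the Cauchy estimate survives the pointwise limit.\<close>

lemma complete_D: "complete_for D dnorm"
  unfolding complete_for_def dist_Cauchy_def
proof (intro allI impI, elim conjE)
  fix s :: "nat \<Rightarrow> _" assume "\<forall>n. s n \<in> carrier D"
    and C: "\<forall>e>0. \<exists>K. \<forall>m\<ge>K. \<forall>n\<ge>K. dnorm (s m \<ominus>\<^bsub>D\<^esub> s n) < e"
  then have s: "s n \<in> DS" for n by simp
  have diff: "cmod (s m f - s n f) \<le> dnorm (s m \<ominus>\<^bsub>D\<^esub> s n) * N f" if f: "f \<in> J" for m n f
    using dnorm_upper[OF D_minus_mem[OF s s] f, of m n] D_minus[OF s s f, of m n] by simp
  have "convergent (\<lambda>n. s n f)" if f: "f \<in> J" for f
  proof (rule Cauchy_convergent, rule CauchyI)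
    fix e :: real assume e: "0 < e"
    have pos: "0 < N f + 1" using N_nonneg[OF f] by simp
    then obtain K where K: "\<And>m n. m \<ge> K \<Longrightarrow> n \<ge> K \<Longrightarrow> dnorm (s m \<ominus>\<^bsub>D\<^esub> s n) < e / (N f + 1)"
      using C e by (metis divide_pos_pos)
    have "norm (s m f - s n f) < e" if "m \<ge> K" "n \<ge> K" for m n
    proof -
      have "norm (s m f - s n f) \<le> e / (N f + 1) * N f"
        using diff[OF f, of m n] mult_right_mono[OF less_imp_le[OF K[OF that]] N_nonneg[OF f]] by linarith
      also have "\<dots> < e" using pos e by (simp add: field_simps)
      finally show ?thesis .
    qed
    then show "\<exists>K. \<forall>m\<ge>K. \<forall>n\<ge>K. norm (s m f - s n f) < e" by blast
  qed
  then obtain A0 where A0: "\<And>f. f \<in> J \<Longrightarrow> (\<lambda>n. s n f) \<longlonglongrightarrow> A0 f"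
    unfolding convergent_def by metis
  define A where "A = restrict A0 J"
  have A: "(\<lambda>n. s n f) \<longlonglongrightarrow> A f" if "f \<in> J" for f using A0 that by (simp add: A_def)
  have close: "cmod (s m f - A f) \<le> e * N f"
    if K: "\<And>m n. m \<ge> K \<Longrightarrow> n \<ge> K \<Longrightarrow> dnorm (s m \<ominus>\<^bsub>D\<^esub> s n) < e" and m: "m \<ge> K" and f: "f \<in> J" for e K m f
  proof (rule LIMSEQ_le_const2)
    show "(\<lambda>n. cmod (s m f - s n f)) \<longlonglongrightarrow> cmod (s m f - A f)"
      by (intro tendsto_norm tendsto_diff tendsto_const A f)
    have "cmod (s m f - s n f) \<le> e * N f" if "n \<ge> K" for n
      using diff[OF f, of m n] mult_right_mono[OF less_imp_le[OF K[OF m that]] N_nonneg[OF f]] by linarith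
    then show "\<exists>K. \<forall>n\<ge>K. cmod (s m f - s n f) \<le> e * N f" by blast
  qed
  have A_mem: "A \<in> DS"
  proof -
    obtain K where K: "\<And>m n. m \<ge> K \<Longrightarrow> n \<ge> K \<Longrightarrow> dnorm (s m \<ominus>\<^bsub>D\<^esub> s n) < 1"
      using C zero_less_one by blast
    show ?thesis
    proof (rule DS_I[of _ "dnorm (s K) + 1"])
      show "A \<in> extensional J" by (simp add: A_def)
      show "A (\<lambda>x. f x + g x) = A f + A g" if "f \<in> J" "g \<in> J" for f g
        using A[OF J_add[OF that]] tendsto_add[OF A[OF that(1)] A[OF that(2)]] LIMSEQ_unique
        by (simp add: DS_add[OF s that])
      show "A (\<lambda>x. c * f x) = c * A f" if "f \<in> J" for c f
        using A[OF J_smult[OF that], of c] tendsto_mult_left[OF A[OF that], of c]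
        unfolding DS_smult[OF s that] by (rule LIMSEQ_unique)
      show "cmod (A f) \<le> (dnorm (s K) + 1) * N f" if f: "f \<in> J" for f
        using close[where K = K and m = K and e = 1, OF K order_refl f] dnorm_upper[OF s f, of K]
          norm_triangle_ineq4[of "s K f" "s K f - A f"] by (simp add: distrib_right)
    qed
  qed
  have "(\<lambda>n. dnorm (s n \<ominus>\<^bsub>D\<^esub> A)) \<longlonglongrightarrow> 0"
  proof (rule LIMSEQ_I)
    fix e :: real assume e: "0 < e"
    then obtain K where K: "\<And>m n. m \<ge> K \<Longrightarrow> n \<ge> K \<Longrightarrow> dnorm (s m \<ominus>\<^bsub>D\<^esub> s n) < e / 2"
      using C half_gt_zero by metis
    have "norm (dnorm (s n \<ominus>\<^bsub>D\<^esub> A) - 0) < e" if n: "n \<ge> K" for n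
    proof -
      have "dnorm (s n \<ominus>\<^bsub>D\<^esub> A) \<le> e / 2"
        by (rule dnorm_le) (use close[OF K n] D_minus[OF s A_mem] e in auto)
      then show ?thesis using dnorm_nonneg[OF D_minus_mem[OF s A_mem]] e by simp
    qed
    then show "\<exists>K. \<forall>n\<ge>K. norm (dnorm (s n \<ominus>\<^bsub>D\<^esub> A) - 0) < e" by blast
  qed
  then show "\<exists>x\<in>carrier D. (\<lambda>n. dnorm (s n \<ominus>\<^bsub>D\<^esub> x)) \<longlonglongrightarrow> 0"
    using A_mem by auto
qed

lemma is_cstar_algebra_D: "is_cstar_algebra D"
  using is_star_algebra_D has_cstar_norm_D complete_D by (simp add: is_cstar_algebra_def)

lemma d_ideal_cstar:
  assumes "d_ideal \<sigma> R S"
  shows "is_cstar_algebra (D\<lparr>carrier := S\<rparr>)"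
  by (rule cstar_subalgebra[OF is_cstar_algebra_D])
    (use assms in \<open>simp_all only: d_ideal_def Let_def, blast+\<close>)

text \<open>Boundedness is part of the claim because it gives the real supremum its meaning.\<close>

lemma op_norm_dual_op:
  assumes A: "A \<in> DS"
  shows "bdd_above ((\<lambda>\<pi>. op_norm (hspace \<pi>) (dual_op \<pi> A)) ` R)"
    and "dnorm A = (SUP \<pi>\<in>R. op_norm (hspace \<pi>) (dual_op \<pi> A))"
proof -
  have le: "op_norm (hspace \<pi>) (dual_op \<pi> A) \<le> dnorm A" if \<pi>: "\<pi> \<in> R" for \<pi>
  proof -
    interpret \<pi>: twisted_rep \<sigma> \<pi> using rep[OF \<pi>] .
    show ?thesis by (intro \<pi>.op_norm_le dual_op_bound A \<pi> dnorm_nonneg)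
  qed
  show bdd: "bdd_above ((\<lambda>\<pi>. op_norm (hspace \<pi>) (dual_op \<pi> A)) ` R)"
    using le by (intro bdd_aboveI2)
  let ?c = "SUP \<pi>\<in>R. op_norm (hspace \<pi>) (dual_op \<pi> A)"
  have op: "hnorm (hspace \<pi>) (dual_op \<pi> A v) \<le> ?c * hnorm (hspace \<pi>) v" "0 \<le> ?c"
    if \<pi>: "\<pi> \<in> R" and v: "v \<in> carrier (hspace \<pi>)" for \<pi> v
  proof -
    interpret \<pi>: twisted_rep \<sigma> \<pi> using rep[OF \<pi>] .
    have up: "op_norm (hspace \<pi>) (dual_op \<pi> A) \<le> ?c" using bdd \<pi> by (intro cSUP_upper)
    have map: "dual_op \<pi> A \<in> \<pi>.V \<rightarrow> \<pi>.V" using dual_op_closed[OF A \<pi>] by auto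
    have b: "\<pi>.nrm (dual_op \<pi> A v) \<le> op_norm (hspace \<pi>) (dual_op \<pi> A) * \<pi>.nrm v"
      "0 \<le> op_norm (hspace \<pi>) (dual_op \<pi> A)"
      by (rule \<pi>.op_norm_bound[OF map]; use v dual_op_linear(2)[OF A \<pi>] dual_op_bound[OF A \<pi>] in blast)+
    show "0 \<le> ?c" using b(2) up by linarith
    show "hnorm (hspace \<pi>) (dual_op \<pi> A v) \<le> ?c * hnorm (hspace \<pi>) v"
      using b(1) mult_right_mono[OF up \<pi>.nrm_nonneg[OF v]] by linarith
  qed
  have "0 \<le> ?c"
  proof -
    obtain \<pi> where \<pi>: "\<pi> \<in> R" using nonempty by auto
    interpret \<pi>: twisted_rep \<sigma> \<pi> using rep[OF \<pi>] .
    show ?thesis using op(2)[OF \<pi> \<pi>.closed(1)] .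
  qed
  then have "dnorm A \<le> ?c" using op(1) by (intro dnorm_le_dual_op A)
  moreover have "?c \<le> dnorm A" using le nonempty by (intro cSUP_least)
  ultimately show "dnorm A = ?c" by simp
qed

end

theorem theorem3p6:
  fixes \<sigma> :: "'g::{topological_group_add, t2_space} \<Rightarrow> 'g \<Rightarrow> complex"
    and R :: "('g, 'v) rep set"
  assumes nondiscrete: "\<exists>S :: 'g set. \<not> open S"
    and cocycle: "normalized_cocycle \<sigma>"
    and reps: "\<forall>\<pi>\<in>R. sigma_rep \<sigma> \<pi>"
    and nonempty: "R \<noteq> {}"
    and sums: "closed_under_direct_sums R"
  shows "(\<forall>A\<in>carrier (J_dual \<sigma> R).
            bdd_above ((\<lambda>\<pi>. op_norm (hspace \<pi>) (dual_op \<pi> A)) ` R) \<and>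
            anorm (J_dual \<sigma> R) A = (SUP \<pi>\<in>R. op_norm (hspace \<pi>) (dual_op \<pi> A))) \<and>
         has_cstar_norm (J_dual \<sigma> R) \<and>
         is_cstar_algebra (J_dual \<sigma> R) \<and>
         (\<forall>\<A>. d_ideal \<sigma> R \<A> \<longrightarrow> is_cstar_algebra ((J_dual \<sigma> R)\<lparr>carrier := \<A>\<rparr>))"
proof -
  interpret rep_family \<sigma> R
    using cocycle reps nonempty sums by unfold_locales
  show ?thesis
    using op_norm_dual_op has_cstar_norm_D is_cstar_algebra_D d_ideal_cstar by auto
qed

end
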